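(* Let $G$ be a plane elementary bipartite graph whose infinite face is forcing, with a reducible face decomposition $\mathrm{RFD}(G_1,\dots,G_n)$ associated with finite faces $s_1,\dots,s_n$ ($n\ge1$), $s_i$ a reducible face of $G_i$ for $2\le i\le n$. Run the following algorithm: set $\mathbf{L_1}=\{0,1\}$; for $i=1,\dots,n-1$, let $P_{i+1}$ be the common periphery of $s_{i+1}$ and $G_{i+1}$; if, along the clockwise orientation of the periphery of $G_{i+1}$, the two end vertices of $P_{i+1}$ are colored white and black respectively, set $$\mathbf{L_{i+1}}=\{x0: x\in\mathbf{L_i}\}\cup\{x1: x\in\mathbf{L_i},\ (x)_j=1 \text{ for all } j \text{ such that } s_j \text{ is a finite face of } G_i \text{ having common edges with } s_{i+1}\};$$ otherwise set $$\mathbf{L_{i+1}}=\{x1: x\in\mathbf{L_i}\}\cup\{x0: x\in\mathbf{L_i},\ (x)_j=0 \text{ for all } j \text{ such that } s_j \text{ is a finite face of } G_i \text{ having common edges with } s_{i+1}\},$$ where $(x)_j$ is the $j$-th digit of $x$. Then the output $\mathbf{L_n}$ is a binary coding of length $n$ of $\mathcal{M}(G)$ in which the binary string of each $M\in\mathcal{M}(G)$ is $\phi_M=\phi_M(s_1)\phi_M(s_2)\cdots\phi_M(s_n)$; that is, $\mathbf{L_n}=\{\phi_M: M\in\mathcal{M}(G)\}$ with $M\mapsto\phi_M$ a bijection from $\mathcal{M}(G)$ onto $\mathbf{L_n}$.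
   Context: All graphs are finite; $\mathcal{M}(G)$ is the set of perfect matchings of $G$. A bipartite graph is elementary if connected and every edge lies in some perfect matching. The vertices of $G$ are properly colored black and white (the same coloring is used throughout). Reducible face decomposition: $G_1=e+P_1$ is an even cycle bounding finite face $s_1$ (edge $e$ plus odd path $P_1$ with the same ends); $G_i=G_{i-1}+P_i$ adds an odd path $P_i$ in the exterior of $G_{i-1}$ meeting $G_{i-1}$ exactly in its two end vertices, with $P_i$ and part of the periphery of $G_{i-1}$ bounding a finite face $s_i$; $G_n=G$. The infinite face of $G$ is forcing if the periphery of $G$ is an even cycle and deleting all periphery vertices leaves either the empty graph or a graph with exactly one perfect matching. For $M\in\mathcal{M}(G)$, an $M$-alternating cycle $C$ is proper if every edge of $C$ in $M$ goes from white to black along the clockwise orientation of $C$; $M_{\hat0}$ is the unique perfect matching of $G$ with no proper $M_{\hat0}$-alternating cycle; $\phi_M(f)$ is the number of cycles of the symmetric difference $M\oplus M_{\hat0}$ containing the finite face $f$ in their interior. *)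

theory Defs
  imports "HOL-Complex_Analysis.Complex_Analysis"
begin

section \<open>Plane graphs\<close>

text \<open>
  A plane graph is an actual drawing: vertices are points of the plane (the type \<^typ>\<open>complex\<close>) and
  an edge is the point set of an arc. Edges are not identified with vertex pairs, so parallel edges are
  allowed (loops are not).
\<close>

record pgraph =
  verts :: "complex set"
  edges :: "complex set set"

definition ends :: "pgraph \<Rightarrow> complex set \<Rightarrow> complex set" where
  "ends G e = e \<inter> verts G"

definition plane_graph :: "pgraph \<Rightarrow> bool" where
  "plane_graph G \<longleftrightarrow> finite (verts G) \<and> finite (edges G) \<and>
     (\<forall>e\<in>edges G. \<exists>g. arc g \<and> path_image g = e \<and> ends G e = {pathstart g, pathfinish g}) \<and>
     (\<forall>e\<in>edges G. \<forall>f\<in>edges G. e \<noteq> f \<longrightarrow> e \<inter> f \<subseteq> verts G)"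

definition drawing :: "pgraph \<Rightarrow> complex set" where
  "drawing G = verts G \<union> \<Union>(edges G)"

definition delete_verts :: "pgraph \<Rightarrow> complex set \<Rightarrow> pgraph" where
  "delete_verts G X = \<lparr>verts = verts G - X, edges = {e \<in> edges G. e \<inter> X = {}}\<rparr>"

definition delete_edges :: "pgraph \<Rightarrow> complex set set \<Rightarrow> pgraph" where
  "delete_edges G F = \<lparr>verts = verts G, edges = edges G - F\<rparr>"

definition connected_graph :: "pgraph \<Rightarrow> bool" where
  "connected_graph G \<longleftrightarrow>
     (\<forall>u\<in>verts G. \<forall>v\<in>verts G. (u, v) \<in> {(x, y). \<exists>e\<in>edges G. ends G e = {x, y}}\<^sup>*)"

text \<open>A path with at least one edge has end vertices \<^term>\<open>hd vs\<close> and \<^term>\<open>last vs\<close>.\<close>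

definition is_path :: "pgraph \<Rightarrow> complex list \<Rightarrow> complex set list \<Rightarrow> bool" where
  "is_path G vs es \<longleftrightarrow> length vs = Suc (length es) \<and> distinct vs \<and>
     set vs \<subseteq> verts G \<and> set es \<subseteq> edges G \<and>
     (\<forall>i<length es. ends G (es ! i) = {vs ! i, vs ! Suc i})"

definition is_cycle :: "pgraph \<Rightarrow> complex list \<Rightarrow> complex set list \<Rightarrow> bool" where
  "is_cycle G vs es \<longleftrightarrow> length vs = length es \<and> 2 \<le> length es \<and> distinct vs \<and> distinct es \<and>
     set vs \<subseteq> verts G \<and> set es \<subseteq> edges G \<and>
     (\<forall>i<length es. ends G (es ! i) = {vs ! i, vs ! (Suc i mod length es)})"

text \<open>A cycle, as a subgraph, is identified with its set of edges.\<close>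

definition cycles :: "pgraph \<Rightarrow> complex set set set" where
  "cycles G = {set es |vs es. is_cycle G vs es}"

section \<open>Faces\<close>

definition finite_faces :: "pgraph \<Rightarrow> complex set set" where
  "finite_faces G = {f \<in> components (- drawing G). bounded f}"

definition infinite_face :: "pgraph \<Rightarrow> complex set" where
  "infinite_face G = outside (drawing G)"

definition face_edges :: "pgraph \<Rightarrow> complex set \<Rightarrow> complex set set" where
  "face_edges G f = {e \<in> edges G. e \<subseteq> frontier f}"

definition periphery :: "pgraph \<Rightarrow> complex set set" where
  "periphery G = face_edges G (infinite_face G)"

definition periphery_verts :: "pgraph \<Rightarrow> complex set" where
  "periphery_verts G = verts G \<inter> frontier (infinite_face G)"

section \<open>Perfect matchings\<close>

definition perfect_matchings :: "pgraph \<Rightarrow> complex set set set" where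
  "perfect_matchings G = {M. M \<subseteq> edges G \<and> (\<forall>v\<in>verts G. \<exists>!e. e \<in> M \<and> v \<in> ends G e)}"

definition elementary :: "pgraph \<Rightarrow> bool" where
  "elementary G \<longleftrightarrow> connected_graph G \<and> (\<forall>e\<in>edges G. \<exists>M\<in>perfect_matchings G. e \<in> M)"

definition infinite_face_forcing :: "pgraph \<Rightarrow> bool" where
  "infinite_face_forcing G \<longleftrightarrow>
     periphery G \<in> cycles G \<and> even (card (periphery G)) \<and>
     frontier (infinite_face G) = \<Union>(periphery G) \<and>
     (verts G - periphery_verts G = {} \<or>
      (\<exists>!M. M \<in> perfect_matchings (delete_verts G (periphery_verts G))))"

section \<open>Colouring, orientation and proper alternating cycles\<close>

datatype colour = White | Black

definition proper_colouring :: "pgraph \<Rightarrow> (complex \<Rightarrow> colour) \<Rightarrow> bool" where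
  "proper_colouring G col \<longleftrightarrow>
     (\<forall>e\<in>edges G. \<forall>u v. ends G e = {u, v} \<longrightarrow> col u \<noteq> col v)"

definition clockwise :: "(real \<Rightarrow> complex) \<Rightarrow> bool" where
  "clockwise g \<longleftrightarrow> simple_path g \<and> pathfinish g = pathstart g \<and>
     (\<forall>z\<in>inside (path_image g). winding_number g z = -1)"

text \<open>
  The clockwise orientation of the cycle \<open>C\<close> traverses the path with edge set \<open>P\<close> (a part of \<open>C\<close>)
  from \<open>u\<close> to \<open>v\<close>. The start of the parametrisation \<open>g\<close> is arbitrary, so that some \<open>g\<close> always
  traverses \<open>P\<close> in one piece.
\<close>

definition clockwise_from_to ::
    "complex set set \<Rightarrow> complex set set \<Rightarrow> complex \<Rightarrow> complex \<Rightarrow> bool" where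
  "clockwise_from_to C P u v \<longleftrightarrow>
     (\<exists>g a b. clockwise g \<and> path_image g = \<Union>C \<and> 0 \<le> a \<and> a < b \<and> b \<le> 1 \<and>
        g ` {a..b} = \<Union>P \<and> g a = u \<and> g b = v)"

definition white_to_black ::
    "(complex \<Rightarrow> colour) \<Rightarrow> complex set set \<Rightarrow> complex set set \<Rightarrow> bool" where
  "white_to_black col C P \<longleftrightarrow>
     (\<exists>u v. clockwise_from_to C P u v \<and> col u = White \<and> col v = Black)"

definition alternating_cycles :: "pgraph \<Rightarrow> complex set set \<Rightarrow> complex set set set" where
  "alternating_cycles G M = {set es |vs es. is_cycle G vs es \<and>
     (\<forall>i<length es. es ! i \<in> M \<longleftrightarrow> es ! (Suc i mod length es) \<notin> M)}"

definition proper_cycle ::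
    "pgraph \<Rightarrow> (complex \<Rightarrow> colour) \<Rightarrow> complex set set \<Rightarrow> complex set set \<Rightarrow> bool" where
  "proper_cycle G col M C \<longleftrightarrow>
     C \<in> alternating_cycles G M \<and> (\<forall>e \<in> C \<inter> M. white_to_black col C {e})"

definition M0 :: "pgraph \<Rightarrow> (complex \<Rightarrow> colour) \<Rightarrow> complex set set" where
  "M0 G col = (THE M. M \<in> perfect_matchings G \<and> (\<nexists>C. proper_cycle G col M C))"

definition phi ::
    "pgraph \<Rightarrow> (complex \<Rightarrow> colour) \<Rightarrow> complex set set \<Rightarrow> complex set \<Rightarrow> nat" where
  "phi G col M f = card {C \<in> cycles G. C \<subseteq> sym_diff M (M0 G col) \<and> f \<subseteq> inside (\<Union>C)}"

definition phi_string ::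
    "pgraph \<Rightarrow> (complex \<Rightarrow> colour) \<Rightarrow> nat \<Rightarrow> (nat \<Rightarrow> complex set) \<Rightarrow> complex set set \<Rightarrow> nat list" where
  "phi_string G col n s M = map (\<lambda>i. phi G col M (s i)) [1..<Suc n]"

section \<open>Reducible face decompositions\<close>

definition reducible_face :: "pgraph \<Rightarrow> complex set \<Rightarrow> bool" where
  "reducible_face G f \<longleftrightarrow> f \<in> finite_faces G \<and>
     (\<exists>vs es. is_path G vs es \<and> odd (length es) \<and> set es = face_edges G f \<inter> periphery G \<and>
        elementary (delete_verts (delete_edges G (set es)) (set vs - {hd vs, last vs})))"

definition first_cycle :: "pgraph \<Rightarrow> complex set \<Rightarrow> bool" where
  "first_cycle G f \<longleftrightarrow>
     (\<exists>e vs es. is_path G vs es \<and> odd (length es) \<and> e \<notin> set es \<and> ends G e = {hd vs, last vs} \<and>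
        verts G = set vs \<and> edges G = insert e (set es)) \<and>
     f \<in> finite_faces G \<and> frontier f = \<Union>(edges G)"

definition ear_extension :: "pgraph \<Rightarrow> pgraph \<Rightarrow> complex set \<Rightarrow> bool" where
  "ear_extension G H f \<longleftrightarrow>
     (\<exists>vs es. is_path H vs es \<and> odd (length es) \<and>
        verts H = verts G \<union> set vs \<and> edges H = edges G \<union> set es \<and>
        hd vs \<in> verts G \<and> last vs \<in> verts G \<and>
        \<Union>(set es) \<inter> drawing G = {hd vs, last vs} \<and>
        \<Union>(set es) - {hd vs, last vs} \<subseteq> infinite_face G \<and>
        f \<in> finite_faces H \<and> (\<exists>Q \<subseteq> periphery G. frontier f = \<Union>(set es \<union> Q)))"

definition RFD :: "pgraph \<Rightarrow> nat \<Rightarrow> (nat \<Rightarrow> pgraph) \<Rightarrow> (nat \<Rightarrow> complex set) \<Rightarrow> bool" where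
  "RFD G n Gs s \<longleftrightarrow> 1 \<le> n \<and> first_cycle (Gs 1) (s 1) \<and>
     (\<forall>i\<in>{2..n}. ear_extension (Gs (i - 1)) (Gs i) (s i)) \<and> Gs n = G"

section \<open>The algorithm\<close>

text \<open>Digits are numbered from 1 in the mathematics, hence the index \<open>j - 1\<close>.\<close>

definition adjacent_digits_eq ::
    "(nat \<Rightarrow> pgraph) \<Rightarrow> (nat \<Rightarrow> complex set) \<Rightarrow> nat \<Rightarrow> nat \<Rightarrow> nat list \<Rightarrow> bool" where
  "adjacent_digits_eq Gs s i d x \<longleftrightarrow>
     (\<forall>j\<in>{1..i}. s j \<in> finite_faces (Gs i) \<and>
        face_edges (Gs (Suc i)) (s j) \<inter> face_edges (Gs (Suc i)) (s (Suc i)) \<noteq> {} \<longrightarrow>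
        x ! (j - 1) = d)"

text \<open>The value at 0 is irrelevant.\<close>

fun algorithm_L ::
    "(complex \<Rightarrow> colour) \<Rightarrow> (nat \<Rightarrow> pgraph) \<Rightarrow> (nat \<Rightarrow> complex set) \<Rightarrow> nat \<Rightarrow> nat list set" where
  "algorithm_L col Gs s 0 = {}"
| "algorithm_L col Gs s (Suc 0) = {[0], [1]}"
| "algorithm_L col Gs s (Suc (Suc k)) =
     (let i = Suc k; H = Gs (Suc i); P = face_edges H (s (Suc i)) \<inter> periphery H;
          L = algorithm_L col Gs s i
      in if white_to_black col (periphery H) P
         then {x @ [0] |x. x \<in> L} \<union> {x @ [1] |x. x \<in> L \<and> adjacent_digits_eq Gs s i 1 x}
         else {x @ [1] |x. x \<in> L} \<union> {x @ [0] |x. x \<in> L \<and> adjacent_digits_eq Gs s i 0 x})"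

definition binary_strings :: "nat \<Rightarrow> nat list set" where
  "binary_strings n = {x. length x = n \<and> set x \<subseteq> {0, 1}}"

end

(*
  Orient every edge from its white to its black end. A perfect matching is then a 0/1 edge function
  with sum 1 at every vertex, and the difference of two of them is a circulation. The clockwise
  boundaries D_1, ..., D_n of the faces s_1, ..., s_n form a basis of the circulations, so relative to
  a reference matching B every perfect matching M has a height vector h with M = B + sum_j h_j D_j.
  Every edge lies on exactly two of the faces (the infinite one included, with height 0).

  A matching B_i of G_i whose edges on the periphery run clockwise from black to white is carried
  along the decomposition. Since the infinite face is forcing, B = B_n is the only perfect matching
  with its values on the periphery. Truncating a height vector at level 2, or at level 0 from below,
  gives a matching with these values, so all heights are 0 or 1. Hence there is no proper
  B-alternating cycle, B is the minimal matching, and the heights of M are phi_M: the cycles in the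
  symmetric difference of M and B partition it and are all traversed in the same sense. A 0/1 vector
  h is a height vector iff B + sum_j h_j D_j is 0/1-valued; checking this on the edges of the last
  face gives the recursion of the algorithm.

  The winding number of a cycle about the points of s_k is minus the coefficient of D_k in its edge
  vector; for the periphery, the theta-curve theorem shows that the clockwise boundary of G_{i+1}
  is that of G_i plus that of s_{i+1}.
*)
theory Submission imports Defs begin

section \<open>Matchings and heights in a sequence of ears\<close>

text \<open>Each vertex is the tail of all its edges or the head of all of them, so conservation at
  a vertex is a sum without signs, and one predicate with a right-hand side \<open>b\<close> covers
  matchings (\<open>b = 1\<close>) and circulations (\<open>b = 0\<close>).

  The obstacle is that edges are point sets, faces are components of a complement and clockwise is
  an existential statement about parametrisations, whereas the counting is linear algebra. The
  winding number, extended linearly to integer edge functions, joins the two. All that the counting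
  needs to know about the plane is \<open>D_old\<close>: an old edge on the new face lay on the old
  periphery, with the opposite sign. The counting therefore has a locale of its own.

  The two branches of the algorithm come from extending a matching over an ear by every second edge,
  ends excluded. If the ends of the ear run clockwise from white to black, this leaves the new face
  at height 0, otherwise it puts it at height 1. That height is always allowed; the other one
  requires a rotation around the new face, possible only if all its finite neighbours have that
  other height too.\<close>

definition balanced :: "('e \<Rightarrow> 'v set) \<Rightarrow> int \<Rightarrow> 'v set \<Rightarrow> 'e set \<Rightarrow> ('e \<Rightarrow> int) \<Rightarrow> bool" where
  "balanced nd b V E f \<longleftrightarrow> (\<forall>e. e \<notin> E \<longrightarrow> f e = 0) \<and> (\<forall>v\<in>V. (\<Sum>e | e \<in> E \<and> v \<in> nd e. f e) = b)"

lemma balanced_add: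
  assumes "balanced nd b V E f" "balanced nd c V E g"
  shows "balanced nd (b + c) V E (\<lambda>e. f e + g e)"
  using assms by (auto simp: balanced_def sum.distrib)

lemma balanced_scale:
  assumes "balanced nd b V E f"
  shows "balanced nd (k * b) V E (\<lambda>e. k * f e)"
  using assms by (auto simp: balanced_def simp flip: sum_distrib_left)

lemma balanced_diff:
  assumes "balanced nd b V E f" "balanced nd c V E g"
  shows "balanced nd (b - c) V E (\<lambda>e. f e - g e)"
  using assms by (auto simp: balanced_def sum_subtractf)

lemma balanced_sum:
  assumes "\<And>j. j \<in> J \<Longrightarrow> balanced nd 0 V E (f j)"
  shows "balanced nd 0 V E (\<lambda>e. \<Sum>j\<in>J. f j e)"
proof -
  have "(\<Sum>e | e \<in> E \<and> v \<in> nd e. \<Sum>j\<in>J. f j e) = 0" if "v \<in> V" for v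
  proof -
    have "(\<Sum>e | e \<in> E \<and> v \<in> nd e. \<Sum>j\<in>J. f j e) = (\<Sum>j\<in>J. \<Sum>e | e \<in> E \<and> v \<in> nd e. f j e)"
      by (rule sum.swap)
    also have "\<dots> = 0" using assms that by (auto simp: balanced_def intro!: sum.neutral)
    finally show ?thesis .
  qed
  moreover have "(\<Sum>j\<in>J. f j e) = 0" if "e \<notin> E" for e
    using assms that by (auto simp: balanced_def intro!: sum.neutral)
  ultimately show ?thesis by (auto simp: balanced_def)
qed

text \<open>
  Combinatorial data of a reducible face decomposition: the ear added in step \<open>i\<close> has its end edges and
  every second edge in between in \<open>P1 i\<close>, the others in \<open>P0 i\<close>, and the ends \<open>T i\<close>; \<open>D i\<close> is the
  clockwise boundary of the new face, with value \<open>\<sigma> i\<close> on \<open>P1 i\<close>. The first cycle is treated as an ear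
  of the empty graph.
\<close>

locale ear_system =
  fixes n :: nat and nd :: "'e \<Rightarrow> 'v set" and V :: "nat \<Rightarrow> 'v set" and E :: "nat \<Rightarrow> 'e set"
    and P0 P1 :: "nat \<Rightarrow> 'e set" and T :: "nat \<Rightarrow> 'v set" and D :: "nat \<Rightarrow> 'e \<Rightarrow> int"
    and \<sigma> :: "nat \<Rightarrow> int"
  assumes E_0: "E 0 = {}" and V_0: "V 0 = {}"
    and E_Suc: "i < n \<Longrightarrow> E (Suc i) = E i \<union> (P0 (Suc i) \<union> P1 (Suc i))"
    and new: "i < n \<Longrightarrow> E i \<inter> (P0 (Suc i) \<union> P1 (Suc i)) = {}"
    and P0_P1: "i < n \<Longrightarrow> P0 (Suc i) \<inter> P1 (Suc i) = {}"
    and P1_ne: "i < n \<Longrightarrow> P1 (Suc i) \<noteq> {}"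
    and balanced_Suc: "i < n \<Longrightarrow> balanced nd b (V (Suc i)) (E (Suc i)) f \<longleftrightarrow>
      (\<forall>e. e \<notin> E (Suc i) \<longrightarrow> f e = 0) \<and>
      (\<exists>t. (\<forall>e\<in>P1 (Suc i). f e = t) \<and> (\<forall>e\<in>P0 (Suc i). f e = b - t) \<and>
         (\<forall>v\<in>V i. (\<Sum>e | e \<in> E i \<and> v \<in> nd e. f e) = b - of_bool (v \<in> T (Suc i)) * t))"
    and D_balanced: "i < n \<Longrightarrow> balanced nd 0 (V (Suc i)) (E (Suc i)) (D (Suc i))"
    and D_P1: "i < n \<Longrightarrow> e \<in> P1 (Suc i) \<Longrightarrow> D (Suc i) e = \<sigma> (Suc i)"
    and sigma: "i < n \<Longrightarrow> \<sigma> (Suc i) = 1 \<or> \<sigma> (Suc i) = -1"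
    and D_old: "i < n \<Longrightarrow> e \<in> E i \<Longrightarrow> D (Suc i) e = 0 \<or> D (Suc i) e = - (\<Sum>j=1..i. D j e)"
begin

section \<open>Face boundaries as a basis of the circulations\<close>

definition outer :: "nat \<Rightarrow> 'e \<Rightarrow> int" where
  "outer i e = (\<Sum>j=1..i. D j e)"

definition span :: "nat \<Rightarrow> (nat \<Rightarrow> int) \<Rightarrow> 'e \<Rightarrow> int" where
  "span i h e = (\<Sum>j=1..i. h j * D j e)"

lemma span_Suc: "span (Suc i) h e = span i h e + h (Suc i) * D (Suc i) e"
  by (simp add: span_def)

lemma D_P0:
  assumes "i < n" "e \<in> P0 (Suc i)" shows "D (Suc i) e = - \<sigma> (Suc i)"
proof -
  obtain t where t: "\<forall>e\<in>P1 (Suc i). D (Suc i) e = t" "\<forall>e\<in>P0 (Suc i). D (Suc i) e = 0 - t"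
    using D_balanced[OF assms(1)] balanced_Suc[OF assms(1), of 0] by blast
  moreover obtain e1 where "e1 \<in> P1 (Suc i)" using P1_ne[OF assms(1)] by blast
  ultimately show ?thesis using D_P1[OF assms(1)] assms(2) by auto
qed

text \<open>This is the case \<open>t = 0\<close> of \<open>balanced_Suc\<close>: the edges in
  \<open>P0\<close> alone serve the inner vertices of the ear, and nothing changes at its two ends.
  For \<open>b = 1\<close> a matching is extended by every second ear edge.\<close>

lemma balanced_extend:
  assumes "i < n" "balanced nd b (V i) (E i) f"
  shows "balanced nd b (V (Suc i)) (E (Suc i)) (\<lambda>e. f e + b * of_bool (e \<in> P0 (Suc i)))"
proof -
  have 1: "f e = 0" if "e \<in> P0 (Suc i) \<union> P1 (Suc i)" for e
    using assms new[OF assms(1)] that by (auto simp: balanced_def)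
  have 2: "(\<Sum>e | e \<in> E i \<and> v \<in> nd e. f e + b * of_bool (e \<in> P0 (Suc i))) = b" if "v \<in> V i" for v
  proof -
    have "(\<Sum>e | e \<in> E i \<and> v \<in> nd e. f e + b * of_bool (e \<in> P0 (Suc i))) =
        (\<Sum>e | e \<in> E i \<and> v \<in> nd e. f e)"
      using new[OF assms(1)] by (intro sum.cong) auto
    then show ?thesis using assms that by (auto simp: balanced_def)
  qed
  show ?thesis
    unfolding balanced_Suc[OF assms(1)]
    using 1 2 P0_P1[OF assms(1)] assms(2) E_Suc[OF assms(1)]
    by (auto simp: balanced_def intro!: exI[of _ 0])
qed

lemma balanced_restrict:
  assumes "i < n" "balanced nd 0 (V (Suc i)) (E (Suc i)) f" "\<forall>e\<in>P1 (Suc i). f e = 0"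
  shows "balanced nd 0 (V i) (E i) f"
proof -
  obtain t where t: "\<forall>e\<in>P1 (Suc i). f e = t" "\<forall>e\<in>P0 (Suc i). f e = 0 - t"
     "\<forall>v\<in>V i. (\<Sum>e | e \<in> E i \<and> v \<in> nd e. f e) = 0 - of_bool (v \<in> T (Suc i)) * t"
    using assms(2) balanced_Suc[OF assms(1), of 0] by blast
  have "t = 0" using t(1) assms(3) P1_ne[OF assms(1)] by auto
  then show ?thesis using t assms(2) E_Suc[OF assms(1)] by (auto simp: balanced_def)
qed

lemma D_balanced_le: "i \<le> n \<Longrightarrow> j \<in> {1..i} \<Longrightarrow> balanced nd 0 (V i) (E i) (D j)"
proof (induction i)
  case (Suc i)
  show ?case
  proof (cases "j = Suc i")
    case True
    then show ?thesis using D_balanced Suc.prems by auto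
  next
    case False
    then have "balanced nd 0 (V i) (E i) (D j)" using Suc by auto
    from balanced_extend[OF _ this] Suc.prems show ?thesis by auto
  qed
qed auto

lemma span_balanced: "i \<le> n \<Longrightarrow> balanced nd 0 (V i) (E i) (span i h)"
  unfolding span_def
  by (rule balanced_sum) (use balanced_scale[where b = 0, OF D_balanced_le] in auto)

text \<open>A circulation has one common value \<open>t\<close> on \<open>P1\<close> of the last
  ear. Subtracting \<open>t * \<sigma>\<close> times the boundary of the last face makes it vanish
  there, because \<open>\<sigma>\<close> squared is 1, and leaves a circulation of the smaller
  graph.\<close>

lemma spanning:
  assumes "i \<le> n" "balanced nd 0 (V i) (E i) f"
  shows "\<exists>h. f = span i h"
  using assms
proof (induction i arbitrary: f)
  case 0
  then show ?case by (auto simp: balanced_def E_0 span_def)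
next
  case (Suc i)
  then have i: "i < n" by auto
  obtain t where t: "\<forall>e\<in>P1 (Suc i). f e = t"
    using Suc.prems(2) balanced_Suc[OF i, of 0] by blast
  define g where "g = (\<lambda>e. f e - (t * \<sigma> (Suc i)) * D (Suc i) e)"
  have "balanced nd 0 (V (Suc i)) (E (Suc i)) g"
    unfolding g_def
    using balanced_diff[OF Suc.prems(2) balanced_scale[OF D_balanced[OF i], of "t * \<sigma> (Suc i)"]] by simp
  moreover have "\<forall>e\<in>P1 (Suc i). g e = 0"
    using t D_P1[OF i] sigma[OF i] by (auto simp: g_def)
  ultimately have "balanced nd 0 (V i) (E i) g" by (rule balanced_restrict[OF i])
  then obtain h where h: "g = span i h" using Suc.IH i by auto
  have "f = span (Suc i) (h(Suc i := t * \<sigma> (Suc i)))"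
  proof
    fix e
    have "span i (h(Suc i := t * \<sigma> (Suc i))) e = span i h e"
      by (auto simp: span_def intro!: sum.cong)
    then show "f e = span (Suc i) (h(Suc i := t * \<sigma> (Suc i))) e"
      using h by (auto simp: span_Suc g_def dest: fun_cong[of _ _ e])
  qed
  then show ?case by blast
qed

lemma independent:
  assumes "i \<le> n" "\<And>e. span i h e = 0" "j \<in> {1..i}"
  shows "h j = 0"
  using assms
proof (induction i)
  case (Suc i)
  then have i: "i < n" by auto
  \<comment> \<open>On an edge of the last ear every earlier boundary vanishes, so this edge
    isolates the last coefficient.\<close>
  obtain e where e: "e \<in> P1 (Suc i)" using P1_ne[OF i] by blast
  have "e \<notin> E i" using e new[OF i] by auto
  then have "D j e = 0" if "j \<in> {1..i}" for j
    using D_balanced_le[of i j] i that by (auto simp: balanced_def)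
  then have "span i h e = 0" by (auto simp: span_def intro!: sum.neutral)
  then have 0: "h (Suc i) = 0"
    using Suc.prems(2)[of e] sigma[OF i] D_P1[OF i e] by (auto simp: span_Suc)
  then have "\<And>e. span i h e = 0" using Suc.prems(2) by (auto simp: span_Suc)
  then show ?case using Suc 0 by (cases "j = Suc i") auto
qed auto

text \<open>The two sides of an edge; the number 0 stands for the infinite face.\<close>

lemma sides:
  assumes "i \<le> n" "e \<in> E i"
  shows "\<exists>a b. a \<noteq> b \<and> a \<le> i \<and> b \<le> i \<and> (\<forall>j\<in>{1..i}. D j e = of_bool (j = a) - of_bool (j = b))"
  using assms
proof (induction i)
  case 0
  then show ?case by (auto simp: E_0)
next
  case (Suc i)
  then have i: "i < n" by auto
  show ?case
  proof (cases "e \<in> E i")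
    case False
    then have D0: "D j e = 0" if "j \<in> {1..i}" for j
      using D_balanced_le[of i j] i that by (auto simp: balanced_def)
    have "D (Suc i) e = 1 \<or> D (Suc i) e = -1"
      using False Suc.prems(2) E_Suc[OF i] D_P0[OF i] D_P1[OF i] sigma[OF i] by auto
    then show ?thesis
    proof
      assume "D (Suc i) e = 1"
      then show ?thesis using D0 by (intro exI[of _ "Suc i"] exI[of _ 0]) (auto simp: le_Suc_eq)
    next
      assume "D (Suc i) e = -1"
      then show ?thesis using D0 by (intro exI[of _ 0] exI[of _ "Suc i"]) (auto simp: le_Suc_eq)
    qed
  next
    case True
    then obtain a b where ab: "a \<noteq> b" "a \<le> i" "b \<le> i"
      "\<forall>j\<in>{1..i}. D j e = of_bool (j = a) - of_bool (j = b)" using Suc i by auto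
    have "(\<Sum>j=1..i. D j e) = (\<Sum>j=1..i. of_bool (j = a)) - (\<Sum>j=1..i. of_bool (j = b))"
      using ab(4) by (simp add: sum_subtractf)
    also have "\<dots> = of_bool (a \<noteq> 0) - of_bool (b \<noteq> 0)"
      using ab(2,3) by (auto simp: of_bool_def sum.delta)
    finally have s: "(\<Sum>j=1..i. D j e) = of_bool (a \<noteq> 0) - of_bool (b \<noteq> 0)" .
    show ?thesis
    proof (cases "D (Suc i) e = 0")
      case True
      then show ?thesis using ab by (intro exI[of _ a] exI[of _ b]) (auto simp: le_Suc_eq)
    next
      case False
      \<comment> \<open>A non-zero value cancels the outer sum, so exactly one of the two old sides
        is the infinite face; the new face takes its place.\<close>
      then have d: "D (Suc i) e = of_bool (b \<noteq> 0) - of_bool (a \<noteq> 0)" using D_old[OF i True] s by auto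
      with False consider "a = 0" "b \<noteq> 0" | "a \<noteq> 0" "b = 0" by (cases "a = 0"; cases "b = 0") auto
      then show ?thesis
      proof cases
        case 1
        then show ?thesis using ab d by (intro exI[of _ "Suc i"] exI[of _ b]) (auto simp: le_Suc_eq)
      next
        case 2
        then show ?thesis using ab d by (intro exI[of _ a] exI[of _ "Suc i"]) (auto simp: le_Suc_eq)
      qed
    qed
  qed
qed

lemma span_sides:
  assumes "a \<noteq> b" "a \<le> i" "b \<le> i" "\<forall>j\<in>{1..i}. D j e = of_bool (j = a) - of_bool (j = b)"
  shows "span i h e = (if a = 0 then 0 else h a) - (if b = 0 then 0 else h b)"
proof -
  have "span i h e = (\<Sum>j=1..i. (if j = a then h j else 0)) - (\<Sum>j=1..i. (if j = b then h j else 0))"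
    unfolding span_def sum_subtractf[symmetric] using assms by (intro sum.cong) auto
  also have "\<dots> = (if a = 0 then 0 else h a) - (if b = 0 then 0 else h b)"
    using assms(2,3) by (auto simp: sum.delta)
  finally show ?thesis .
qed

lemma outer_eq_span: "outer i e = span i (\<lambda>_. 1) e"
  by (simp add: outer_def span_def)

lemma outer_sides:
  assumes "a \<noteq> b" "a \<le> i" "b \<le> i" "\<forall>j\<in>{1..i}. D j e = of_bool (j = a) - of_bool (j = b)"
  shows "outer i e = of_bool (a \<noteq> 0) - of_bool (b \<noteq> 0)"
  using span_sides[OF assms] by (simp add: outer_eq_span)

text \<open>If \<open>\<sigma>\<close> is -1, the added edges of \<open>P0\<close> run clockwise
  from white to black around the new face, the wrong way for the periphery. Subtracting
  \<open>D\<close> rotates the matching around this face and moves it to the edges of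
  \<open>P1\<close>.\<close>

primrec base :: "nat \<Rightarrow> 'e \<Rightarrow> int" where
  "base 0 e = 0"
| "base (Suc i) e = base i e + of_bool (e \<in> P0 (Suc i)) - (if \<sigma> (Suc i) = 1 then 0 else D (Suc i) e)"

lemma base_balanced: "i \<le> n \<Longrightarrow> balanced nd 1 (V i) (E i) (base i)"
proof (induction i)
  case 0
  then show ?case by (auto simp: balanced_def V_0)
next
  case (Suc i)
  then have i: "i < n" and b: "balanced nd 1 (V i) (E i) (base i)" by auto
  have "balanced nd 0 (V (Suc i)) (E (Suc i)) (\<lambda>e. if \<sigma> (Suc i) = 1 then 0 else D (Suc i) e)"
    using D_balanced[OF i] by (cases "\<sigma> (Suc i) = 1") (auto simp: balanced_def)
  from balanced_diff[OF balanced_extend[OF i b] this] show ?case by simp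
qed

text \<open>The invariant that determines the recursion for \<open>base\<close>. An old edge that
  stays on the periphery is not on the new face, so its value does not change; on the ear the two
  signs of \<open>\<sigma>\<close> are checked.\<close>

lemma base_outer: "i \<le> n \<Longrightarrow> e \<in> E i \<Longrightarrow> outer i e \<noteq> 0 \<Longrightarrow> base i e = of_bool (outer i e = -1)"
proof (induction i)
  case 0
  then show ?case by (auto simp: E_0)
next
  case (Suc i)
  then have i: "i < n" by auto
  have o: "outer (Suc i) e = outer i e + D (Suc i) e" by (simp add: outer_def)
  show ?case
  proof (cases "e \<in> E i")
    case True
    then have "e \<notin> P0 (Suc i)" using new[OF i] by auto
    moreover have "D (Suc i) e = 0" using D_old[OF i True] Suc.prems o by (auto simp: outer_def)
    ultimately show ?thesis using Suc True o i by auto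
  next
    case False
    then have "D j e = 0" if "j \<in> {1..i}" for j
      using D_balanced_le[of i j] i that by (auto simp: balanced_def)
    then have o0: "outer i e = 0" by (auto simp: outer_def)
    have b0: "base i e = 0" using base_balanced[of i] i False by (auto simp: balanced_def)
    consider "e \<in> P0 (Suc i)" | "e \<in> P1 (Suc i)" "e \<notin> P0 (Suc i)"
      using False Suc.prems(2) E_Suc[OF i] by auto
    then show ?thesis
      using D_P0[OF i] D_P1[OF i] sigma[OF i] o o0 b0 by cases auto
  qed
qed

text \<open>Only the rotation around the new face could leave \<open>{0, 1}\<close>. An old edge of
  that face was on the periphery, where \<open>base_outer\<close> fixes its value in such a way that
  the rotation just exchanges 0 and 1.\<close>

lemma base_01: "i \<le> n \<Longrightarrow> base i e \<in> {0, 1}"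
proof (induction i)
  case (Suc i)
  then have i: "i < n" by auto
  show ?case
  proof (cases "e \<in> E i")
    case True
    then have "e \<notin> P0 (Suc i)" using new[OF i] by auto
    have "D (Suc i) e = 0 \<or> D (Suc i) e = - outer i e" using D_old[OF i True] by (simp add: outer_def)
    moreover obtain a b where "a \<noteq> b" "a \<le> i" "b \<le> i"
      "\<forall>j\<in>{1..i}. D j e = of_bool (j = a) - of_bool (j = b)" using sides[of i e] i True by auto
    then have "outer i e \<in> {-1,0,1}" by (auto simp: outer_sides)
    ultimately show ?thesis using Suc base_outer[of i e] i True \<open>e \<notin> P0 (Suc i)\<close> by auto
  next
    case False
    have b0: "base i e = 0" using base_balanced[of i] i False by (auto simp: balanced_def)
    consider "e \<in> P0 (Suc i)" | "e \<in> P1 (Suc i)" "e \<notin> P0 (Suc i)" | "e \<notin> E (Suc i)" "e \<notin> P0 (Suc i)"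
      using False E_Suc[OF i] by auto
    then show ?thesis
      using D_P0[OF i] D_P1[OF i] sigma[OF i] b0 D_balanced[OF i] by cases (auto simp: balanced_def)
  qed
qed auto

definition comb :: "nat \<Rightarrow> (nat \<Rightarrow> int) \<Rightarrow> 'e \<Rightarrow> int" where
  "comb i h e = base i e + span i h e"

lemma comb_balanced: "i \<le> n \<Longrightarrow> balanced nd 1 (V i) (E i) (comb i h)"
  unfolding comb_def using balanced_add[OF base_balanced span_balanced, of i h] by simp

lemma comb_inj:
  assumes "comb n h = comb n k" "j \<in> {1..n}"
  shows "h j = k j"
proof -
  have "span n (\<lambda>j. h j - k j) e = 0" for e
    using fun_cong[OF assms(1), of e]
    by (simp add: comb_def span_def sum_subtractf left_diff_distrib)
  from independent[OF _ this assms(2)] show ?thesis by simp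
qed

text \<open>On an edge between the new face and an old one, the value lies in \<open>{0, 1}\<close> unless exactly the new
  face has the height excluded by the algorithm.\<close>

lemma comb_Suc_01:
  assumes i: "i < n" and h: "\<And>j. j \<in> {1..Suc i} \<Longrightarrow> h j \<in> {0, 1}"
  defines "d \<equiv> of_bool (\<sigma> (Suc i) = 1)"
  shows "(\<forall>e. comb (Suc i) h e \<in> {0, 1}) \<longleftrightarrow>
    (\<forall>e. comb i h e \<in> {0, 1}) \<and>
    (h (Suc i) = d \<longrightarrow> (\<forall>j\<in>{1..i}. (\<exists>e\<in>E (Suc i). D j e \<noteq> 0 \<and> D (Suc i) e \<noteq> 0) \<longrightarrow> h j = d))"
proof -
  \<comment> \<open>For \<open>d = 0\<close> the boundary of the new face has already been
    subtracted once in \<open>base (Suc i)\<close>, whence the shift by \<open>d - 1\<close>. The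
    coefficient of \<open>D (Suc i)\<close> vanishes iff the 0/1 height \<open>h (Suc i)\<close>
    differs from \<open>d\<close>: that height is free, and \<open>d\<close> is the constrained
    one.\<close>
  have eq: "comb (Suc i) h e = comb i h e + of_bool (e \<in> P0 (Suc i)) + (h (Suc i) - 1 + d) * D (Suc i) e" for e
    by (auto simp: comb_def span_Suc d_def algebra_simps)
  have hs: "h (Suc i) = 0 \<or> h (Suc i) = 1" and d01: "d = 0 \<or> d = 1" using h[of "Suc i"] by (auto simp: d_def)
  have new_comb: "comb i h e = 0" if "e \<notin> E i" for e
    using comb_balanced[of i h] i that by (auto simp: balanced_def)
  have new_01: "comb (Suc i) h e \<in> {0, 1}" if nE: "e \<notin> E i" for e
  proof (cases "e \<in> E (Suc i)")
    case False
    then show ?thesis using comb_balanced[of "Suc i" h] i by (auto simp: balanced_def)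
  next
    case True
    then consider "e \<in> P0 (Suc i)" | "e \<in> P1 (Suc i)" "e \<notin> P0 (Suc i)" using nE E_Suc[OF i] by blast
    then show ?thesis
      using D_P0[OF i] D_P1[OF i] sigma[OF i] new_comb[OF nE] hs
      by cases (auto simp: eq d_def)
  qed
  have old: "comb (Suc i) h e = comb i h e" if "e \<in> E i" "D (Suc i) e = 0" for e
    using that new[OF i] by (auto simp: eq)
  \<comment> \<open>The other side of such an edge was the infinite face, of height 0. Hence the old
    value is \<open>h a\<close> or \<open>1 - h b\<close>, which is in \<open>{0, 1}\<close> anyway,
    and the rotation around the new face keeps it there only if the old neighbour has height
    \<open>d\<close>.\<close>
  have key: "comb i h e \<in> {0, 1} \<and>
     (comb (Suc i) h e \<in> {0, 1} \<longleftrightarrow>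
     (h (Suc i) = d \<longrightarrow> (\<forall>j\<in>{1..i}. D j e \<noteq> 0 \<longrightarrow> h j = d)))"
    if e: "e \<in> E i" "D (Suc i) e \<noteq> 0" for e
  proof -
    obtain a b where ab: "a \<noteq> b" "a \<le> i" "b \<le> i"
      "\<forall>j\<in>{1..i}. D j e = of_bool (j = a) - of_bool (j = b)" using sides[of i e] i e by auto
    have o: "outer i e = of_bool (a \<noteq> 0) - of_bool (b \<noteq> 0)" by (rule outer_sides[OF ab])
    have d: "D (Suc i) e = - outer i e" using D_old[OF i e(1)] e(2) by (auto simp: outer_def)
    have P: "e \<notin> P0 (Suc i)" using new[OF i] e by auto
    have b: "base i e = of_bool (outer i e = -1)" using base_outer[of i e] i e d by auto
    consider "a = 0" "b \<in> {1..i}" | "b = 0" "a \<in> {1..i}"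
      using d e(2) o ab(1-3) by (cases "a = 0"; cases "b = 0") auto
    then show ?thesis
    proof cases
      case 1
      then have "comb i h e = 1 - h b" using b o span_sides[OF ab, of h] by (auto simp: comb_def)
      moreover have "h b \<in> {0,1}" using h 1 by auto
      moreover have "(\<forall>j\<in>{1..i}. D j e \<noteq> 0 \<longrightarrow> h j = d) \<longleftrightarrow> h b = d" using 1 ab(4) by auto
      ultimately show ?thesis using 1 d o P hs d01 unfolding eq by auto
    next
      case 2
      then have "comb i h e = h a" using b o span_sides[OF ab, of h] by (auto simp: comb_def)
      moreover have "h a \<in> {0,1}" using h 2 by auto
      moreover have "(\<forall>j\<in>{1..i}. D j e \<noteq> 0 \<longrightarrow> h j = d) \<longleftrightarrow> h a = d" using 2 ab(4) by auto
      ultimately show ?thesis using 2 d o P hs d01 unfolding eq by auto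
    qed
  qed
  have adj: "e \<in> E i" if "j \<in> {1..i}" "D j e \<noteq> 0" for j e
    using D_balanced_le[of i j] i that by (auto simp: balanced_def)
  show ?thesis
  proof
    assume L: "\<forall>e. comb (Suc i) h e \<in> {0, 1}"
    have "comb i h e \<in> {0, 1}" for e
      using L[rule_format, of e] key[of e] old[of e] new_comb[of e] by (cases "e \<in> E i"; cases "D (Suc i) e = 0") auto
    moreover have "h j = d" if "h (Suc i) = d" "j \<in> {1..i}" "D j e \<noteq> 0" "D (Suc i) e \<noteq> 0" for j e
      using key[OF adj[OF that(2,3)] that(4)] L that by auto
    ultimately show "(\<forall>e. comb i h e \<in> {0, 1}) \<and>
      (h (Suc i) = d \<longrightarrow> (\<forall>j\<in>{1..i}. (\<exists>e\<in>E (Suc i). D j e \<noteq> 0 \<and> D (Suc i) e \<noteq> 0) \<longrightarrow> h j = d))" by blast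
  next
    assume R: "(\<forall>e. comb i h e \<in> {0, 1}) \<and>
      (h (Suc i) = d \<longrightarrow> (\<forall>j\<in>{1..i}. (\<exists>e\<in>E (Suc i). D j e \<noteq> 0 \<and> D (Suc i) e \<noteq> 0) \<longrightarrow> h j = d))"
    show "\<forall>e. comb (Suc i) h e \<in> {0, 1}"
    proof
      fix e
      show "comb (Suc i) h e \<in> {0, 1}"
      proof (cases "e \<in> E i \<and> D (Suc i) e \<noteq> 0")
        case True
        have "e \<in> E (Suc i)" using True E_Suc[OF i] by auto
        then show ?thesis using key[of e] True R by blast
      next
        case False
        then show ?thesis using R new_01[of e] old[of e] by (cases "e \<in> E i") metis+
      qed
    qed
  qed
qed

text \<open>Cutting the height function at a level gives a matching that agrees with \<^term>\<open>base n\<close> on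
  the periphery.\<close>

lemma heights_01:
  assumes unique: "\<And>m. balanced nd 1 (V n) (E n) m \<Longrightarrow> (\<And>e. m e \<in> {0, 1}) \<Longrightarrow>
      (\<And>e. e \<in> E n \<Longrightarrow> outer n e \<noteq> 0 \<Longrightarrow> m e = base n e) \<Longrightarrow> m = base n"
    and m: "\<And>e. comb n h e \<in> {0, 1}"
    and j: "j \<in> {1..n}"
  shows "h j \<in> {0, 1}"
proof -
  have key: "h j < 2 \<and> h j \<ge> 0"
  proof -
    \<comment> \<open>The part \<open>k\<close> of \<open>h\<close> above level 1 or below level 0
      is itself a height vector of a matching that agrees with \<open>base n\<close> on the
      periphery. Uniqueness and independence of the boundaries make it zero.\<close>
    have main: "k j = 0" if k: "\<And>j. k j = of_bool (h j \<ge> 2) \<or> k j = - of_bool (h j < 0)"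
      and kk: "(\<forall>j. k j = of_bool (h j \<ge> 2)) \<or> (\<forall>j. k j = - of_bool (h j < 0))" for k :: "nat \<Rightarrow> int"
    proof -
      have *: "comb n k e \<in> {0, 1} \<and> (outer n e \<noteq> 0 \<longrightarrow> comb n k e = base n e)" for e
      proof (cases "e \<in> E n")
        case False
        then show ?thesis
          using comb_balanced[of n k] base_balanced[of n] by (auto simp: balanced_def)
      next
        case True
        then obtain a b where ab: "a \<noteq> b" "a \<le> n" "b \<le> n"
          "\<forall>j\<in>{1..n}. D j e = of_bool (j = a) - of_bool (j = b)" using sides[of n e] by auto
        define h' k' where "h' j = (if j = 0 then 0 else h j)" and "k' j = (if j = 0 then 0 else k j)" for j :: nat
        have k': "(\<forall>j. k' j = of_bool (h' j \<ge> 2)) \<or> (\<forall>j. k' j = - of_bool (h' j < 0))"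
          using kk by (auto simp: h'_def k'_def)
        have h: "comb n h e = base n e + (h' a - h' b)" and k: "comb n k e = base n e + (k' a - k' b)"
          using span_sides[OF ab] by (auto simp: comb_def h'_def k'_def)
        have b01: "base n e = 0 \<or> base n e = 1" using base_01[of n e] by auto
        have d: "base n e + (h' a - h' b) = 0 \<or> base n e + (h' a - h' b) = 1" using m[of e] h by auto
        \<comment> \<open>By \<open>d\<close> the heights of the two sides differ by at most 1.
          Either the cut does not separate them, or it does and then accounts for the whole
          difference.\<close>
        have ka: "k' a - k' b = 0 \<or> k' a - k' b = h' a - h' b"
        proof -
          from k' consider "k' a = of_bool (h' a \<ge> 2)" "k' b = of_bool (h' b \<ge> 2)"
            | "k' a = - of_bool (h' a < 0)" "k' b = - of_bool (h' b < 0)" by blast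
          then show ?thesis
            using b01 d by cases (cases "h' a \<ge> 2"; cases "h' b \<ge> 2"; cases "h' a < 0"; cases "h' b < 0"; force)+
        qed
        then have 1: "comb n k e \<in> {0, 1}" using k b01 d by auto
        \<comment> \<open>On the periphery one side has height 0, so \<open>d\<close> puts the other
          height in \<open>{0, 1}\<close>, where both cuts give 0.\<close>
        have 2: "comb n k e = base n e" if o: "outer n e \<noteq> 0"
        proof -
          have bo: "base n e = of_bool (outer n e = -1)" using base_outer[of n e] True o by auto
          have oo: "outer n e = of_bool (a \<noteq> 0) - of_bool (b \<noteq> 0)" by (rule outer_sides[OF ab])
          consider "a = 0" "b \<noteq> 0" | "b = 0" "a \<noteq> 0"
            using o oo ab(1) by (cases "a = 0"; cases "b = 0") auto
          then show ?thesis
          proof cases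
            case 1
            then have "base n e = 1" "h' a = 0" "k' a = 0" using bo oo by (auto simp: h'_def k'_def)
            then show ?thesis using d k k' by auto
          next
            case 2
            then have "base n e = 0" "h' b = 0" "k' b = 0" using bo oo by (auto simp: h'_def k'_def)
            then show ?thesis using d k k' by auto
          qed
        qed
        show ?thesis using 1 2 by blast
      qed
      have "comb n k = base n" using comb_balanced[of n k] * by (intro unique) auto
      then have "comb n k = comb n (\<lambda>_. 0)" by (auto simp: comb_def span_def fun_eq_iff)
      from comb_inj[OF this j] show ?thesis .
    qed
    have "of_bool (h j \<ge> 2) = (0::int)" by (rule main[where k = "\<lambda>j. of_bool (h j \<ge> 2)"]) auto
    moreover have "- of_bool (h j < 0) = (0::int)" by (rule main[where k = "\<lambda>j. - of_bool (h j < 0)"]) auto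
    ultimately show ?thesis by (auto split: if_splits)
  qed
  then show ?thesis by auto
qed

end

section \<open>Winding numbers and theta curves\<close>

lemma arc_same_image_ends:
  fixes p q :: "real \<Rightarrow> 'a::t2_space"
  assumes "arc p" "arc q" "path_image q = path_image p"
  shows "(pathstart q = pathstart p \<and> pathfinish q = pathfinish p) \<or>
    (pathstart q = pathfinish p \<and> pathfinish q = pathstart p)"
proof -
  obtain p' where p': "homeomorphism {0..1} (path_image p) p p'"
    using homeomorphism_arc[OF assms(1)] by blast
  define f where "f = p' \<circ> q"
  have img: "f ` {0..1} = {0..1}"
    using homeomorphism_image2[OF p'] assms(3) unfolding f_def path_image_def image_comp[symmetric] by simp
  have inj: "inj_on f {0..1}"
    unfolding f_def
  proof (rule comp_inj_on)
    show "inj_on q {0..1}" using assms(2) by (simp add: arc_def)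
    show "inj_on p' (q ` {0..1})"
      using homeomorphism_apply2[OF p'] assms(3) unfolding path_image_def by (metis inj_onI)
  qed
  have cont: "continuous_on {0..1} f"
    unfolding f_def
  proof (rule continuous_on_compose)
    show "continuous_on {0..1} q" using assms(2) by (simp add: arc_def path_def)
    show "continuous_on (q ` {0..1}) p'"
      using p' assms(3) by (simp add: homeomorphism_def path_image_def)
  qed
  have pf: "p (f t) = q t" if "t \<in> {0..1}" for t
    using homeomorphism_apply2[OF p', of "q t"] imageI[OF that, of q] assms(3)
      by (simp add: f_def path_image_def)
  \<comment> \<open>A continuous injection of an interval is strictly monotone, so interior points
    go strictly between \<open>f 0\<close> and \<open>f 1\<close>. As \<open>f\<close> is onto, it
    permutes 0 and 1.\<close>
  have between: "(f 0 < f x \<and> f x < f 1) \<or> (f 1 < f x \<and> f x < f 0)" if "x \<in> {0<..<1}" for x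
    using continuous_inj_imp_mono[OF _ _ cont inj, of x] that by auto
  have rng: "f x \<in> {0..1}" if "x \<in> {0..1}" for x using img that by blast
  obtain x0 x1 where x: "x0 \<in> {0..1}" "f x0 = 0" "x1 \<in> {0..1}" "f x1 = 1"
  proof -
    have "0 \<in> f ` {0..1}" "1 \<in> f ` {0..1}" unfolding img by auto
    then show thesis using that by (elim imageE) metis
  qed
  have "x0 = 0 \<or> x0 = 1" using between[of x0] x rng[of 0] rng[of 1] by fastforce
  moreover have "x1 = 0 \<or> x1 = 1" using between[of x1] x rng[of 0] rng[of 1] by fastforce
  ultimately have "(f 0 = 0 \<and> f 1 = 1) \<or> (f 0 = 1 \<and> f 1 = 0)" using x by auto
  then show ?thesis using pf[of 0] pf[of 1] by (auto simp: pathstart_def pathfinish_def)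
qed

text \<open>The two arcs differ by the reparametrisation \<open>f\<close>, which fixes 0 and 1, and
  are therefore homotopic within their common image. So the winding number depends only on the point
  set and the direction, as it must when edges are point sets.\<close>

lemma arc_same_image_winding_number:
  assumes "arc p" "arc q" "path_image q = path_image p" "pathstart q = pathstart p"
    "z \<notin> path_image p"
  shows "winding_number q z = winding_number p z"
proof -
  obtain p' where p': "homeomorphism {0..1} (path_image p) p p'"
    using homeomorphism_arc[OF assms(1)] by blast
  define f where "f = p' \<circ> q"
  have fin: "pathfinish q = pathfinish p"
    using arc_same_image_ends[OF assms(1-3)] assms(1,4) arc_distinct_ends[OF assms(1)] by auto
  have p'p: "p' (p t) = t" if "t \<in> {0..1}" for t
    using p' that by (auto simp: homeomorphism_def)
  have "homotopic_paths (-{z}) p q"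
  proof (rule homotopic_paths_reparametrize)
    show "path p" using assms(1) by (rule arc_imp_path)
    show "path_image p \<subseteq> - {z}" using assms(5) by auto
    show "continuous_on {0..1} f"
      unfolding f_def
    proof (rule continuous_on_compose)
      show "continuous_on {0..1} q" using assms(2) by (simp add: arc_def path_def)
      show "continuous_on (q ` {0..1}) p'"
        using p' assms(3) by (simp add: homeomorphism_def path_image_def)
    qed
    show "f \<in> {0..1} \<rightarrow> {0..1}"
    proof -
      have "f ` {0..1} = {0..1}"
        using homeomorphism_image2[OF p'] assms(3) unfolding f_def path_image_def image_comp[symmetric] by simp
      then show ?thesis by blast
    qed
    show "f 0 = 0" using assms(4) p'p[of 0] by (simp add: f_def pathstart_def)
    show "f 1 = 1" using fin p'p[of 1] by (simp add: f_def pathfinish_def)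
    show "q t = p (f t)" if "t \<in> {0..1}" for t
      using homeomorphism_apply2[OF p', of "q t"] imageI[OF that, of q] assms(3)
      by (simp add: f_def path_image_def)
  qed
  then show ?thesis using winding_number_homotopic_paths by metis
qed

lemma arc_same_image_winding_number_reverse:
  assumes "arc p" "arc q" "path_image q = path_image p" "pathstart q = pathfinish p"
    "z \<notin> path_image p"
  shows "winding_number q z = - winding_number p z"
proof -
  have "winding_number q z = winding_number (reversepath p) z"
    using assms by (intro arc_same_image_winding_number) (auto simp: arc_reversepath)
  then show ?thesis using winding_number_reversepath assms arc_imp_path by metis
qed

text \<open>A simple closed curve cut at two points, both arcs running from the first point to the
  second. Its winding number is then the difference of two arc values, and the three loops of a
  theta curve become differences of three arcs.\<close>

definition arc_pair :: "(real \<Rightarrow> complex) \<Rightarrow> (real \<Rightarrow> complex) \<Rightarrow> bool" where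
  "arc_pair p q \<longleftrightarrow> arc p \<and> arc q \<and> pathstart q = pathstart p \<and> pathfinish q = pathfinish p \<and>
     path_image p \<inter> path_image q = {pathstart p, pathfinish p}"

definition pair_loop :: "(real \<Rightarrow> complex) \<Rightarrow> (real \<Rightarrow> complex) \<Rightarrow> real \<Rightarrow> complex" where
  "pair_loop p q = p +++ reversepath q"

lemma pair_loop:
  assumes "arc_pair p q"
  shows "simple_path (pair_loop p q)" "pathfinish (pair_loop p q) = pathstart (pair_loop p q)"
    "path_image (pair_loop p q) = path_image p \<union> path_image q"
    "pathstart (pair_loop p q) = pathstart p"
  using assms unfolding arc_pair_def pair_loop_def
  by (auto simp: path_image_join intro!: simple_path_join_loop arc_reversepath)

lemma winding_number_pair_loop:
  assumes "arc_pair p q" "z \<notin> path_image p" "z \<notin> path_image q"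
  shows "winding_number (pair_loop p q) z = winding_number p z - winding_number q z"
  using assms unfolding arc_pair_def pair_loop_def
  by (auto simp: winding_number_join winding_number_reversepath arc_imp_path)

lemma arc_pair_sym: "arc_pair p q \<Longrightarrow> arc_pair q p"
  by (auto simp: arc_pair_def)

lemma arc_pair_reverse: "arc_pair p q \<Longrightarrow> arc_pair (reversepath p) (reversepath q)"
  by (auto simp: arc_pair_def arc_reversepath)

lemma inside_UnD: "z \<in> inside (A \<union> B) \<Longrightarrow> z \<notin> A \<and> z \<notin> B"
  using inside_no_overlap[of "A \<union> B"] by blast

lemma jordan_pair:
  assumes "arc_pair p q"
  defines "X \<equiv> path_image p \<union> path_image q"
  shows "inside X \<noteq> {}" "open (inside X)" "connected (inside X)" "bounded (inside X)"
    "connected (outside X)" "\<not> bounded (outside X)" "inside X \<inter> outside X = {}"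
    "inside X \<union> outside X = - X" "frontier (inside X) = X" "frontier (outside X) = X"
  using Jordan_inside_outside[OF pair_loop(1,2)[OF assms(1)]]
  unfolding pair_loop(3)[OF assms(1)] X_def by simp_all

lemma wn_inside_pair:
  assumes "arc_pair p q"
  obtains d :: int where "d = 1 \<or> d = -1"
    "\<And>z. z \<in> inside (path_image p \<union> path_image q) \<Longrightarrow> winding_number p z - winding_number q z = of_int d"
proof -
  have *: "winding_number (pair_loop p q) z = winding_number p z - winding_number q z"
    if "z \<in> inside (path_image p \<union> path_image q)" for z
    using inside_UnD[OF that] by (intro winding_number_pair_loop assms) auto
  show thesis
    using simple_closed_path_winding_number_inside[OF pair_loop(1)[OF assms]]
  proof cases
    case 1
    then show ?thesis using that[of 1] * pair_loop(3)[OF assms] by auto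
  next
    case 2
    then show ?thesis using that[of "-1"] * pair_loop(3)[OF assms] by auto
  qed
qed

lemma wn_outside_pair:
  assumes "arc_pair p q" "z \<notin> path_image p" "z \<notin> path_image q" 
    "z \<notin> inside (path_image p \<union> path_image q)"
  shows "winding_number p z - winding_number q z = 0"
proof -
  have "z \<in> outside (path_image (pair_loop p q))"
    using assms(2-4) jordan_pair(8)[OF assms(1)] unfolding pair_loop(3)[OF assms(1)] by blast
  then show ?thesis
    using winding_number_zero_in_outside[of "pair_loop p q"] pair_loop[OF assms(1)]
      winding_number_pair_loop[OF assms(1-3)] by (simp add: simple_path_imp_path)
qed

lemma arc_pair_not_subset:
  assumes "arc_pair p q"
  shows "\<not> path_image q \<subseteq> path_image p"
proof
  assume "path_image q \<subseteq> path_image p"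
  then have "path_image q \<subseteq> {pathstart p, pathfinish p}" using assms by (auto simp: arc_pair_def)
  moreover have "infinite (path_image q)"
    using assms finite_imageD[of q "{0..1}"] infinite_Icc[of "0::real" 1]
    by (auto simp: arc_pair_def arc_def path_image_def)
  ultimately show False using finite_subset by blast
qed

text \<open>The clockwise relation quantifies over all parametrisations; this is why they agree. If
  \<open>g\<close> ran through \<open>p\<close> backwards, it would run through \<open>q\<close> the
  other way as well, and its winding number about an inside point would change sign, although it is
  1 or -1.\<close>

lemma direction_unique:
  assumes pq: "arc_pair p q" and g: "simple_path g" "pathfinish g = pathstart g"
    and img: "path_image g = path_image p \<union> path_image q"
    and ab: "0 \<le> a" "a < b" "b \<le> 1" "g ` {a..b} = path_image p"
    and wn: "\<And>z. z \<in> inside (path_image g) \<Longrightarrow> winding_number g z = winding_number p z - winding_number q z"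
  shows "g a = pathstart p \<and> g b = pathfinish p"
proof -
  \<comment> \<open>Starting the loop at parameter \<open>a\<close> turns the part on
    \<open>p\<close> into the initial segment \<open>{0..c}\<close>; the rest \<open>r\<close> must
    then have the image of \<open>q\<close>.\<close>
  define k where "k = shiftpath a g"
  define c where "c = b - a"
  have k: "simple_path k" "pathfinish k = pathstart k" "path_image k = path_image g"
    using g ab simple_path_shiftpath[of g a] path_image_shiftpath[of a g]
    by (auto simp: k_def closed_shiftpath)
  have kt: "k t = g (a + t)" if "0 \<le> t" "t \<le> c" for t
    using that ab by (simp add: k_def shiftpath_def c_def)
  have kimg: "k ` {0..c} = path_image p"
  proof -
    have "k ` {0..c} = (\<lambda>t. g (a + t)) ` {0..c}" using kt by (intro image_cong) auto
    moreover have "{a..b} = (\<lambda>t. a + t) ` {0..c}" by (simp add: c_def)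
    ultimately show ?thesis using ab(4) by (simp only: image_image)
  qed
  have c: "0 < c" "c < 1"
  proof -
    show "0 < c" using ab by (simp add: c_def)
    have "c \<noteq> 1"
    proof
      assume "c = 1"
      then have "path_image k = path_image p" using kimg by (simp add: path_image_def)
      then show False using arc_pair_not_subset[OF pq] k img by auto
    qed
    then show "c < 1" using ab by (simp add: c_def)
  qed
  define p' r where "p' = subpath 0 c k" and "r = subpath c 1 k"
  have k0: "k 0 = g a" "k c = g b" "k 1 = g a"
    using kt[of 0] kt[of c] c k(2) by (simp_all add: c_def pathfinish_def pathstart_def)
  have p': "arc p'" unfolding p'_def using c by (intro arc_simple_path_subpath_interior k(1)) auto
  have p'i: "path_image p' = path_image p" unfolding p'_def using c kimg by (simp add: path_image_subpath)
  have p'e: "pathstart p' = g a" "pathfinish p' = g b" unfolding p'_def by (simp_all add: k0)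
  have r: "arc r" unfolding r_def using c by (intro arc_simple_path_subpath_interior k(1)) auto
  have ri: "path_image r = k ` {c..1}" unfolding r_def using c by (simp add: path_image_subpath)
  have re: "pathstart r = g b" "pathfinish r = g a" unfolding r_def by (simp_all add: k0)
  have loop: "k x = k y \<Longrightarrow> x = y \<or> x = 0 \<and> y = 1 \<or> x = 1 \<and> y = 0" if "x \<in> {0..1}" "y \<in> {0..1}" for x y
    using k(1) that unfolding simple_path_def loop_free_def by blast
  have ends: "pathstart p = g a \<and> pathfinish p = g b \<or> pathstart p = g b \<and> pathfinish p = g a"
    using arc_same_image_ends[OF p' _ p'i[symmetric]] p'e pq unfolding arc_pair_def by metis
  have rq: "path_image r = path_image q"
  proof -
    have u: "path_image p \<union> path_image q = path_image p \<union> path_image r"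
    proof -
      have "{0..1} = {0..c} \<union> {c..1}" using c by auto
      then have "path_image k = k ` {0..c} \<union> k ` {c..1}" unfolding path_image_def by (metis image_Un)
      then show ?thesis using kimg ri img k(3) by simp
    qed
    have pr: "path_image p \<inter> path_image r = {g a, g b}"
    proof
      show "path_image p \<inter> path_image r \<subseteq> {g a, g b}"
      proof
        fix x assume "x \<in> path_image p \<inter> path_image r"
        then have "x \<in> k ` {0..c}" "x \<in> k ` {c..1}" unfolding kimg ri by blast+
        then obtain s t where st: "s \<in> {0..c}" "t \<in> {c..1}" "x = k s" "x = k t" by blast
        then have "s = t \<or> s = 0 \<and> t = 1 \<or> s = 1 \<and> t = 0" using loop[of s t] c by auto
        then have "s = c \<or> s = 0" using st c by auto
        then show "x \<in> {g a, g b}" using st(3) k0 by auto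
      qed
      have "g a \<in> path_image p" "g b \<in> path_image p"
        using pathstart_in_path_image[of p'] pathfinish_in_path_image[of p'] unfolding p'e p'i by blast+
      moreover have "g b \<in> path_image r" "g a \<in> path_image r"
        using pathstart_in_path_image[of r] pathfinish_in_path_image[of r] unfolding re by blast+
      ultimately show "{g a, g b} \<subseteq> path_image p \<inter> path_image r" by blast
    qed
    have "path_image p \<inter> path_image q = {pathstart p, pathfinish p}"
      using pq unfolding arc_pair_def by blast
    then have "path_image p \<inter> path_image q = {g a, g b}" using ends by (metis insert_commute)
    with u pr show ?thesis by blast
  qed
  show ?thesis
  proof (rule ccontr)
    assume "\<not> ?thesis"
    with ends have e: "pathstart p = g b" "pathfinish p = g a" by auto
    obtain z where z: "z \<in> inside (path_image g)" using jordan_pair[OF pq] img by auto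
    then have zn: "z \<notin> path_image p" "z \<notin> path_image q"
      using inside_UnD[of z "path_image p" "path_image q"] img by auto
    obtain d :: int where d: "d = 1 \<or> d = -1" "winding_number p z - winding_number q z = of_int d"
      using wn_inside_pair[OF pq] z img by metis
    have "winding_number p' z = - winding_number p z"
      using pq zn by (intro arc_same_image_winding_number_reverse p') (simp_all add: arc_pair_def p'i p'e e)
    moreover have "winding_number r z = winding_number q z"
      using pq zn by (intro arc_same_image_winding_number r) (simp_all add: arc_pair_def rq re e[symmetric])
    moreover have "winding_number p' z + winding_number r z = winding_number k z"
      unfolding p'_def r_def using c k img zn
      by (subst winding_number_subpath_combine) (auto simp: simple_path_imp_path)
    moreover have "winding_number k z = winding_number g z"
      unfolding k_def using g ab zn img
      by (intro winding_number_shiftpath) (auto simp: simple_path_imp_path)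
    ultimately have "of_int d = - (of_int d :: complex)" using wn[OF z] d by (simp add: algebra_simps)
    then show False using d(1) by auto
  qed
qed

text \<open>Otherwise no arc enters the inside of the loop formed by the other two. These insides
  are then connected, miss all three arcs and have different frontiers, so a point inside the loop
  of \<open>p\<close> and \<open>a2\<close> is outside both other loops. But its winding number for
  that loop is the sum of those for the other two, and 1 or -1 is not 0 + 0.\<close>

lemma theta_nested:
  assumes p1: "arc_pair p a1" and p2: "arc_pair p a2" and a12: "arc_pair a1 a2"
    and out: "path_image p \<inter> inside (path_image a1 \<union> path_image a2) = {}"
  shows "path_image a1 \<inter> inside (path_image p \<union> path_image a2) \<noteq> {} \<or>
    path_image a2 \<inter> inside (path_image p \<union> path_image a1) \<noteq> {}"
proof (rule ccontr)
  assume *: "\<not> ?thesis"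
  define I1 I2 I3 where "I1 = inside (path_image p \<union> path_image a2)"
    and "I2 = inside (path_image p \<union> path_image a1)"
    and "I3 = inside (path_image a1 \<union> path_image a2)"
  define X where "X = path_image p \<union> path_image a1 \<union> path_image a2"
  have free: "I1 \<inter> X = {}" "I2 \<inter> X = {}" "I3 \<inter> X = {}"
    using * out inside_no_overlap[of "path_image p \<union> path_image a2"]
      inside_no_overlap[of "path_image p \<union> path_image a1"]
      inside_no_overlap[of "path_image a1 \<union> path_image a2"]
    unfolding I1_def I2_def I3_def X_def by blast+
  have J: "I1 \<noteq> {}" "connected I1" "connected I2" "connected I3"
    "frontier I1 = path_image p \<union> path_image a2" "frontier I2 = path_image p \<union> path_image a1"
    "frontier I3 = path_image a1 \<union> path_image a2"
    unfolding I1_def I2_def I3_def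
    by (rule jordan_pair[OF p2] jordan_pair[OF p1] jordan_pair[OF a12])+
  have FX: "frontier I1 \<subseteq> X" "frontier I2 \<subseteq> X" "frontier I3 \<subseteq> X"
    unfolding J X_def by blast+
  have disj: "A \<inter> B = {}"
    if "connected A" "connected B" "A \<inter> X = {}" "B \<inter> X = {}" "frontier A \<subseteq> X" "frontier B \<subseteq> X"
      "frontier A \<noteq> frontier B" for A B :: "complex set"
  proof (rule ccontr)
    assume n: "A \<inter> B \<noteq> {}"
    have "A \<subseteq> B" using connected_Int_frontier[of A B] that n by blast
    moreover have "B \<subseteq> A" using connected_Int_frontier[of B A] that n by blast
    ultimately show False using that by auto
  qed
  have int: "path_image a1 \<inter> path_image a2 = {pathstart p, pathfinish p}"
      "path_image p \<inter> path_image a1 = {pathstart p, pathfinish p}"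
    using p1 p2 a12 by (simp_all add: arc_pair_def)
  have mem: "{pathstart p, pathfinish p} \<subseteq> path_image p" by (simp add: pathstart_in_path_image pathfinish_in_path_image)
  have mem2: "{pathstart p, pathfinish p} \<subseteq> path_image a2" using int(1) by blast
  have "path_image p \<union> path_image a2 \<noteq> path_image p \<union> path_image a1"
  proof
    assume "path_image p \<union> path_image a2 = path_image p \<union> path_image a1"
    then have "path_image a2 \<subseteq> path_image p \<union> (path_image a1 \<inter> path_image a2)" by blast
    then have "path_image a2 \<subseteq> path_image p" unfolding int using mem by blast
    then show False using arc_pair_not_subset[OF p2] by blast
  qed
  then have 12: "I1 \<inter> I2 = {}" using disj[OF J(2,3) free(1,2) FX(1,2)] unfolding J(5,6) by blast
  have "path_image p \<union> path_image a2 \<noteq> path_image a1 \<union> path_image a2"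
  proof
    assume "path_image p \<union> path_image a2 = path_image a1 \<union> path_image a2"
    then have "path_image p \<subseteq> (path_image p \<inter> path_image a1) \<union> path_image a2" by blast
    then have "path_image p \<subseteq> path_image a2" unfolding int using mem2 by blast
    then show False using arc_pair_not_subset[OF arc_pair_sym[OF p2]] by blast
  qed
  then have 13: "I1 \<inter> I3 = {}" using disj[OF J(2,4) free(1,3) FX(1,3)] unfolding J(5,7) by blast
  obtain z where z: "z \<in> I1" using J by auto
  then have zn: "z \<notin> path_image p" "z \<notin> path_image a1" "z \<notin> path_image a2" using free by (auto simp: X_def)
  obtain d :: int where d: "d = 1 \<or> d = -1" "winding_number p z - winding_number a2 z = of_int d"
    using wn_inside_pair[OF p2] z I1_def by metis
  have "winding_number p z - winding_number a1 z = 0"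
    using wn_outside_pair[OF p1 zn(1,2)] z 12 I2_def by auto
  moreover have "winding_number a1 z - winding_number a2 z = 0"
    using wn_outside_pair[OF a12 zn(2,3)] z 13 I3_def by auto
  ultimately have "of_int d = (0 :: complex)" using d by (simp add: algebra_simps)
  then show False using d by auto
qed

lemma theta_split:
  assumes pr: "arc_pair p r" and pq: "arc_pair p q" and qr: "arc_pair q r"
    and "path_image q \<inter> inside (path_image p \<union> path_image r) \<noteq> {}"
  shows "inside (path_image p \<union> path_image q) \<inter> inside (path_image q \<union> path_image r) = {}"
    "inside (path_image p \<union> path_image q) \<union> inside (path_image q \<union> path_image r) \<union>
       (path_image q - {pathstart p, pathfinish p}) = inside (path_image p \<union> path_image r)"
proof -
  have ends: "pathstart r = pathstart p" "pathfinish r = pathfinish p"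
    "pathstart q = pathstart p" "pathfinish q = pathfinish p"
    and sp: "simple_path p" "simple_path q" "simple_path r" "pathstart p \<noteq> pathfinish p"
    and int: "path_image p \<inter> path_image r = {pathstart p, pathfinish p}"
      "path_image p \<inter> path_image q = {pathstart p, pathfinish p}"
      "path_image r \<inter> path_image q = {pathstart p, pathfinish p}"
  proof -
    have A: "arc p" "arc q" "arc r" using pr pq unfolding arc_pair_def by blast+
    show "simple_path p" "simple_path q" "simple_path r" using A arc_imp_simple_path by blast+
    show "pathstart p \<noteq> pathfinish p" using arc_distinct_ends[OF A(1)] by metis
    show e: "pathstart r = pathstart p" "pathfinish r = pathfinish p"
      "pathstart q = pathstart p" "pathfinish q = pathfinish p"
      "path_image p \<inter> path_image r = {pathstart p, pathfinish p}"
      "path_image p \<inter> path_image q = {pathstart p, pathfinish p}"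
      using pr pq unfolding arc_pair_def by blast+
    show "path_image r \<inter> path_image q = {pathstart p, pathfinish p}"
      using qr e unfolding arc_pair_def by (metis Int_commute)
  qed
  have "inside (path_image p \<union> path_image q) \<inter> inside (path_image r \<union> path_image q) = {} \<and>
    inside (path_image p \<union> path_image q) \<union> inside (path_image r \<union> path_image q) \<union>
       (path_image q - {pathstart p, pathfinish p}) = inside (path_image p \<union> path_image r)"
    by (rule split_inside_simple_closed_curve[OF sp(1) refl refl sp(3) ends(1,2) sp(2) ends(3,4) sp(4) int assms(4)])
      (rule conjI)
  then show "inside (path_image p \<union> path_image q) \<inter> inside (path_image q \<union> path_image r) = {}"
    "inside (path_image p \<union> path_image q) \<union> inside (path_image q \<union> path_image r) \<union>
       (path_image q - {pathstart p, pathfinish p}) = inside (path_image p \<union> path_image r)"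
    by (simp_all only: Un_commute[of "path_image r" "path_image q"])
qed

text \<open>A point inside one of the two small loops is not inside the other one, where the winding
  number is 0. By additivity it has the same winding number for its small loop as for the big one.
  This makes clockwise boundaries add up.\<close>

lemma theta_orientation:
  assumes pr: "arc_pair p r" and pq: "arc_pair p q" and qr: "arc_pair q r"
    and "path_image q \<inter> inside (path_image p \<union> path_image r) \<noteq> {}"
  obtains d :: int where "d = 1 \<or> d = -1"
    "\<And>z. z \<in> inside (path_image p \<union> path_image r) \<Longrightarrow> winding_number p z - winding_number r z = of_int d"
    "\<And>z. z \<in> inside (path_image p \<union> path_image q) \<Longrightarrow> winding_number p z - winding_number q z = of_int d"
    "\<And>z. z \<in> inside (path_image q \<union> path_image r) \<Longrightarrow> winding_number q z - winding_number r z = of_int d"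
proof -
  note s = theta_split[OF assms]
  have sub: "inside (path_image p \<union> path_image q) \<subseteq> inside (path_image p \<union> path_image r)"
    "inside (path_image q \<union> path_image r) \<subseteq> inside (path_image p \<union> path_image r)" using s(2) by blast+
  obtain d :: int where d: "d = 1 \<or> d = -1"
    "\<And>z. z \<in> inside (path_image p \<union> path_image r) \<Longrightarrow> winding_number p z - winding_number r z = of_int d"
    using wn_inside_pair[OF pr] by metis
  have 1: "winding_number p z - winding_number q z = of_int d"
    if z: "z \<in> inside (path_image p \<union> path_image q)" for z
  proof -
    have zn: "z \<notin> path_image q" using z inside_no_overlap[of "path_image p \<union> path_image q"] by blast
    have zr: "z \<notin> path_image r" using z s(2) inside_no_overlap[of "path_image p \<union> path_image r"] by blast
    have "winding_number q z - winding_number r z = 0"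
      using z s(1) by (intro wn_outside_pair[OF qr zn zr]) blast
    moreover have "winding_number p z - winding_number r z = of_int d" using z sub by (intro d) blast
    ultimately show ?thesis by (simp add: algebra_simps)
  qed
  have 2: "winding_number q z - winding_number r z = of_int d"
    if z: "z \<in> inside (path_image q \<union> path_image r)" for z
  proof -
    have zn: "z \<notin> path_image q" using z inside_no_overlap[of "path_image q \<union> path_image r"] by blast
    have zp: "z \<notin> path_image p" using z s(2) inside_no_overlap[of "path_image p \<union> path_image r"] by blast
    have "winding_number p z - winding_number q z = 0"
      using z s(1) by (intro wn_outside_pair[OF pq zp zn]) blast
    moreover have "winding_number p z - winding_number r z = of_int d" using z sub by (intro d) blast
    ultimately show ?thesis by (simp add: algebra_simps)
  qed
  show thesis using that d 1 2 by blast
qed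

text \<open>Identifies a face known only as a bounded component with frontier on the curve. The
  outer region is unbounded, the loop of \<open>q\<close> and \<open>r\<close> is excluded by
  hypothesis, and the region that remains is connected and meets none of the arcs.\<close>

lemma theta_bounded_face:
  assumes pr: "arc_pair p r" and pq: "arc_pair p q" and qr: "arc_pair q r"
    and ne: "path_image q \<inter> inside (path_image p \<union> path_image r) \<noteq> {}"
    and f: "connected f" "f \<noteq> {}" "bounded f"
    and free: "f \<inter> (path_image p \<union> path_image q \<union> path_image r) = {}"
    and fr: "frontier f \<subseteq> path_image p \<union> path_image q \<union> path_image r"
    and out: "f \<inter> inside (path_image q \<union> path_image r) = {}"
  shows "f = inside (path_image p \<union> path_image q)"
proof -
  define X where "X = path_image p \<union> path_image q \<union> path_image r"
  define I O' A B where "I = inside (path_image p \<union> path_image r)"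
    and "O' = outside (path_image p \<union> path_image r)"
    and "A = inside (path_image p \<union> path_image q)" and "B = inside (path_image q \<union> path_image r)"
  have s: "A \<inter> B = {}" "A \<union> B \<union> (path_image q - {pathstart p, pathfinish p}) = I"
    unfolding A_def B_def I_def by (rule theta_split[OF pr pq qr ne])+
  have J: "connected O'" "\<not> bounded O'" "I \<union> O' = - (path_image p \<union> path_image r)" "I \<inter> O' = {}"
    unfolding I_def O'_def by (rule jordan_pair[OF pr])+
  have J': "connected A" using jordan_pair[OF pq] by (simp_all add: A_def)
  have A: "A \<inter> path_image p = {}" "A \<inter> path_image q = {}"
    using inside_no_overlap[of "path_image p \<union> path_image q"] unfolding A_def by blast+
  have max: "T \<subseteq> f" if "connected T" "T \<inter> f \<noteq> {}" "T \<inter> X = {}" for T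
    using connected_Int_frontier[of T f] that fr unfolding X_def by blast
  have "{pathstart p, pathfinish p} \<subseteq> path_image p"
    by (simp add: pathstart_in_path_image pathfinish_in_path_image)
  then have "O' \<inter> path_image q = {}" using s(2) J(3,4) by blast
  then have "O' \<inter> X = {}" using J(3) unfolding X_def by blast
  then have "O' \<inter> f = {}" using max[OF J(1)] J(2) f(3) bounded_subset by blast
  then have "f \<subseteq> I" using J(3) free by blast
  then have 1: "f \<subseteq> A" using s(2) out free unfolding B_def by blast
  have "A \<inter> X = {}" using A s(2) J(3) unfolding X_def by blast
  then have "A \<subseteq> f" using max[OF J'] 1 f(2) by blast
  with 1 show ?thesis by (simp add: A_def)
qed

text \<open>The outside of \<open>C\<close> misses \<open>X\<close>, is connected and unbounded,
  hence lies in one unbounded component of the complement of \<open>X\<close>. So a graph drawn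
  within its periphery has the outside of the periphery as infinite face.\<close>

lemma outside_filled:
  assumes "connected (outside C)" "\<not> bounded (outside C)" "C \<subseteq> X" "X \<subseteq> C \<union> inside C"
  shows "outside X = outside C"
proof
  show "outside X \<subseteq> outside C" using outside_mono assms(3) by blast
  show "outside C \<subseteq> outside X"
  proof
    fix x assume x: "x \<in> outside C"
    have s: "outside C \<subseteq> - X"
      using assms(4) outside_no_overlap[of C] inside_Int_outside[of C] by blast
    then have "outside C \<subseteq> connected_component_set (- X) x"
      using connected_component_maximal[OF x assms(1)] by blast
    then have "\<not> bounded (connected_component_set (- X) x)" using assms(2) bounded_subset by blast
    then show "x \<in> outside X" using s x by (auto simp: outside_def)
  qed
qed

section \<open>Paths in a bipartite plane graph\<close>

definition sg :: "colour \<Rightarrow> int" where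
  "sg c = (if c = White then 1 else -1)"

lemma sg_neq: "c \<noteq> d \<Longrightarrow> sg c = - sg d"
  by (cases c; cases d) (auto simp: sg_def)

text \<open>An edge of a walk counts \<open>1\<close> if it is traversed from white to black.\<close>

definition pvec :: "(complex \<Rightarrow> colour) \<Rightarrow> complex list \<Rightarrow> complex set list \<Rightarrow> complex set \<Rightarrow> int" where
  "pvec col vs es e = (\<Sum>(v, e')\<leftarrow>zip vs es. if e' = e then sg (col v) else 0)"

lemma pvec_Nil [simp]: "pvec col vs [] e = 0" "pvec col [] es e = 0"
  by (simp_all add: pvec_def)

lemma pvec_Cons:
  "pvec col (v # vs) (e' # es) e = (if e' = e then sg (col v) else 0) + pvec col vs es e"
  by (simp add: pvec_def)

lemma pvec_append:
  "length vs = length es \<Longrightarrow> pvec col (vs @ vs') (es @ es') e = pvec col vs es e + pvec col vs' es' e"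
  by (simp add: pvec_def)

lemma pvec_append1: "length es \<le> length vs \<Longrightarrow> pvec col (vs @ vs') es e = pvec col vs es e"
  by (simp add: pvec_def zip_append1)

lemma pvec_notin: "e \<notin> set es \<Longrightarrow> pvec col vs es e = 0"
  by (induction es arbitrary: vs) (case_tac vs; auto simp: pvec_Cons)+

lemma pvec_nth:
  assumes "distinct es" "k < length es" "length es \<le> length vs"
  shows "pvec col vs es (es ! k) = sg (col (vs ! k))"
  using assms
proof (induction es arbitrary: vs k)
  case (Cons e es)
  then obtain v vs' where vs: "vs = v # vs'" by (cases vs) auto
  show ?case
  proof (cases k)
    case 0
    then show ?thesis using Cons.prems vs by (auto simp: pvec_notin pvec_Cons)
  next
    case (Suc k')
    then have "e \<noteq> es ! k'" using Cons.prems by auto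
    then show ?thesis using Cons.IH[of k' vs'] Cons.prems vs Suc by (auto simp: pvec_Cons)
  qed
qed auto

lemma is_path_Cons:
  assumes "is_path G (v # vs) (e # es)"
  shows "is_path G vs es" "ends G e = {v, hd vs}" "v \<notin> set vs" "vs \<noteq> []" "e \<in> edges G" "v \<in> verts G"
proof -
  have *: "length vs = Suc (length es)" "distinct (v # vs)" "set (v # vs) \<subseteq> verts G"
    "set (e # es) \<subseteq> edges G" "\<And>i. i < Suc (length es) \<Longrightarrow> ends G ((e # es) ! i) = {(v # vs) ! i, (v # vs) ! Suc i}"
    using assms by (auto simp: is_path_def)
  show "vs \<noteq> []" using *(1) by auto
  then show "ends G e = {v, hd vs}" using *(5)[of 0] by (simp add: hd_conv_nth)
  show "is_path G vs es"
    unfolding is_path_def using * *(5)[of "Suc _"] by auto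
qed (use assms in \<open>auto simp: is_path_def\<close>)

lemma is_path_ends_subset:
  assumes "is_path G vs es" "e \<in> set es"
  shows "ends G e \<subseteq> set vs"
proof -
  obtain i where "i < length es" "e = es ! i" using assms(2) by (auto simp: in_set_conv_nth)
  then show ?thesis using assms(1) by (auto simp: is_path_def)
qed

lemma is_path_distinct_edges:
  assumes "is_path G vs es" shows "distinct es"
  unfolding distinct_conv_nth
proof (intro allI impI)
  fix i j assume ij: "i < length es" "j < length es" "i \<noteq> j"
  show "es ! i \<noteq> es ! j"
  proof
    assume "es ! i = es ! j"
    moreover have "ends G (es ! i) = {vs ! i, vs ! Suc i}" "ends G (es ! j) = {vs ! j, vs ! Suc j}"
      using assms ij by (simp_all add: is_path_def)
    ultimately have "{vs ! i, vs ! Suc i} = {vs ! j, vs ! Suc j}" by metis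
    then have "vs ! i = vs ! j \<or> vs ! i = vs ! Suc j \<and> vs ! Suc i = vs ! j"
      by (auto simp: doubleton_eq_iff)
    moreover have "distinct vs" "length vs = Suc (length es)" using assms by (auto simp: is_path_def)
    ultimately show False using ij by (auto simp: nth_eq_iff_index_eq)
  qed
qed

lemma is_path_rev:
  assumes "is_path G vs es" shows "is_path G (rev vs) (rev es)"
proof -
  have "ends G (rev es ! i) = {rev vs ! i, rev vs ! Suc i}" if i: "i < length es" for i
  proof -
    have l: "length vs = Suc (length es)" using assms by (simp add: is_path_def)
    have "rev es ! i = es ! (length es - Suc i)" using i by (simp add: rev_nth)
    moreover have "rev vs ! i = vs ! Suc (length es - Suc i)" using i l by (simp add: rev_nth Suc_diff_Suc)
    moreover have "rev vs ! Suc i = vs ! (length es - Suc i)" using i l by (simp add: rev_nth)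
    moreover have "length es - Suc i < length es" using i by auto
    ultimately show ?thesis using assms unfolding is_path_def by (metis insert_commute)
  qed
  then show ?thesis using assms by (auto simp: is_path_def)
qed

lemma is_path_drop:
  assumes "is_path G vs es" "k \<le> length es"
  shows "is_path G (drop k vs) (drop k es)"
  using assms by (auto simp: is_path_def dest: in_set_dropD)

locale plane_bip =
  fixes G :: pgraph and col :: "complex \<Rightarrow> colour"
  assumes plane: "plane_graph G" and colouring: "proper_colouring G col"
begin

lemma finite_edges: "finite (edges G)" and finite_verts: "finite (verts G)"
  using plane by (auto simp: plane_graph_def)

lemma ends_col: "e \<in> edges G \<Longrightarrow> ends G e = {u, v} \<Longrightarrow> col u \<noteq> col v"
  using colouring by (auto simp: proper_colouring_def)

lemma ex_earc:
  assumes "e \<in> edges G"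
  shows "\<exists>g. arc g \<and> path_image g = e \<and> ends G e = {pathstart g, pathfinish g} \<and>
    col (pathstart g) = White \<and> col (pathfinish g) = Black"
proof -
  obtain g where g: "arc g" "path_image g = e" "ends G e = {pathstart g, pathfinish g}"
    using plane assms by (auto simp: plane_graph_def)
  have "col (pathstart g) \<noteq> col (pathfinish g)" using ends_col[OF assms g(3)] .
  then consider "col (pathstart g) = White" "col (pathfinish g) = Black"
    | "col (pathstart g) = Black" "col (pathfinish g) = White"
    by (metis colour.exhaust)
  then show ?thesis
  proof cases
    case 1
    then show ?thesis using g by blast
  next
    case 2
    then show ?thesis using g
      by (intro exI[of _ "reversepath g"]) (auto simp: arc_reversepath insert_commute)
  qed
qed

definition earc :: "complex set \<Rightarrow> real \<Rightarrow> complex" where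
  "earc e = (SOME g. arc g \<and> path_image g = e \<and> ends G e = {pathstart g, pathfinish g} \<and>
    col (pathstart g) = White \<and> col (pathfinish g) = Black)"

lemma earc:
  assumes "e \<in> edges G"
  shows "arc (earc e)" "path_image (earc e) = e" "ends G e = {pathstart (earc e), pathfinish (earc e)}"
    "col (pathstart (earc e)) = White" "col (pathfinish (earc e)) = Black"
  using someI_ex[OF ex_earc[OF assms]] unfolding earc_def by blast+

section \<open>Winding numbers of integer edge functions\<close>

definition ewn :: "complex set \<Rightarrow> complex \<Rightarrow> complex" where
  "ewn e z = winding_number (earc e) z"

text \<open>Single arcs have no integral winding number, but the sum over a closed walk has one.
  Linearity allows evaluating a combination of face boundaries at a point term by term.\<close>

definition wn :: "(complex set \<Rightarrow> int) \<Rightarrow> complex \<Rightarrow> complex" where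
  "wn f z = (\<Sum>e\<in>edges G. of_int (f e) * ewn e z)"

lemma wn_diff: "wn (\<lambda>e. f e - g e) z = wn f z - wn g z"
  by (simp add: wn_def left_diff_distrib sum_subtractf)

lemma wn_scale: "wn (\<lambda>e. k * f e) z = of_int k * wn f z"
  by (simp add: wn_def sum_distrib_left mult.assoc)

lemma wn_sum: "wn (\<lambda>e. \<Sum>j\<in>J. f j e) z = (\<Sum>j\<in>J. wn (f j) z)"
  unfolding wn_def by (subst sum.swap) (simp add: sum_distrib_right)

lemma wn_pvec:
  "set es \<subseteq> edges G \<Longrightarrow> wn (pvec col vs es) z = (\<Sum>(v, e)\<leftarrow>zip vs es. of_int (sg (col v)) * ewn e z)"
proof (induction es arbitrary: vs)
  case (Cons e es)
  show ?case
  proof (cases vs)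
    case (Cons v vs')
    have "wn (pvec col (v # vs') (e # es)) z =
      (\<Sum>e'\<in>edges G. (if e' = e then of_int (sg (col v)) * ewn e z else 0)) + wn (pvec col vs' es) z"
      unfolding wn_def sum.distrib[symmetric] by (intro sum.cong) (auto simp: ring_distribs pvec_Cons)
    then show ?thesis using Cons.IH[of vs'] Cons.prems local.Cons finite_edges by simp
  qed (simp add: wn_def)
qed (simp add: wn_def)

lemma edge_inter:
  assumes "e \<in> edges G" "f \<in> edges G" "e \<noteq> f"
  shows "e \<inter> f \<subseteq> ends G e \<inter> ends G f"
  using plane assms unfolding plane_graph_def ends_def by blast

lemma ends_sub: "ends G e \<subseteq> e"
  by (auto simp: ends_def)

lemma ends_neq: "e \<in> edges G \<Longrightarrow> ends G e = {u, v} \<Longrightarrow> u \<noteq> v"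
  using ends_col by blast

lemma edge_infinite: "e \<in> edges G \<Longrightarrow> infinite e"
  using earc[of e] finite_imageD[of "earc e" "{0..1}"] infinite_Icc[of "0::real" 1]
  by (auto simp: arc_def path_image_def)

lemma edge_arc:
  assumes "e \<in> edges G" "ends G e = {u, v}"
  shows "\<exists>p. arc p \<and> path_image p = e \<and> pathstart p = u \<and> pathfinish p = v \<and>
    (\<forall>z. z \<notin> e \<longrightarrow> winding_number p z = of_int (sg (col u)) * ewn e z)"
proof -
  note a = earc[OF assms(1)]
  show ?thesis
  proof (cases "u = pathstart (earc e)")
    case True
    then have "v = pathfinish (earc e)"
      using a(3) assms(2) ends_neq[OF assms] by (metis doubleton_eq_iff)
    then show ?thesis using a True
      by (intro exI[of _ "earc e"]) (simp add: ewn_def sg_def)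
  next
    case False
    then have u: "u = pathfinish (earc e)" using a(3) assms(2) by (metis doubleton_eq_iff)
    then have v: "v = pathstart (earc e)"
      using a(3) assms(2) ends_neq[OF assms] by (metis doubleton_eq_iff)
    have "winding_number (reversepath (earc e)) z = - ewn e z" if "z \<notin> e" for z
      using winding_number_reversepath[of "earc e" z] a(1,2) that by (simp add: arc_imp_path ewn_def)
    then show ?thesis using a(1,2,5) u v
      by (intro exI[of _ "reversepath (earc e)"]) (simp add: arc_reversepath sg_def)
  qed
qed

text \<open>The bridge from graph paths to arcs. An edge walked from black to white counts
  negatively, just as the reversal of \<open>earc\<close> changes the sign of its winding
  number.\<close>

lemma path_arc:
  assumes "is_path G vs es" "es \<noteq> []"
  shows "\<exists>p. arc p \<and> path_image p = \<Union>(set es) \<and> pathstart p = hd vs \<and> pathfinish p = last vs \<and>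
    (\<forall>z. z \<notin> \<Union>(set es) \<longrightarrow> winding_number p z = wn (pvec col vs es) z)"
  using assms
proof (induction es arbitrary: vs)
  case (Cons e es)
  then obtain v vs' where vs: "vs = v # vs'" by (cases vs) (auto simp: is_path_def)
  note c = is_path_Cons[OF Cons.prems(1)[unfolded vs]]
  obtain p where p: "arc p" "path_image p = e" "pathstart p = v" "pathfinish p = hd vs'"
    "\<And>z. z \<notin> e \<Longrightarrow> winding_number p z = of_int (sg (col v)) * ewn e z"
    using edge_arc[OF c(5,2)] by blast
  have sub: "set (e # es) \<subseteq> edges G" using Cons.prems by (simp add: is_path_def)
  show ?case
  proof (cases "es = []")
    case True
    then have "vs' = [hd vs']" using c(1) by (cases vs') (auto simp: is_path_def)
    then have "last vs = hd vs'" using vs by (metis last.simps list.distinct(1))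
    then show ?thesis using p True vs wn_pvec[OF sub, of vs]
      by (intro exI[of _ p]) auto
  next
    case False
    obtain q where q: "arc q" "path_image q = \<Union>(set es)" "pathstart q = hd vs'" "pathfinish q = last vs'"
      "\<And>z. z \<notin> \<Union>(set es) \<Longrightarrow> winding_number q z = wn (pvec col vs' es) z"
      using Cons.IH[OF c(1) False] by blast
    \<comment> \<open>Distinct edges meet only in common ends, and a path visits no vertex twice, so
      the first edge meets the rest only at the joint.\<close>
    have int: "e \<inter> \<Union>(set es) \<subseteq> {hd vs'}"
    proof
      fix x assume "x \<in> e \<inter> \<Union>(set es)"
      then obtain f where f: "f \<in> set es" "x \<in> e" "x \<in> f" by blast
      have fs: "ends G f \<subseteq> set vs'" by (rule is_path_ends_subset[OF c(1) f(1)])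
      have "e \<noteq> f" using fs c(2,3) by auto
      then have "x \<in> ends G e" "x \<in> ends G f" using edge_inter[OF c(5), of f] f sub by auto
      then show "x \<in> {hd vs'}" using fs c(2,3) by auto
    qed
    have "winding_number (p +++ q) z = wn (pvec col vs (e # es)) z" if "z \<notin> \<Union>(set (e # es))" for z
    proof -
      have z: "z \<notin> e" "z \<notin> \<Union>(set es)" using that by auto
      have "winding_number (p +++ q) z = winding_number p z + winding_number q z"
        using p q z by (intro winding_number_join) (simp_all add: arc_imp_path)
      also have "\<dots> = of_int (sg (col v)) * ewn e z + wn (pvec col vs' es) z" using p(5) q(5) z by simp
      finally show ?thesis using sub vs by (simp add: wn_pvec)
    qed
    moreover have "arc (p +++ q)" using p q int by (intro arc_join) simp_all
    moreover have "path_image (p +++ q) = \<Union>(set (e # es))" using p q by (simp add: path_image_join)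
    moreover have "last vs = last vs'" using vs c(4) by simp
    ultimately show ?thesis using p q vs by (intro exI[of _ "p +++ q"]) simp
  qed
qed simp

text \<open>The two edges through an inner vertex are walked from vertices of opposite colours, so
  their values cancel; only the two ends of the path contribute.\<close>

lemma pvec_balance:
  assumes "is_path G vs es"
  shows "(\<Sum>e | e \<in> edges G \<and> v \<in> ends G e. pvec col vs es e) =
    of_bool (v = hd vs) * sg (col (hd vs)) - of_bool (v = last vs) * sg (col (last vs))"
  using assms
proof (induction es arbitrary: vs)
  case Nil
  then show ?case by (cases vs) (auto simp: is_path_def)
next
  case (Cons e es)
  then obtain u vs' where vs: "vs = u # vs'" by (cases vs) (auto simp: is_path_def)
  note c = is_path_Cons[OF Cons.prems(1)[unfolded vs]]
  have sgn: "sg (col u) = - sg (col (hd vs'))" using ends_col[OF c(5,2)] by (rule sg_neq)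
  have neq: "u \<noteq> hd vs'" using ends_neq[OF c(5,2)] .
  have "(\<Sum>e' | e' \<in> edges G \<and> v \<in> ends G e'. pvec col vs (e # es) e') =
    (\<Sum>e' | e' \<in> edges G \<and> v \<in> ends G e'. if e = e' then sg (col u) else 0) +
    (\<Sum>e' | e' \<in> edges G \<and> v \<in> ends G e'. pvec col vs' es e')"
    unfolding vs by (simp add: sum.distrib pvec_Cons)
  also have "(\<Sum>e' | e' \<in> edges G \<and> v \<in> ends G e'. if e = e' then sg (col u) else 0) =
     of_bool (v = u \<or> v = hd vs') * sg (col u)"
    using c(2,5) finite_edges by (simp add: sum.delta)
  finally show ?case using Cons.IH[OF c(1)] vs c(4) sgn neq by auto
qed

lemma pvec_rev:
  assumes "is_path G vs es"
  shows "pvec col (rev vs) (rev es) e = - pvec col vs es e"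
  using assms
proof (induction es arbitrary: vs)
  case (Cons e' es)
  then obtain u vs' where vs: "vs = u # vs'" by (cases vs) (auto simp: is_path_def)
  note c = is_path_Cons[OF Cons.prems(1)[unfolded vs]]
  have sgn: "sg (col u) = - sg (col (hd vs'))" using ends_col[OF c(5,2)] by (rule sg_neq)
  obtain w ws where w: "vs' = w # ws" using c(4) by (cases vs') auto
  have l: "length ws = length es" using c(1) w by (simp add: is_path_def)
  have "pvec col (rev vs) (rev (e' # es)) e = pvec col (rev ws @ [w] @ [u]) (rev es @ [e']) e"
    using vs w by simp
  also have "\<dots> = pvec col (rev ws) (rev es) e + (if e' = e then sg (col w) else 0)"
    using l by (subst pvec_append) (auto simp: pvec_Cons)
  also have "pvec col (rev ws) (rev es) e = pvec col (rev ws @ [w]) (rev es) e"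
    using l by (subst pvec_append1) auto
  also have "\<dots> = - pvec col vs' es e" using Cons.IH[OF c(1)] w by simp
  finally show ?case using sgn vs w by (simp add: pvec_Cons)
qed simp

end

section \<open>Cycles and their clockwise edge vectors\<close>

text \<open>The graph counterpart of \<open>arc_pair\<close>. With parallel edges a cycle may
  consist of two single-edge paths on the same vertices, so disjointness of the edge sets has to be
  required separately.\<close>

definition path_pair :: "pgraph \<Rightarrow> complex list \<Rightarrow> complex set list \<Rightarrow> complex list \<Rightarrow> complex set list \<Rightarrow> bool" where
  "path_pair G vs1 es1 vs2 es2 \<longleftrightarrow> is_path G vs1 es1 \<and> is_path G vs2 es2 \<and> es1 \<noteq> [] \<and> es2 \<noteq> [] \<and>
     hd vs2 = hd vs1 \<and> last vs2 = last vs1 \<and> set vs1 \<inter> set vs2 = {hd vs1, last vs1} \<and>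
     set es1 \<inter> set es2 = {}"

lemma path_pair_sym: "path_pair G vs1 es1 vs2 es2 \<Longrightarrow> path_pair G vs2 es2 vs1 es1"
  unfolding path_pair_def by (metis Int_commute)

text \<open>Turns the existential definition into a statement about the ends of \<open>p\<close>.
  One direction is \<open>direction_unique\<close>; for the other, the loop along \<open>p\<close>
  and back along \<open>q\<close> covers \<open>p\<close> on the parameters from 0 to 1/2.\<close>

lemma clockwise_pair:
  assumes pq: "arc_pair p q"
    and d: "\<And>z. z \<in> inside (path_image p \<union> path_image q) \<Longrightarrow> winding_number p z - winding_number q z = -1"
    and C: "\<Union>C = path_image p \<union> path_image q" and P: "\<Union>P = path_image p"
  shows "clockwise_from_to C P u v \<longleftrightarrow> u = pathstart p \<and> v = pathfinish p"
proof
  assume "clockwise_from_to C P u v"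
  then obtain g a b where g: "clockwise g" "path_image g = \<Union>C" "0 \<le> a" "a < b" "b \<le> 1"
    "g ` {a..b} = \<Union>P" "g a = u" "g b = v" by (auto simp: clockwise_from_to_def)
  have "g a = pathstart p \<and> g b = pathfinish p"
  proof (rule direction_unique[OF pq _ _ _ g(3-5)])
    show "simple_path g" "pathfinish g = pathstart g" using g(1) by (simp_all add: clockwise_def)
    show "path_image g = path_image p \<union> path_image q" "g ` {a..b} = path_image p" using g C P by simp_all
    fix z assume z: "z \<in> inside (path_image g)"
    then have "winding_number g z = -1" using g(1) by (simp add: clockwise_def)
    then show "winding_number g z = winding_number p z - winding_number q z"
      using d[of z] z g(2) C by simp
  qed
  then show "u = pathstart p \<and> v = pathfinish p" using g by simp
next
  assume uv: "u = pathstart p \<and> v = pathfinish p"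
  let ?g = "pair_loop p q"
  note L = pair_loop[OF pq]
  have "winding_number ?g z = -1" if z: "z \<in> inside (path_image p \<union> path_image q)" for z
    using winding_number_pair_loop[OF pq] inside_UnD[OF z] d[OF z] by simp
  then have "clockwise ?g" using L by (simp add: clockwise_def)
  moreover have "?g ` {0..1/2} = path_image p"
  proof -
    have "?g ` {0..1/2} = (\<lambda>t. p (2 * t)) ` {0..1/2}"
      by (intro image_cong) (auto simp: pair_loop_def joinpaths_def)
    also have "\<dots> = p ` ((\<lambda>t. 2 * t) ` {0..1/2})" by (simp only: image_image)
    also have "(\<lambda>t. 2 * t) ` {0..1/2} = {0..1::real}"
      using image_mult_atLeastAtMost[of 2 0 "1/2::real"] by simp
    finally show ?thesis by (simp add: path_image_def)
  qed
  moreover have "?g 0 = u" "?g (1/2) = v"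
    using uv by (simp_all add: pair_loop_def joinpaths_def pathstart_def pathfinish_def)
  ultimately show "clockwise_from_to C P u v"
    unfolding clockwise_from_to_def using L C P
    by (intro exI[of _ ?g] exI[of _ 0] exI[of _ "1/2"]) simp
qed

lemma is_cycle_rotate:
  assumes "is_cycle G vs es" shows "is_cycle G (rotate k vs) (rotate k es)"
proof -
  have l: "length vs = length es" "2 \<le> length es" using assms by (auto simp: is_cycle_def)
  have "ends G (rotate k es ! i) = {rotate k vs ! i, rotate k vs ! (Suc i mod length es)}"
    if i: "i < length es" for i
  proof -
    let ?j = "(k + i) mod length es"
    have j: "?j < length es" using l by (intro mod_less_divisor) linarith
    have j': "Suc i mod length es < length es" using l by (intro mod_less_divisor) linarith
    have "rotate k es ! i = es ! ?j" using i by (simp add: nth_rotate)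
    moreover have "rotate k vs ! i = vs ! ?j" using i l by (simp add: nth_rotate)
    moreover have "rotate k vs ! (Suc i mod length es) = vs ! (Suc ?j mod length es)"
      using j j' l by (simp add: nth_rotate mod_simps)
    ultimately show ?thesis using assms j by (auto simp: is_cycle_def)
  qed
  then show ?thesis using assms by (auto simp: is_cycle_def)
qed

lemma pvec_rotate:
  assumes "length vs = length es" shows "pvec col (rotate k vs) (rotate k es) e = pvec col vs es e"
proof (induction k)
  case (Suc k)
  let ?vs = "rotate k vs" and ?es = "rotate k es"
  have "pvec col (rotate1 ?vs) (rotate1 ?es) e = pvec col ?vs ?es e"
  proof (cases ?vs)
    case (Cons v t)
    then obtain e' s where es: "?es = e' # s" using assms by (metis length_rotate length_Suc_conv)
    have "length t = length s" using assms Cons es by (metis length_rotate length_Cons nat.inject)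
    then show ?thesis using Cons es by (simp add: pvec_append pvec_Cons)
  qed (use assms in auto)
  then show ?case using Suc by simp
qed simp

context plane_bip
begin

text \<open>The remaining part of the cycle is closed up by its first vertex and reversed, so that
  both paths run from \<open>hd vs\<close> to \<open>vs ! k\<close>; the reversal accounts for the
  difference of edge vectors.\<close>

lemma cycle_split:
  assumes "is_cycle G vs es" "0 < k" "k < length es"
  shows "path_pair G (take (Suc k) vs) (take k es) (rev (drop k vs @ [hd vs])) (rev (drop k es))"
    and "pvec col (take (Suc k) vs) (take k es) e - pvec col (rev (drop k vs @ [hd vs])) (rev (drop k es)) e
      = pvec col vs es e"
proof -
  have c: "length vs = length es" "2 \<le> length es" "distinct vs" "distinct es" "set vs \<subseteq> verts G"
    "set es \<subseteq> edges G" "\<And>i. i < length es \<Longrightarrow> ends G (es ! i) = {vs ! i, vs ! (Suc i mod length es)}"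
    using assms(1) by (auto simp: is_cycle_def)
  have ne1: "vs \<noteq> []" using c(1,2) by auto
  then have ne: "vs \<noteq> []" "vs ! 0 = hd vs" by (simp_all add: hd_conv_nth)
  have p1: "is_path G (take (Suc k) vs) (take k es)"
    using c assms(2,3) by (auto simp: is_path_def dest: in_set_takeD)
  have hd_notin: "hd vs \<notin> set (drop k vs)"
  proof -
    have "hd vs \<in> set (take k vs)" using ne(1) assms(2) by (cases vs; cases k) auto
    then show ?thesis using set_take_disj_set_drop_if_distinct[OF c(3), of k k] by auto
  qed
  have p2: "is_path G (drop k vs @ [hd vs]) (drop k es)"
    unfolding is_path_def
  proof (intro conjI allI impI)
    fix i assume i: "i < length (drop k es)"
    then show "ends G (drop k es ! i) = {(drop k vs @ [hd vs]) ! i, (drop k vs @ [hd vs]) ! Suc i}"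
    proof -
      have i': "k + i < length es" using i by simp
      have 1: "ends G (drop k es ! i) = {vs ! (k + i), vs ! (Suc (k + i) mod length es)}"
        using c(7)[OF i'] assms(3) by simp
      have 2: "(drop k vs @ [hd vs]) ! i = vs ! (k + i)" using i' c(1) i by (simp add: nth_append)
      have 3: "(drop k vs @ [hd vs]) ! Suc i = vs ! (Suc (k + i) mod length es)"
      proof (cases "Suc (k + i) = length es")
        case True
        then have "Suc i = length (drop k vs)" using c(1) by simp
        then have "(drop k vs @ [hd vs]) ! Suc i = hd vs" by (metis nth_append_length)
        then show ?thesis using True ne(2) by simp
      next
        case False
        then have "Suc i < length (drop k vs)" "Suc (k + i) < length es" using i' c(1) by simp_all
        then show ?thesis by (simp add: nth_append)
      qed
      show ?thesis using 1 2 3 by simp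
    qed
  next
    show "length (drop k vs @ [hd vs]) = Suc (length (drop k es))" using c(1) by simp
    show "distinct (drop k vs @ [hd vs])" using c(3) hd_notin by simp
    show "set (drop k vs @ [hd vs]) \<subseteq> verts G" using c(5) ne(1) by (auto dest: in_set_dropD)
    show "set (drop k es) \<subseteq> edges G" using c(6) by (auto dest: in_set_dropD)
  qed
  have hdk: "hd (drop k vs) = vs ! k" using c assms by (simp add: hd_drop_conv_nth)
  have last1: "last (take (Suc k) vs) = vs ! k" using c assms by (simp add: take_Suc_conv_app_nth)
  have int: "set (take (Suc k) vs) \<inter> (set (drop k vs) \<union> {hd vs}) = {hd vs, vs ! k}"
  proof -
    have "set (take (Suc k) vs) = insert (vs ! k) (set (take k vs))"
      using c assms by (simp add: take_Suc_conv_app_nth)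
    moreover have "set (take k vs) \<inter> set (drop k vs) = {}" using c(3) by (simp add: set_take_disj_set_drop_if_distinct)
    moreover have "vs ! k \<in> set (drop k vs)" using c assms by (metis Cons_nth_drop_Suc list.set_intros(1))
    moreover have "hd vs \<in> set (take k vs)" using ne(1) assms(2) by (cases vs; cases k) auto
    ultimately show ?thesis by auto
  qed
  have pne: "drop k vs \<noteq> []" using c assms by simp
  show "path_pair G (take (Suc k) vs) (take k es) (rev (drop k vs @ [hd vs])) (rev (drop k es))"
    unfolding path_pair_def
  proof (intro conjI)
    show "is_path G (rev (drop k vs @ [hd vs])) (rev (drop k es))" by (rule is_path_rev[OF p2])
    show "hd (rev (drop k vs @ [hd vs])) = hd (take (Suc k) vs)" using ne by simp
    show "last (rev (drop k vs @ [hd vs])) = last (take (Suc k) vs)"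
      using hdk last1 pne by (simp add: last_rev)
    show "set (take (Suc k) vs) \<inter> set (rev (drop k vs @ [hd vs])) = {hd (take (Suc k) vs), last (take (Suc k) vs)}"
      using int last1 ne by auto
    show "set (take k es) \<inter> set (rev (drop k es)) = {}"
      using c(4) by (simp add: set_take_disj_set_drop_if_distinct)
  qed (use p1 c assms in auto)
  have "pvec col vs es e = pvec col (take k vs @ drop k vs) (take k es @ drop k es) e" by simp
  also have "\<dots> = pvec col (take k vs) (take k es) e + pvec col (drop k vs) (drop k es) e"
    using c by (subst pvec_append) auto
  also have "pvec col (take k vs) (take k es) e = pvec col (take (Suc k) vs) (take k es) e"
    using c assms by (simp add: take_Suc_conv_app_nth pvec_append1)
  also have "pvec col (drop k vs) (drop k es) e = pvec col (drop k vs @ [hd vs]) (drop k es) e"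
    using c by (simp add: pvec_append1)
  also have "\<dots> = - pvec col (rev (drop k vs @ [hd vs])) (rev (drop k es)) e"
    using pvec_rev[OF p2] by simp
  finally show "pvec col (take (Suc k) vs) (take k es) e - pvec col (rev (drop k vs @ [hd vs])) (rev (drop k es)) e
      = pvec col vs es e" by simp
qed

lemma cycle_split_edge:
  assumes "is_cycle G vs es" "e \<in> set es"
  obtains u v vs2 es2 where "path_pair G [u, v] [e] vs2 es2" "set es = insert e (set es2)"
    "\<And>x. pvec col [u, v] [e] x - pvec col vs2 es2 x = pvec col vs es x"
proof -
  obtain k where k: "k < length es" "e = es ! k" using assms(2) by (auto simp: in_set_conv_nth)
  have l: "length vs = length es" "2 \<le> length es" using assms(1) by (auto simp: is_cycle_def)
  let ?vs = "rotate k vs" and ?es = "rotate k es"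
  have c: "is_cycle G ?vs ?es" by (rule is_cycle_rotate[OF assms(1)])
  obtain u v t where vs: "?vs = u # v # t"
    using l by (cases ?vs; cases "tl ?vs") (auto dest: arg_cong[of _ _ length])
  obtain e' s where es: "?es = e' # s" using l by (cases ?es) (auto dest: arg_cong[of _ _ length])
  have "?es ! 0 = e" using k l by (subst nth_rotate) auto
  then have e': "e' = e" using es by simp
  have "length es = Suc (length s)" using es by (metis length_rotate length_Cons)
  then have "s \<noteq> []" using l(2) by auto
  note sp = cycle_split[OF c, of 1]
  have 1: "path_pair G [u, v] [e] (rev (v # t @ [u])) (rev s)"
    using sp(1) l vs es e' \<open>s \<noteq> []\<close> by simp
  have 2: "pvec col [u, v] [e] x - pvec col (rev (v # t @ [u])) (rev s) x = pvec col vs es x" for x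
    using sp(2)[of x] l vs es e' \<open>s \<noteq> []\<close> pvec_rotate[OF l(1), of col k x] by simp
  have "set es = set ?es" by simp
  then have "set es = insert e (set (rev s))" using es e' by simp
  then show thesis using that 1 2 by blast
qed

lemma path_pair_cycle:
  assumes "path_pair G vs1 es1 vs2 es2"
  defines "vs \<equiv> butlast vs1 @ butlast (rev vs2)" and "es \<equiv> es1 @ rev es2"
  shows "is_cycle G vs es" "pvec col vs es e = pvec col vs1 es1 e - pvec col vs2 es2 e"
proof -
  have p: "is_path G vs1 es1" "is_path G vs2 es2" "es1 \<noteq> []" "es2 \<noteq> []"
     "hd vs2 = hd vs1" "last vs2 = last vs1" "set vs1 \<inter> set vs2 = {hd vs1, last vs1}"
     "set es1 \<inter> set es2 = {}" using assms(1) by (auto simp: path_pair_def)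
  note r = is_path_rev[OF p(2)]
  have l: "length vs1 = Suc (length es1)" "length vs2 = Suc (length es2)" "distinct vs1" "distinct vs2"
    using p(1,2) by (auto simp: is_path_def)
  have ne: "vs1 \<noteq> []" "vs2 \<noteq> []" using l by auto
  have n1: "butlast vs1 ! i = vs1 ! i" if "i < length es1" for i using that l by (simp add: nth_butlast)
  have n2: "butlast (rev vs2) ! i = rev vs2 ! i" if "i < length es2" for i
    using that l nth_butlast[of i "rev vs2"] by (simp del: butlast_rev)
  have last1: "vs1 ! length es1 = last vs1" using l ne by (simp add: last_conv_nth)
  have rev0: "rev vs2 ! 0 = last vs1" using p(6) ne by (metis hd_conv_nth hd_rev rev_is_Nil_conv)
  have revl: "rev vs2 ! length es2 = hd vs1" using p(5) ne l by (metis last_rev last_conv_nth length_rev diff_Suc_1 rev_is_Nil_conv)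
  have vs0: "vs1 ! 0 = hd vs1" using ne by (simp add: hd_conv_nth)
  have len: "length vs = length es1 + length es2" "length es = length es1 + length es2"
    using l by (simp_all add: vs_def es_def)
  have vs_nth: "vs ! i = (if i < length es1 then vs1 ! i else rev vs2 ! (i - length es1))"
    if "i < length es1 + length es2" for i
    using that n1 n2 l by (auto simp: vs_def nth_append)
  have pos: "0 < length es1" "0 < length es2" using p by auto
  have E: "ends G (es ! i) = {vs ! i, vs ! (Suc i mod length es)}" if i: "i < length es" for i
  proof (cases "i < length es1")
    case True
    have "ends G (es ! i) = {vs1 ! i, vs1 ! Suc i}" using p(1) True by (simp add: is_path_def es_def nth_append)
    moreover have "vs ! (Suc i mod length es) = vs1 ! Suc i"
    proof (cases "Suc i < length es1")
      case True
      then show ?thesis using vs_nth len by simp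
    next
      case False
      then have s: "Suc i = length es1" using \<open>i < length es1\<close> by simp
      then have "Suc i mod length es = length es1" using pos len by simp
      then show ?thesis using vs_nth[of "length es1"] pos rev0 last1 s by simp
    qed
    ultimately show ?thesis using vs_nth[of i] True by simp
  next
    case False
    define j where "j = i - length es1"
    have j: "j < length es2" "i = length es1 + j" using False i len by (auto simp: j_def)
    have "ends G (es ! i) = {rev vs2 ! j, rev vs2 ! Suc j}"
      using r j by (simp add: is_path_def es_def nth_append)
    moreover have "vs ! (Suc i mod length es) = rev vs2 ! Suc j"
    proof (cases "Suc j < length es2")
      case True
      then show ?thesis using vs_nth[of "Suc i"] len j by simp
    next
      case False
      then have s: "Suc j = length es2" using j by simp
      then have "Suc i = length es" using len j by linarith
      then have "Suc i mod length es = 0" by simp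
      then show ?thesis using vs_nth[of 0] pos vs0 revl s by simp
    qed
    ultimately show ?thesis using vs_nth[of i] False j by simp
  qed
  have b1: "set (butlast vs1) = set vs1 - {last vs1}"
  proof -
    have e: "butlast vs1 @ [last vs1] = vs1" using ne(1) by simp
    then have "distinct (butlast vs1 @ [last vs1])" using l(3) by simp
    moreover have "set vs1 = set (butlast vs1 @ [last vs1])" using e by simp
    ultimately show ?thesis by auto
  qed
  have b2: "set (butlast (rev vs2)) = set vs2 - {hd vs2}"
  proof -
    have "butlast (rev vs2) = rev (tl vs2)" by (simp add: butlast_rev)
    then show ?thesis using l(4) ne(2) by (cases vs2) auto
  qed
  have dv: "distinct vs"
    unfolding vs_def using l(3,4) b1 b2 p(5,6,7) by (auto simp: distinct_butlast distinct_tl)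
  show "is_cycle G vs es"
    unfolding is_cycle_def
  proof (intro conjI allI impI E dv)
    show "length vs = length es" "2 \<le> length es" using len pos by linarith+
    show "distinct es" using is_path_distinct_edges[OF p(1)] is_path_distinct_edges[OF p(2)] p(8) by (simp add: es_def)
    show "set vs \<subseteq> verts G" using b1 b2 p(1,2) by (auto simp: vs_def is_path_def)
    show "set es \<subseteq> edges G" using p(1,2) by (auto simp: es_def is_path_def)
  qed
  have "pvec col vs es e = pvec col (butlast vs1) es1 e + pvec col (butlast (rev vs2)) (rev es2) e"
    unfolding vs_def es_def using l by (subst pvec_append) auto
  also have "pvec col (butlast vs1) es1 e = pvec col (butlast vs1 @ [last vs1]) es1 e"
    using l by (subst pvec_append1) auto
  also have "pvec col (butlast (rev vs2)) (rev es2) e = pvec col (butlast (rev vs2) @ [last (rev vs2)]) (rev es2) e"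
    using l by (subst pvec_append1) auto
  finally show "pvec col vs es e = pvec col vs1 es1 e - pvec col vs2 es2 e"
    using ne pvec_rev[OF p(2), of e] append_butlast_last_id[of "rev vs2"]
    by (simp del: butlast_rev)
qed

definition traces :: "(real \<Rightarrow> complex) \<Rightarrow> complex list \<Rightarrow> complex set list \<Rightarrow> bool" where
  "traces p vs es \<longleftrightarrow> arc p \<and> path_image p = \<Union>(set es) \<and> pathstart p = hd vs \<and> pathfinish p = last vs \<and>
    (\<forall>z. z \<notin> \<Union>(set es) \<longrightarrow> winding_number p z = wn (pvec col vs es) z)"

lemma traces_arc_pair:
  assumes "path_pair G vs1 es1 vs2 es2" "traces p vs1 es1" "traces q vs2 es2"
  shows "arc_pair p q"
proof -
  have p: "is_path G vs1 es1" "is_path G vs2 es2" "es1 \<noteq> []" "es2 \<noteq> []"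
     "hd vs2 = hd vs1" "last vs2 = last vs1" "set vs1 \<inter> set vs2 = {hd vs1, last vs1}"
     "set es1 \<inter> set es2 = {}" using assms(1) by (auto simp: path_pair_def)
  have "path_image p \<inter> path_image q \<subseteq> {hd vs1, last vs1}"
  proof
    fix x assume "x \<in> path_image p \<inter> path_image q"
    then obtain e f where ef: "e \<in> set es1" "f \<in> set es2" "x \<in> e" "x \<in> f"
      using assms(2,3) by (auto simp: traces_def)
    have "e \<noteq> f" using ef p(8) by auto
    moreover have "e \<in> edges G" "f \<in> edges G" using ef p(1,2) by (auto simp: is_path_def)
    ultimately have "x \<in> ends G e" "x \<in> ends G f" using edge_inter[of e f] ef by auto
    then show "x \<in> {hd vs1, last vs1}"
      using is_path_ends_subset[OF p(1) ef(1)] is_path_ends_subset[OF p(2) ef(2)] p(7) by blast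
  qed
  moreover have "hd vs1 \<in> path_image p" "last vs1 \<in> path_image p" "hd vs1 \<in> path_image q" "last vs1 \<in> path_image q"
    using assms(2,3) p(5,6) pathstart_in_path_image[of p] pathfinish_in_path_image[of p]
      pathstart_in_path_image[of q] pathfinish_in_path_image[of q] by (simp_all add: traces_def)
  ultimately have "path_image p \<inter> path_image q = {hd vs1, last vs1}" by blast
  then show ?thesis using assms(2,3) p(5,6) by (simp add: arc_pair_def traces_def)
qed

lemma ex_traces: "path_pair G vs1 es1 vs2 es2 \<Longrightarrow> \<exists>p. traces p vs1 es1"
  using path_arc[of vs1 es1] unfolding traces_def path_pair_def by blast

lemma is_path_distinct_ends: "is_path G vs es \<Longrightarrow> es \<noteq> [] \<Longrightarrow> hd vs \<noteq> last vs"
  by (cases vs) (auto simp: is_path_def)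

text \<open>The vertex lists do not reveal on which side the first path lies, so the orientation
  \<open>d\<close> is only known to be one of two signs and enters all conclusions.\<close>

lemma pair_orientation:
  assumes pp: "path_pair G vs1 es1 vs2 es2"
  defines "C \<equiv> set es1 \<union> set es2"
  obtains d :: int where "d = 1 \<or> d = -1"
    "\<And>z. z \<in> inside (\<Union>C) \<Longrightarrow> wn (\<lambda>e. pvec col vs1 es1 e - pvec col vs2 es2 e) z = of_int d"
    "\<And>z. z \<notin> \<Union>C \<Longrightarrow> z \<notin> inside (\<Union>C) \<Longrightarrow> wn (\<lambda>e. pvec col vs1 es1 e - pvec col vs2 es2 e) z = 0"
    "\<And>u v. clockwise_from_to C (set es1) u v \<longleftrightarrow>
       (if d = -1 then u = hd vs1 \<and> v = last vs1 else u = last vs1 \<and> v = hd vs1)"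
proof -
  obtain p q where p: "traces p vs1 es1" and q: "traces q vs2 es2"
    using ex_traces[OF pp] ex_traces[OF path_pair_sym[OF pp]] by blast
  have pq: "arc_pair p q" by (rule traces_arc_pair[OF pp p q])
  have im: "path_image p = \<Union>(set es1)" "path_image q = \<Union>(set es2)" using p q by (auto simp: traces_def)
  have C: "\<Union>C = path_image p \<union> path_image q" using im by (auto simp: C_def)
  have w: "winding_number p z - winding_number q z = wn (\<lambda>e. pvec col vs1 es1 e - pvec col vs2 es2 e) z"
    if "z \<notin> \<Union>C" for z
    using that p q unfolding traces_def C_def wn_diff by auto
  obtain d :: int where d: "d = 1 \<or> d = -1"
    "\<And>z. z \<in> inside (\<Union>C) \<Longrightarrow> winding_number p z - winding_number q z = of_int d"
    using wn_inside_pair[OF pq] C by metis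
  have 1: "wn (\<lambda>e. pvec col vs1 es1 e - pvec col vs2 es2 e) z = of_int d" if "z \<in> inside (\<Union>C)" for z
  proof -
    have "z \<notin> \<Union>C" using that inside_no_overlap[of "\<Union>C"] by blast
    then show ?thesis using d(2)[OF that] w by metis
  qed
  have 2: "wn (\<lambda>e. pvec col vs1 es1 e - pvec col vs2 es2 e) z = 0"
    if "z \<notin> \<Union>C" "z \<notin> inside (\<Union>C)" for z
    using wn_outside_pair[OF pq, of z] w[OF that(1)] that C by auto
  have 3: "clockwise_from_to C (set es1) u v \<longleftrightarrow>
       (if d = -1 then u = hd vs1 \<and> v = last vs1 else u = last vs1 \<and> v = hd vs1)" for u v
  proof (cases "d = -1")
    case True
    have "clockwise_from_to C (set es1) u v \<longleftrightarrow> u = pathstart p \<and> v = pathfinish p"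
      using d(2) True C im by (intro clockwise_pair[OF pq]) auto
    then show ?thesis using True p by (simp add: traces_def)
  next
    case False
    then have d1: "d = 1" using d(1) by simp
    have "clockwise_from_to C (set es1) u v \<longleftrightarrow>
      u = pathstart (reversepath p) \<and> v = pathfinish (reversepath p)"
    proof (rule clockwise_pair[OF arc_pair_reverse[OF pq]])
      fix z assume "z \<in> inside (path_image (reversepath p) \<union> path_image (reversepath q))"
      then have z: "z \<in> inside (path_image p \<union> path_image q)" by simp
      have "path p" "path q" using pq by (auto simp: arc_pair_def arc_imp_path)
      then show "winding_number (reversepath p) z - winding_number (reversepath q) z = - 1"
        using inside_UnD[OF z] d(2)[of z] z d1 C by (simp add: winding_number_reversepath algebra_simps)
    qed (use C im in simp_all)
    then show ?thesis using False p by (simp add: traces_def)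
  qed
  show thesis using that d(1) 1 2 3 by blast
qed

text \<open>The edge vector of the clockwise traversal of a cycle.\<close>

definition cvec :: "complex set set \<Rightarrow> complex set \<Rightarrow> int" where
  "cvec C e = (if e \<in> C then if white_to_black col C {e} then 1 else -1 else 0)"

text \<open>\<open>cvec\<close> asks separately for each edge whether it is traversed from white to
  black. Splitting the cycle at that edge gives a sign \<open>d'\<close>, and a common inside point
  shows that it is the same \<open>d\<close> for all edges. The minus sign is there because
  clockwise curves have winding number -1.\<close>

lemma cvec_cycle:
  assumes c: "is_cycle G vs es" and d: "d = 1 \<or> d = (-1::int)"
    and w: "\<And>z. z \<in> inside (\<Union>(set es)) \<Longrightarrow> wn (pvec col vs es) z = of_int d"
  shows "cvec (set es) e = - d * pvec col vs es e"
proof (cases "e \<in> set es")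
  case True
  obtain u v vs2 es2 where s: "path_pair G [u, v] [e] vs2 es2" "set es = insert e (set es2)"
    "\<And>x. pvec col [u, v] [e] x - pvec col vs2 es2 x = pvec col vs es x"
    using cycle_split_edge[OF c True] by metis
  have fe: "(\<lambda>x. pvec col [u, v] [e] x - pvec col vs2 es2 x) = pvec col vs es" using s(3) by auto
  have U: "set [e] \<union> set es2 = set es" using s(2) by simp
  obtain d' :: int where dd1: "d' = 1 \<or> d' = -1"
    and dw: "\<And>z. z \<in> inside (\<Union>(set es)) \<Longrightarrow> wn (pvec col vs es) z = of_int d'"
    and "\<And>z. z \<notin> \<Union>(set es) \<Longrightarrow> z \<notin> inside (\<Union>(set es)) \<Longrightarrow> wn (pvec col vs es) z = 0"
    and dc: "\<And>x y. clockwise_from_to (set es) (set [e]) x y \<longleftrightarrow>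
      (if d' = -1 then x = hd [u, v] \<and> y = last [u, v] else x = last [u, v] \<and> y = hd [u, v])"
    by (rule pair_orientation[OF s(1), unfolded fe U]) blast
  have d': "clockwise_from_to (set es) {e} x y \<longleftrightarrow> (if d' = -1 then x = u \<and> y = v else x = v \<and> y = u)" for x y
    using dc[of x y] by simp
  have "inside (\<Union>(set es)) \<noteq> {}"
  proof -
    obtain p q where p: "traces p [u, v] [e]" and q: "traces q vs2 es2"
      using ex_traces[OF s(1)] ex_traces[OF path_pair_sym[OF s(1)]] by blast
    have "\<Union>(set es) = path_image p \<union> path_image q" using p q s(2) by (auto simp: traces_def)
    then show ?thesis using jordan_pair(1)[OF traces_arc_pair[OF s(1) p q]] by simp
  qed
  then obtain z where "z \<in> inside (\<Union>(set es))" by blast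
  then have dd: "d' = d" using w[of z] dw[of z] by simp
  have e: "e \<in> edges G" "ends G e = {u, v}" using s(1) by (auto simp: path_pair_def is_path_def)
  have col: "col u \<noteq> col v" by (rule ends_col[OF e])
  have "e \<notin> set es2" using s(1) by (auto simp: path_pair_def)
  then have pe: "pvec col vs es e = sg (col u)"
    using s(3)[of e] by (simp add: pvec_Cons pvec_notin)
  have "white_to_black col (set es) {e} \<longleftrightarrow> (if d = -1 then col u = White else col v = White)"
    unfolding white_to_black_def d' dd using col by (cases "col u"; cases "col v") auto
  then show ?thesis using True pe d col by (cases "col u"; cases "col v") (auto simp: cvec_def sg_def)
qed (simp add: cvec_def pvec_notin)

lemma cvec_pair:
  assumes pp: "path_pair G vs1 es1 vs2 es2"
  defines "C \<equiv> set es1 \<union> set es2"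
  obtains d :: int where "d = 1 \<or> d = -1"
    "\<And>z. z \<in> inside (\<Union>C) \<Longrightarrow> wn (\<lambda>e. pvec col vs1 es1 e - pvec col vs2 es2 e) z = of_int d"
    "\<And>e. cvec C e = - d * (pvec col vs1 es1 e - pvec col vs2 es2 e)"
    "\<And>u v. clockwise_from_to C (set es1) u v \<longleftrightarrow>
       (if d = -1 then u = hd vs1 \<and> v = last vs1 else u = last vs1 \<and> v = hd vs1)"
proof -
  let ?vs = "butlast vs1 @ butlast (rev vs2)" and ?es = "es1 @ rev es2"
  note c = path_pair_cycle[OF pp]
  have C: "set ?es = C" by (simp add: C_def)
  have fe: "pvec col ?vs ?es = (\<lambda>e. pvec col vs1 es1 e - pvec col vs2 es2 e)" using c(2) by auto
  obtain d :: int where d: "d = 1 \<or> d = -1"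
    "\<And>z. z \<in> inside (\<Union>C) \<Longrightarrow> wn (\<lambda>e. pvec col vs1 es1 e - pvec col vs2 es2 e) z = of_int d"
    "\<And>u v. clockwise_from_to C (set es1) u v \<longleftrightarrow>
       (if d = -1 then u = hd vs1 \<and> v = last vs1 else u = last vs1 \<and> v = hd vs1)"
    unfolding C_def by (rule pair_orientation[OF pp]) blast
  have "cvec C e = - d * (pvec col vs1 es1 e - pvec col vs2 es2 e)" for e
    using cvec_cycle[OF c(1) d(1), unfolded C fe, of e] d(2) by blast
  with d show thesis by (intro that)
qed

lemma cycle_pair:
  assumes "C \<in> cycles G"
  obtains vs1 es1 vs2 es2 where "path_pair G vs1 es1 vs2 es2" "C = set es1 \<union> set es2"
proof -
  obtain vs es where c: "is_cycle G vs es" "C = set es" using assms by (auto simp: cycles_def)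
  then have "es \<noteq> []" by (auto simp: is_cycle_def)
  then obtain e where "e \<in> set es" by (cases es) auto
  from cycle_split_edge[OF c(1) this] obtain u v vs2 es2 where
    "path_pair G [u, v] [e] vs2 es2" "set es = insert e (set es2)" by metis
  then show thesis using that[of "[u,v]" "[e]" vs2 es2] c(2) by simp
qed

lemma cycle_jordan:
  assumes "C \<in> cycles G"
  obtains p q where "arc_pair p q" "\<Union>C = path_image p \<union> path_image q"
proof -
  obtain vs1 es1 vs2 es2 where pp: "path_pair G vs1 es1 vs2 es2" "C = set es1 \<union> set es2"
    using cycle_pair[OF assms] .
  obtain p q where p: "traces p vs1 es1" and q: "traces q vs2 es2"
    using ex_traces[OF pp(1)] ex_traces[OF path_pair_sym[OF pp(1)]] by blast
  have "\<Union>C = path_image p \<union> path_image q" using p q pp(2) by (auto simp: traces_def)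
  then show thesis using that traces_arc_pair[OF pp(1) p q] by blast
qed

lemma wn_cvec:
  assumes "C \<in> cycles G" "z \<notin> \<Union>C"
  shows "wn (cvec C) z = (if z \<in> inside (\<Union>C) then -1 else 0)"
proof -
  obtain vs1 es1 vs2 es2 where pp: "path_pair G vs1 es1 vs2 es2" "C = set es1 \<union> set es2"
    using cycle_pair[OF assms(1)] .
  define f where "f = (\<lambda>e. pvec col vs1 es1 e - pvec col vs2 es2 e)"
  obtain d :: int where d: "d = 1 \<or> d = -1"
    "\<And>z. z \<in> inside (\<Union>C) \<Longrightarrow> wn f z = of_int d" "\<And>e. cvec C e = - d * f e"
    unfolding pp(2) f_def by (rule cvec_pair[OF pp(1)]) blast
  have o: "wn f z = 0" if "z \<notin> inside (\<Union>C)"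
    unfolding f_def
    by (rule pair_orientation[OF pp(1)]) (use assms(2) that in \<open>simp add: pp(2)\<close>)
  have "cvec C = (\<lambda>e. - d * f e)" using d(3) by auto
  then have "wn (cvec C) z = of_int (- d) * wn f z"
    by (simp only: wn_scale)
  then show ?thesis using d(1,2) o by auto
qed

lemma cvec_balance:
  assumes "C \<in> cycles G"
  shows "(\<Sum>e | e \<in> edges G \<and> v \<in> ends G e. cvec C e) = 0"
proof -
  obtain vs1 es1 vs2 es2 where pp: "path_pair G vs1 es1 vs2 es2" "C = set es1 \<union> set es2"
    using cycle_pair[OF assms(1)] .
  obtain d :: int where d: "\<And>e. cvec C e = - d * (pvec col vs1 es1 e - pvec col vs2 es2 e)"
    unfolding pp(2) by (rule cvec_pair[OF pp(1)]) blast
  have p: "is_path G vs1 es1" "is_path G vs2 es2" "hd vs2 = hd vs1" "last vs2 = last vs1"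
    using pp by (auto simp: path_pair_def)
  have "(\<Sum>e | e \<in> edges G \<and> v \<in> ends G e. cvec C e) =
    - d * ((\<Sum>e | e \<in> edges G \<and> v \<in> ends G e. pvec col vs1 es1 e) -
           (\<Sum>e | e \<in> edges G \<and> v \<in> ends G e. pvec col vs2 es2 e))"
    unfolding d by (simp only: sum_distrib_left[symmetric] sum_subtractf)
  also have "\<dots> = 0" unfolding pvec_balance[OF p(1)] pvec_balance[OF p(2)] p(3,4) by simp
  finally show ?thesis .
qed

end

section \<open>Ears, cycles and symmetric differences\<close>

lemma path_edges_at:
  assumes "is_path G vs es" "k \<le> length es"
  shows "{e \<in> set es. vs ! k \<in> ends G e} = (\<lambda>i. es ! i) ` {i. i < length es \<and> (i = k \<or> Suc i = k)}"
proof -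
  have "vs ! k \<in> ends G (es ! i) \<longleftrightarrow> i = k \<or> Suc i = k" if "i < length es" for i
    using assms that by (auto simp: is_path_def nth_eq_iff_index_eq)
  then show ?thesis by (auto simp: in_set_conv_nth)
qed

lemma path_sum_at:
  fixes f :: "complex set \<Rightarrow> int"
  assumes "is_path G vs es" "es \<noteq> []"
  shows "(\<Sum>e | e \<in> set es \<and> hd vs \<in> ends G e. f e) = f (es ! 0)"
    and "(\<Sum>e | e \<in> set es \<and> last vs \<in> ends G e. f e) = f (es ! (length es - 1))"
    and "0 < k \<Longrightarrow> k < length es \<Longrightarrow> (\<Sum>e | e \<in> set es \<and> vs ! k \<in> ends G e. f e) = f (es ! (k - 1)) + f (es ! k)"
    and "v \<notin> set vs \<Longrightarrow> (\<Sum>e | e \<in> set es \<and> v \<in> ends G e. f e) = 0"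
proof -
  have l: "length vs = Suc (length es)" "distinct es" "vs \<noteq> []"
    using assms is_path_distinct_edges by (auto simp: is_path_def)
  have "hd vs = vs ! 0" "last vs = vs ! length es" using l by (auto simp: hd_conv_nth last_conv_nth)
  moreover have "{i. i < length es \<and> (i = 0 \<or> Suc i = 0)} = {0}"
    "{i. i < length es \<and> (i = length es \<or> Suc i = length es)} = {length es - 1}" using assms(2) by auto
  ultimately show "(\<Sum>e | e \<in> set es \<and> hd vs \<in> ends G e. f e) = f (es ! 0)"
    "(\<Sum>e | e \<in> set es \<and> last vs \<in> ends G e. f e) = f (es ! (length es - 1))"
    using path_edges_at[OF assms(1), of 0] path_edges_at[OF assms(1), of "length es"] by auto
  show "(\<Sum>e | e \<in> set es \<and> v \<in> ends G e. f e) = 0" if "v \<notin> set vs"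
    using is_path_ends_subset[OF assms(1)] that by (intro sum.neutral) blast
  assume k: "0 < k" "k < length es"
  then have "{i. i < length es \<and> (i = k \<or> Suc i = k)} = {k - 1, k}" by auto
  then have "{e \<in> set es. vs ! k \<in> ends G e} = {es ! (k - 1), es ! k}"
    using path_edges_at[OF assms(1), of k] k by auto
  moreover have "es ! (k - 1) \<noteq> es ! k" using l k by (simp add: nth_eq_iff_index_eq)
  ultimately show "(\<Sum>e | e \<in> set es \<and> vs ! k \<in> ends G e. f e) = f (es ! (k - 1)) + f (es ! k)" by simp
qed

text \<open>Positions count from 0, so in a path with an odd number of edges both end edges are in
  this set; it becomes \<open>P1\<close>.\<close>

definition even_edges :: "'a list \<Rightarrow> 'a set" where
  "even_edges es = {es ! k |k. k < length es \<and> even k}"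

definition odd_edges :: "'a list \<Rightarrow> 'a set" where
  "odd_edges es = {es ! k |k. k < length es \<and> odd k}"

lemma even_odd_edges:
  "even_edges es \<union> odd_edges es = set es"
  "distinct es \<Longrightarrow> even_edges es \<inter> odd_edges es = {}"
  unfolding even_edges_def odd_edges_def set_conv_nth by (blast, auto simp: nth_eq_iff_index_eq)

lemma ends_even_edges:
  assumes "odd (length es)"
  shows "es ! 0 \<in> even_edges es" "es ! (length es - 1) \<in> even_edges es"
proof -
  have "0 < length es" using assms by (cases es) auto
  then show "es ! 0 \<in> even_edges es" unfolding even_edges_def by blast
  have "length es - 1 < length es" "even (length es - 1)" using assms \<open>0 < length es\<close> by auto
  then show "es ! (length es - 1) \<in> even_edges es" unfolding even_edges_def by blast
qed

lemma alternating_chain: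
  fixes f :: "'a \<Rightarrow> int"
  assumes "\<And>k. 0 < k \<Longrightarrow> k < length es \<Longrightarrow> f (es ! (k - 1)) + f (es ! k) = b"
  shows "e \<in> even_edges es \<Longrightarrow> f e = f (es ! 0)" "e \<in> odd_edges es \<Longrightarrow> f e = b - f (es ! 0)"
proof -
  have "k < length es \<Longrightarrow> f (es ! k) = (if even k then f (es ! 0) else b - f (es ! 0))" for k
  proof (induction k)
    case (Suc k)
    then show ?case using assms[of "Suc k"] by (cases "even k") auto
  qed simp
  then show "e \<in> even_edges es \<Longrightarrow> f e = f (es ! 0)" "e \<in> odd_edges es \<Longrightarrow> f e = b - f (es ! 0)"
    by (auto simp: even_edges_def odd_edges_def)
qed

lemma chain_alternating:
  fixes f :: "'a \<Rightarrow> int"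
  assumes "\<forall>e\<in>even_edges es. f e = t" "\<forall>e\<in>odd_edges es. f e = b - t" "0 < k" "k < length es"
  shows "f (es ! (k - 1)) + f (es ! k) = b"
proof -
  have "f (es ! i) = (if even i then t else b - t)" if "i < length es" for i
    using assms(1,2) that by (auto simp: even_edges_def odd_edges_def)
  from this[of k] this[of "k - 1"] show ?thesis using assms(3,4) by auto
qed

lemma path_vertex_cases:
  assumes "is_path G vs es" "v \<in> set vs"
  shows "v = hd vs \<or> v = last vs \<or> (\<exists>k. 0 < k \<and> k < length es \<and> v = vs ! k)"
proof -
  obtain k where k: "k < length vs" "v = vs ! k" using assms(2) by (auto simp: in_set_conv_nth)
  have l: "length vs = Suc (length es)" "vs \<noteq> []" using assms by (auto simp: is_path_def)
  have "hd vs = vs ! 0" "last vs = vs ! length es" using l by (auto simp: hd_conv_nth last_conv_nth)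
  then show ?thesis using k l by (cases "k = 0"; cases "k = length es") auto
qed

lemma is_path_nth_inner:
  assumes "is_path G vs es" "0 < k" "k < length es"
  shows "vs ! k \<in> set vs" "vs ! k \<noteq> hd vs" "vs ! k \<noteq> last vs"
proof -
  have l: "length vs = Suc (length es)" "vs \<noteq> []" "distinct vs" using assms by (auto simp: is_path_def)
  have "hd vs = vs ! 0" "last vs = vs ! length es" using l by (auto simp: hd_conv_nth last_conv_nth)
  then show "vs ! k \<in> set vs" "vs ! k \<noteq> hd vs" "vs ! k \<noteq> last vs"
    using assms l by (auto simp: nth_eq_iff_index_eq)
qed

text \<open>An inner vertex of the ear meets two ear edges and no old edge, so the values alternate
  between \<open>t\<close> and \<open>b - t\<close>. The number of ear edges is odd, so both end
  edges carry \<open>t\<close>, which is what the ear contributes where it is attached.\<close>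

lemma ear_balanced:
  assumes P: "is_path G vs es" "odd (length es)"
    and V: "VK = VH \<union> set vs" "set vs \<inter> VH = {hd vs, last vs}"
    and E: "EK = EH \<union> set es" "set es \<inter> EH = {}" "finite EH"
    and H: "\<And>e. e \<in> EH \<Longrightarrow> ends G e \<subseteq> VH"
  shows "balanced (ends G) b VK EK f \<longleftrightarrow> (\<forall>e. e \<notin> EK \<longrightarrow> f e = 0) \<and>
    (\<exists>t. (\<forall>e\<in>even_edges es. f e = t) \<and> (\<forall>e\<in>odd_edges es. f e = b - t) \<and>
      (\<forall>v\<in>VH. (\<Sum>e | e \<in> EH \<and> v \<in> ends G e. f e) = b - of_bool (v \<in> {hd vs, last vs}) * t))"
    (is "_ \<longleftrightarrow> ?R")
proof -
  have ne: "es \<noteq> []" using P(2) by auto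
  note at = path_sum_at[OF P(1) ne]
  have hl: "hd vs \<noteq> last vs" using P(1) ne by (cases vs) (auto simp: is_path_def)
  have split: "(\<Sum>e | e \<in> EK \<and> v \<in> ends G e. f e) =
    (\<Sum>e | e \<in> EH \<and> v \<in> ends G e. f e) + (\<Sum>e | e \<in> set es \<and> v \<in> ends G e. f e)" for v
  proof -
    have "{e. e \<in> EK \<and> v \<in> ends G e} = {e. e \<in> EH \<and> v \<in> ends G e} \<union> {e. e \<in> set es \<and> v \<in> ends G e}"
      using E by auto
    then show ?thesis using E by (simp only:) (intro sum.union_disjoint; auto)
  qed
  have inner: "(\<Sum>e | e \<in> EK \<and> vs ! k \<in> ends G e. f e) = f (es ! (k - 1)) + f (es ! k)"
    if k: "0 < k" "k < length es" for k
  proof -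
    have "vs ! k \<notin> VH" using is_path_nth_inner[OF P(1) k] V(2) by blast
    then have "(\<Sum>e | e \<in> EH \<and> vs ! k \<in> ends G e. f e) = 0" using H by (intro sum.neutral) blast
    then show ?thesis using split at(3)[OF k, where f = f] by simp
  qed
  have old: "(\<Sum>e | e \<in> EK \<and> v \<in> ends G e. f e) = (\<Sum>e | e \<in> EH \<and> v \<in> ends G e. f e) +
     of_bool (v \<in> {hd vs, last vs}) * t"
    if v: "v \<in> VH" and t: "f (es ! 0) = t" "f (es ! (length es - 1)) = t" for v t
  proof -
    consider "v = hd vs" | "v = last vs" | "v \<notin> set vs" using v V(2) by blast
    then have "(\<Sum>e | e \<in> set es \<and> v \<in> ends G e. f e) = of_bool (v \<in> {hd vs, last vs}) * t"
    proof cases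
      case 3
      then have "v \<noteq> hd vs" "v \<noteq> last vs" using V(2) by auto
      then show ?thesis using at(4)[OF 3, where f = f] by simp
    qed (use at(1,2)[where f = f] t in simp_all)
    then show ?thesis using split by simp
  qed
  note ev = ends_even_edges[OF P(2)]
  show ?thesis
  proof
    assume L: "balanced (ends G) b VK EK f"
    have chain: "f (es ! (k - 1)) + f (es ! k) = b" if k: "0 < k" "k < length es" for k
    proof -
      have "vs ! k \<in> VK" using is_path_nth_inner(1)[OF P(1) k] V(1) by auto
      then show ?thesis using L inner[OF k] by (auto simp: balanced_def)
    qed
    note ac = alternating_chain[of es f b, OF chain]
    define t where "t = f (es ! 0)"
    have t: "f (es ! 0) = t" "f (es ! (length es - 1)) = t" using ac(1)[OF _ _ ev(2)] by (auto simp: t_def)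
    have "\<forall>v\<in>VH. (\<Sum>e | e \<in> EH \<and> v \<in> ends G e. f e) = b - of_bool (v \<in> {hd vs, last vs}) * t"
    proof
      fix v assume v: "v \<in> VH"
      then have "(\<Sum>e | e \<in> EK \<and> v \<in> ends G e. f e) = b" using L V(1) by (auto simp: balanced_def)
      then show "(\<Sum>e | e \<in> EH \<and> v \<in> ends G e. f e) = b - of_bool (v \<in> {hd vs, last vs}) * t"
        using old[OF v t] by simp
    qed
    moreover have "\<forall>e\<in>even_edges es. f e = t" "\<forall>e\<in>odd_edges es. f e = b - t"
      using ac by (auto simp: t_def)
    moreover have "\<forall>e. e \<notin> EK \<longrightarrow> f e = 0" using L by (simp add: balanced_def)
    ultimately show ?R by blast
  next
    assume ?R
    then obtain t where R: "\<forall>e. e \<notin> EK \<longrightarrow> f e = 0" "\<forall>e\<in>even_edges es. f e = t"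
      "\<forall>e\<in>odd_edges es. f e = b - t"
      "\<And>v. v \<in> VH \<Longrightarrow> (\<Sum>e | e \<in> EH \<and> v \<in> ends G e. f e) = b - of_bool (v \<in> {hd vs, last vs}) * t"
      by blast
    have t: "f (es ! 0) = t" "f (es ! (length es - 1)) = t" using R(2) ev by auto
    have "(\<Sum>e | e \<in> EK \<and> v \<in> ends G e. f e) = b" if "v \<in> VK" for v
    proof (cases "v \<in> VH")
      case True
      then show ?thesis using old[OF True t] R(4)[OF True] by simp
    next
      case False
      then have "v \<in> set vs" "v \<noteq> hd vs" "v \<noteq> last vs" using that V by blast+
      then obtain k where k: "0 < k" "k < length es" "v = vs ! k"
        using path_vertex_cases[OF P(1)] by blast
      then show ?thesis using inner[OF k(1,2)] chain_alternating[OF R(2,3) k(1,2)] by simp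
    qed
    then show "balanced (ends G) b VK EK f" using R(1) by (simp add: balanced_def)
  qed
qed

text \<open>The edge closing the cycle behaves like one more edge at an odd position. With it
  counted in \<open>P0\<close>, the first cycle has the form of an ear attached to the empty
  graph.\<close>

lemma first_cycle_balanced:
  assumes P: "is_path G vs es" "odd (length es)" and e: "e \<notin> set es" "ends G e = {hd vs, last vs}"
  shows "balanced (ends G) b (set vs) (insert e (set es)) f \<longleftrightarrow> (\<forall>e'. e' \<notin> insert e (set es) \<longrightarrow> f e' = 0) \<and>
    (\<exists>t. (\<forall>e'\<in>even_edges es. f e' = t) \<and> (\<forall>e'\<in>insert e (odd_edges es). f e' = b - t))"
    (is "_ \<longleftrightarrow> ?R")
proof -
  have ne: "es \<noteq> []" using P(2) by auto
  note at = path_sum_at[OF P(1) ne, where f = f]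
  have split: "(\<Sum>e' | e' \<in> insert e (set es) \<and> v \<in> ends G e'. f e') =
    of_bool (v \<in> {hd vs, last vs}) * f e + (\<Sum>e | e \<in> set es \<and> v \<in> ends G e. f e)" for v
  proof (cases "v \<in> {hd vs, last vs}")
    case True
    then have "{e'. e' \<in> insert e (set es) \<and> v \<in> ends G e'} = insert e {e. e \<in> set es \<and> v \<in> ends G e}"
      using e by auto
    then show ?thesis using e True by simp
  next
    case False
    then have "{e'. e' \<in> insert e (set es) \<and> v \<in> ends G e'} = {e. e \<in> set es \<and> v \<in> ends G e}"
      using e by auto
    then show ?thesis using False by simp
  qed
  have inner: "(\<Sum>e' | e' \<in> insert e (set es) \<and> vs ! k \<in> ends G e'. f e') = f (es ! (k - 1)) + f (es ! k)"
    if k: "0 < k" "k < length es" for k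
    using split[of "vs ! k"] at(3)[OF k] is_path_nth_inner[OF P(1) k] by simp
  note ev = ends_even_edges[OF P(2)]
  have mem: "hd vs \<in> set vs" "last vs \<in> set vs" using P(1) by (auto simp: is_path_def intro!: hd_in_set last_in_set)
  show ?thesis
  proof
    assume L: "balanced (ends G) b (set vs) (insert e (set es)) f"
    have chain: "f (es ! (k - 1)) + f (es ! k) = b" if k: "0 < k" "k < length es" for k
    proof -
      have "vs ! k \<in> set vs" using is_path_nth_inner(1)[OF P(1) k] by auto
      then show ?thesis using L inner[OF k] by (auto simp: balanced_def)
    qed
    note ac = alternating_chain[of es f b, OF chain]
    have "(\<Sum>e' | e' \<in> insert e (set es) \<and> hd vs \<in> ends G e'. f e') = b"
      using L mem by (auto simp: balanced_def)
    then have "f e = b - f (es ! 0)" using split[of "hd vs"] at(1) by simp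
    then show ?R
      using ac L by (auto simp: balanced_def intro!: exI[of _ "f (es ! 0)"])
  next
    assume ?R
    then obtain t where R: "\<forall>e'. e' \<notin> insert e (set es) \<longrightarrow> f e' = 0" "\<forall>e\<in>even_edges es. f e = t"
      "\<forall>e\<in>odd_edges es. f e = b - t" "f e = b - t" by blast
    have t: "f (es ! 0) = t" "f (es ! (length es - 1)) = t" using R(2) ev by auto
    have "(\<Sum>e' | e' \<in> insert e (set es) \<and> v \<in> ends G e'. f e') = b" if vv: "v \<in> set vs" for v
    proof -
      consider "v = hd vs" | "v = last vs" | k where "0 < k" "k < length es" "v = vs ! k"
        using path_vertex_cases[OF P(1) vv] by blast
      then show ?thesis
      proof cases
        case 1
        then show ?thesis using split[of v] at(1) t R(4) by simp
      next
        case 2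
        then show ?thesis using split[of v] at(2) t R(4) by simp
      next
        case 3
        then show ?thesis using inner[OF 3(1,2)] chain_alternating[OF R(2,3) 3(1,2)] by simp
      qed
    qed
    then show "balanced (ends G) b (set vs) (insert e (set es)) f" using R(1) by (simp add: balanced_def)
  qed
qed

lemma cycle_propagate:
  assumes c: "is_cycle G vs es" and step: "\<And>i. i < length es \<Longrightarrow> Q (es ! i) \<Longrightarrow> Q (es ! (Suc i mod length es))"
    and e: "e \<in> set es" "Q e" and e': "e' \<in> set es"
  shows "Q e'"
proof -
  obtain k where k: "k < length es" "e = es ! k" using e by (auto simp: in_set_conv_nth)
  obtain j where j: "j < length es" "e' = es ! j" using e' by (auto simp: in_set_conv_nth)
  have pos: "0 < length es" using k by auto
  have "Q (es ! ((k + i) mod length es))" for i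
  proof (induction i)
    case 0
    then show ?case using k e by simp
  next
    case (Suc i)
    have "(k + i) mod length es < length es" using pos by simp
    from step[OF this Suc] show ?case by (simp add: mod_simps)
  qed
  from this[of "j + length es - k"] show ?thesis using k j by simp
qed

context plane_bip
begin

lemma cvec_abs: "e \<in> C \<Longrightarrow> cvec C e = 1 \<or> cvec C e = -1" "e \<notin> C \<Longrightarrow> cvec C e = 0"
  by (auto simp: cvec_def)

lemma cycle_edges: "C \<in> cycles G \<Longrightarrow> C \<subseteq> edges G" "C \<in> cycles G \<Longrightarrow> C \<noteq> {}"
  by (auto simp: cycles_def is_cycle_def)

lemma cvec_adjacent:
  assumes c: "is_cycle G vs es" and i: "i < length es"
  shows "cvec (set es) (es ! (Suc i mod length es)) = - cvec (set es) (es ! i)"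
proof -
  have l: "length vs = length es" "distinct es" "set es \<subseteq> edges G" using c by (auto simp: is_cycle_def)
  have j: "Suc i mod length es < length es" using i by (intro mod_less_divisor) linarith
  have en: "ends G (es ! i) = {vs ! i, vs ! (Suc i mod length es)}" using c i by (auto simp: is_cycle_def)
  have "sg (col (vs ! i)) = - sg (col (vs ! (Suc i mod length es)))"
  proof (rule sg_neq)
    have "es ! i \<in> edges G" using l i by auto
    from ends_col[OF this en] show "col (vs ! i) \<noteq> col (vs ! (Suc i mod length es))" .
  qed
  moreover have "\<exists>d. \<forall>e. cvec (set es) e = d * pvec col vs es e"
  proof -
    have "es \<noteq> []" using i by auto
    then obtain e u v vs2 es2 where s: "path_pair G [u, v] [e] vs2 es2" "set es = insert e (set es2)"
      "\<And>x. pvec col [u, v] [e] x - pvec col vs2 es2 x = pvec col vs es x"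
      using cycle_split_edge[OF c, of "hd es"] by (metis hd_in_set)
    have U: "set [e] \<union> set es2 = set es" using s(2) by simp
    show ?thesis by (rule cvec_pair[OF s(1), unfolded U s(3)]) blast
  qed
  ultimately show ?thesis using l i j by (auto simp: pvec_nth)
qed

section \<open>Edge sets in which every degree is 0 or 2\<close>

definition deg02 :: "complex set set \<Rightarrow> bool" where
  "deg02 X \<longleftrightarrow> X \<subseteq> edges G \<and> (\<forall>v. {e \<in> X. v \<in> ends G e} = {} \<or> card {e \<in> X. v \<in> ends G e} = 2)"

text \<open>A lone cycle edge at \<open>v\<close> would contribute 1 or -1 to the sum of
  \<open>cvec C\<close> there, which is zero.\<close>

lemma cycle_two_at:
  assumes "C \<in> cycles G" "e \<in> C" "v \<in> ends G e"
  obtains e' where "e' \<in> C" "e' \<noteq> e" "v \<in> ends G e'"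
proof (rule ccontr)
  assume "\<not> thesis"
  then have none: "\<And>e'. e' \<in> C \<Longrightarrow> e' \<noteq> e \<Longrightarrow> v \<notin> ends G e'" using that by blast
  have eE: "e \<in> edges G" using assms cycle_edges by blast
  have "(\<Sum>e' | e' \<in> edges G \<and> v \<in> ends G e'. cvec C e') = (\<Sum>e'\<in>{e}. cvec C e')"
    using finite_edges eE assms none cvec_abs(2) by (intro sum.mono_neutral_right) auto
  then show False using cvec_balance[OF assms(1), of v] cvec_abs(1)[OF assms(2)] by auto
qed

lemma deg02_at_cycle:
  assumes X: "deg02 X" and C: "C \<in> cycles G" "C \<subseteq> X" and e: "e \<in> C" "v \<in> ends G e"
  shows "{f \<in> X. v \<in> ends G f} \<subseteq> C"
proof -
  obtain e' where e': "e' \<in> C" "e' \<noteq> e" "v \<in> ends G e'" using cycle_two_at[OF C(1) e] .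
  have "e \<in> {f \<in> X. v \<in> ends G f}" using C e by auto
  then have c: "card {f \<in> X. v \<in> ends G f} = 2" using X unfolding deg02_def by blast
  then have "finite {f \<in> X. v \<in> ends G f}" by (metis card.infinite zero_neq_numeral)
  moreover have "{e, e'} \<subseteq> {f \<in> X. v \<in> ends G f}" "card {e, e'} = 2" using C e e' by auto
  ultimately have "{e, e'} = {f \<in> X. v \<in> ends G f}" using c by (metis card_subset_eq)
  then show ?thesis using e e' by auto
qed

text \<open>A cycle in \<open>X\<close> uses up both edges of \<open>X\<close> at each of its
  vertices, so a walk along \<open>C\<close> that starts on \<open>D\<close> cannot leave
  \<open>D\<close>.\<close>

lemma deg02_cycle_unique:
  assumes X: "deg02 X" and C: "C \<in> cycles G" "C \<subseteq> X" and D: "D \<in> cycles G" "D \<subseteq> X"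
    and e: "e \<in> C" "e \<in> D"
  shows "C \<subseteq> D"
proof
  fix e' assume e': "e' \<in> C"
  obtain vs es where c: "is_cycle G vs es" "C = set es" using C by (auto simp: cycles_def)
  show "e' \<in> D"
  proof (rule cycle_propagate[OF c(1), of "\<lambda>e. e \<in> D" e e'])
    fix i assume i: "i < length es" "es ! i \<in> D"
    let ?j = "Suc i mod length es"
    have j: "?j < length es" using i by (intro mod_less_divisor) linarith
    have "vs ! ?j \<in> ends G (es ! i)" "vs ! ?j \<in> ends G (es ! ?j)"
      using c(1) i j by (auto simp: is_cycle_def)
    moreover have "es ! ?j \<in> X" using C c j by auto
    ultimately show "es ! ?j \<in> D" using deg02_at_cycle[OF X D i(2)] by blast
  qed (use e e' c in auto)
qed

text \<open>At the last vertex of a longest path in \<open>X\<close> there is a second edge of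
  \<open>X\<close>. By maximality it leads back to the path and closes a cycle.\<close>

lemma deg02_ex_cycle:
  assumes X: "deg02 X" and ne: "X \<noteq> {}"
  shows "\<exists>C\<in>cycles G. C \<subseteq> X"
proof -
  define L where "L = {length es |vs es. is_path G vs es \<and> es \<noteq> [] \<and> set es \<subseteq> X}"
  have "L \<subseteq> {..card (verts G)}"
  proof
    fix l assume "l \<in> L"
    then obtain vs es where l: "l = length es" "is_path G vs es" by (auto simp: L_def)
    then have "length vs = card (set vs)" "set vs \<subseteq> verts G" "length vs = Suc l"
      by (auto simp: is_path_def distinct_card)
    then show "l \<in> {..card (verts G)}" using card_mono[OF finite_verts, of "set vs"] by auto
  qed
  then have fin: "finite L" using finite_subset by blast
  obtain e0 where e0: "e0 \<in> X" using ne by blast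
  then have e0E: "e0 \<in> edges G" using X by (auto simp: deg02_def)
  obtain u v where uv: "ends G e0 = {u, v}" "u \<noteq> v" using earc(3)[OF e0E] ends_neq[OF e0E] by metis
  have "ends G e0 \<subseteq> verts G" by (auto simp: ends_def)
  then have "is_path G [u, v] [e0]" using uv e0E by (auto simp: is_path_def)
  then have "1 \<in> L" unfolding L_def using e0 by (auto intro!: exI[of _ "[u,v]"] exI[of _ "[e0]"])
  then have "Max L \<in> L" using fin by (intro Max_in) auto
  then obtain vs es where p: "is_path G vs es" "es \<noteq> []" "set es \<subseteq> X" "length es = Max L"
    by (auto simp: L_def)
  have max: "length fs \<le> length es" if "is_path G ws fs" "fs \<noteq> []" "set fs \<subseteq> X" for ws fs
  proof -
    have "length fs \<in> L" using that unfolding L_def by blast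
    then show ?thesis using Max_ge[OF fin] p(4) by simp
  qed
  have l: "length vs = Suc (length es)" "distinct vs" "set vs \<subseteq> verts G" using p(1) by (auto simp: is_path_def)
  then have vsne: "vs \<noteq> []" by auto
  define v where "v = last vs"
  have v: "v = vs ! length es" using l vsne by (simp add: v_def last_conv_nth)
  define el where "el = es ! (length es - 1)"
  have el: "el \<in> X" "v \<in> ends G el"
  proof -
    have k: "length es - 1 < length es" "Suc (length es - 1) = length es" using p(2) by auto
    show "el \<in> X" unfolding el_def using p(3) k(1) nth_mem by blast
    have "ends G el = {vs ! (length es - 1), vs ! Suc (length es - 1)}"
      unfolding el_def using p(1) k(1) unfolding is_path_def by blast
    then show "v \<in> ends G el" using k(2) v by simp
  qed
  have at: "{e \<in> set es. v \<in> ends G e} = {el}"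
  proof -
    have "{i. i < length es \<and> (i = length es \<or> Suc i = length es)} = {length es - 1}" using p(2) by auto
    then show ?thesis using path_edges_at[OF p(1), of "length es"] v by (simp add: el_def)
  qed
  have "card {e \<in> X. v \<in> ends G e} = 2" using X el unfolding deg02_def by blast
  then have "{e \<in> X. v \<in> ends G e} \<noteq> {el}" by auto
  then obtain e' where e': "e' \<in> X" "v \<in> ends G e'" "e' \<noteq> el" using el by auto
  then have e'E: "e' \<in> edges G" using X by (auto simp: deg02_def)
  have e'n: "e' \<notin> set es" using at e' by auto
  obtain w where w: "ends G e' = {w, v}" "w \<noteq> v"
  proof -
    obtain a b where "ends G e' = {a, b}" "a \<noteq> b" using earc(3)[OF e'E] ends_neq[OF e'E] by metis
    then show thesis using that e'(2) by (metis insertE insert_commute singletonD)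
  qed
  have wV: "w \<in> verts G" using w by (auto simp: ends_def)
  have "w \<in> set vs"
  proof (rule ccontr)
    assume "w \<notin> set vs"
    have "is_path G (vs @ [w]) (es @ [e'])"
      unfolding is_path_def
    proof (intro conjI allI impI)
      fix i assume i: "i < length (es @ [e'])"
      show "ends G ((es @ [e']) ! i) = {(vs @ [w]) ! i, (vs @ [w]) ! Suc i}"
      proof (cases "i = length es")
        case True
        have "(vs @ [w]) ! length vs = w" by simp
        then show ?thesis using True l w v by (simp add: nth_append insert_commute)
      next
        case False
        then have "i < length es" using i by simp
        then show ?thesis using p(1) l by (simp add: is_path_def nth_append)
      qed
    qed (use p(1) l \<open>w \<notin> set vs\<close> wV e'E in \<open>auto simp: is_path_def\<close>)
    from max[OF this] show False using e' p by auto
  qed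
  then obtain j where j: "j < length vs" "w = vs ! j" by (auto simp: in_set_conv_nth)
  then have j': "j < length es" using w(2) v l by (cases "j = length es") auto
  have q: "is_path G (drop j vs) (drop j es)" using is_path_drop[OF p(1)] j' by simp
  have hd: "hd (drop j vs) = w" using j by (simp add: hd_drop_conv_nth)
  have la: "last (drop j vs) = v" using j by (simp add: v_def)
  have mem: "w \<in> set (drop j vs)" "v \<in> set (drop j vs)"
    using hd la j by (metis drop_eq_Nil hd_in_set last_in_set leD)+
  have "path_pair G [w, v] [e'] (drop j vs) (drop j es)"
    unfolding path_pair_def
  proof (intro conjI)
    show "is_path G [w, v] [e']" using w wV e'E l vsne by (auto simp: is_path_def v_def)
    show "set [w, v] \<inter> set (drop j vs) = {hd [w, v], last [w, v]}" using mem by auto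
    show "set [e'] \<inter> set (drop j es) = {}" using e'n by (auto dest: in_set_dropD)
  qed (use q hd la j' in auto)
  from path_pair_cycle(1)[OF this]
  have "set ([e'] @ rev (drop j es)) \<in> cycles G" unfolding cycles_def by blast
  then have "insert e' (set (drop j es)) \<in> cycles G" by simp
  moreover have "insert e' (set (drop j es)) \<subseteq> X" using e' p(3) by (auto dest: in_set_dropD)
  ultimately show ?thesis by blast
qed

text \<open>Removing a cycle of \<open>X\<close> takes away both edges at each vertex that it meets,
  so the rest has degrees 0 and 2 again; this is repeated until the removed cycle contains
  \<open>e\<close>.\<close>

lemma deg02_cover:
  assumes "deg02 X" "e \<in> X"
  shows "\<exists>C\<in>cycles G. C \<subseteq> X \<and> e \<in> C"
  using assms
proof (induction "card X" arbitrary: X rule: less_induct)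
  case less
  have fin: "finite X" using less.prems finite_edges finite_subset by (auto simp: deg02_def)
  obtain C where C: "C \<in> cycles G" "C \<subseteq> X" using deg02_ex_cycle less.prems by blast
  show ?case
  proof (cases "e \<in> C")
    case False
    have "deg02 (X - C)"
      unfolding deg02_def
    proof (intro conjI allI)
      show "X - C \<subseteq> edges G" using less.prems by (auto simp: deg02_def)
      fix v
      show "{e \<in> X - C. v \<in> ends G e} = {} \<or> card {e \<in> X - C. v \<in> ends G e} = 2"
      proof (cases "\<exists>f\<in>C. v \<in> ends G f")
        case True
        then obtain f where "f \<in> C" "v \<in> ends G f" by blast
        then show ?thesis using deg02_at_cycle[OF less.prems(1) C] by blast
      next
        case False
        then have "{e \<in> X - C. v \<in> ends G e} = {e \<in> X. v \<in> ends G e}" by blast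
        then show ?thesis using less.prems by (simp add: deg02_def)
      qed
    qed
    moreover have "card (X - C) < card X"
      using C(2) cycle_edges(2)[OF C(1)] by (intro psubset_card_mono fin) blast
    ultimately obtain C' where "C' \<in> cycles G" "C' \<subseteq> X - C" "e \<in> C'"
      using less.hyps less.prems(2) False by blast
    then show ?thesis by blast
  qed (use C in blast)
qed

lemma matching_edge:
  assumes "M \<in> perfect_matchings G" "v \<in> verts G"
  obtains e where "e \<in> M" "v \<in> ends G e" "\<And>e'. e' \<in> M \<Longrightarrow> v \<in> ends G e' \<Longrightarrow> e' = e"
  using assms unfolding perfect_matchings_def by blast

lemma sym_diff_deg02:
  assumes M: "M \<in> perfect_matchings G" and B: "B \<in> perfect_matchings G"
  shows "deg02 (sym_diff M B)"
  unfolding deg02_def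
proof (intro conjI allI)
  show "sym_diff M B \<subseteq> edges G" using assms by (auto simp: perfect_matchings_def)
  fix v
  show "{e \<in> sym_diff M B. v \<in> ends G e} = {} \<or> card {e \<in> sym_diff M B. v \<in> ends G e} = 2"
  proof (cases "v \<in> verts G")
    case False
    then show ?thesis by (auto simp: ends_def)
  next
    case True
    obtain m where m: "m \<in> M" "v \<in> ends G m" "\<And>e'. e' \<in> M \<Longrightarrow> v \<in> ends G e' \<Longrightarrow> e' = m"
      using matching_edge[OF M True] by blast
    obtain b where b: "b \<in> B" "v \<in> ends G b" "\<And>e'. e' \<in> B \<Longrightarrow> v \<in> ends G e' \<Longrightarrow> e' = b"
      using matching_edge[OF B True] by blast
    show ?thesis
    proof (cases "m = b")
      case True
      have "e \<in> M \<longleftrightarrow> e \<in> B" if "v \<in> ends G e" for e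
        using m(1) m(3)[OF _ that] b(1) b(3)[OF _ that] True by metis
      then have "{e \<in> sym_diff M B. v \<in> ends G e} = {}" by blast
      then show ?thesis by blast
    next
      case False
      have "e \<in> sym_diff M B \<longleftrightarrow> e = m \<or> e = b" if "v \<in> ends G e" for e
        using m(1,2) m(3)[OF _ that] b(1,2) b(3)[OF _ that] m(3)[of b] b(3)[of m] False by blast
      then have "{e \<in> sym_diff M B. v \<in> ends G e} = {m, b}" using m(2) b(2) by blast
      then show ?thesis using False by simp
    qed
  qed
qed

text \<open>Along \<open>C\<close> the clockwise sign and the sign of \<open>M\<close> minus
  \<open>B\<close> both change at every step, so they agree up to one global sign.\<close>

lemma sym_diff_cycle:
  assumes M: "M \<in> perfect_matchings G" and B: "B \<in> perfect_matchings G"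
    and C: "C \<in> cycles G" "C \<subseteq> sym_diff M B"
  shows "C \<in> alternating_cycles G M"
    and "(\<forall>e\<in>C. cvec C e = of_bool (e \<in> M) - of_bool (e \<in> B)) \<or>
         (\<forall>e\<in>C. cvec C e = of_bool (e \<in> B) - of_bool (e \<in> M))"
proof -
  obtain vs es where c: "is_cycle G vs es" "C = set es" using C by (auto simp: cycles_def)
  have l: "length vs = length es" "2 \<le> length es" "distinct es" using c(1) by (auto simp: is_cycle_def)
  have alt: "es ! i \<in> M \<longleftrightarrow> es ! (Suc i mod length es) \<notin> M" if i: "i < length es" for i
  proof -
    let ?j = "Suc i mod length es"
    have j: "?j < length es" using i by (intro mod_less_divisor) linarith
    have "?j \<noteq> i"
    proof (cases "Suc i = length es")
      case True
      then show ?thesis using l(2) by auto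
    next
      case False
      then show ?thesis using i by simp
    qed
    then have ne: "es ! i \<noteq> es ! ?j" using l i j by (simp add: nth_eq_iff_index_eq)
    have v: "vs ! ?j \<in> ends G (es ! i)" "vs ! ?j \<in> ends G (es ! ?j)"
      using c(1) i j by (auto simp: is_cycle_def)
    have vV: "vs ! ?j \<in> verts G" using v by (auto simp: ends_def)
    have "es ! i \<in> sym_diff M B" "es ! ?j \<in> sym_diff M B" using C c i j by auto
    moreover have "\<not> (es ! i \<in> M \<and> es ! ?j \<in> M)" using matching_edge[OF M vV] v ne by metis
    moreover have "\<not> (es ! i \<in> B \<and> es ! ?j \<in> B)" using matching_edge[OF B vV] v ne by metis
    ultimately show ?thesis by blast
  qed
  show "C \<in> alternating_cycles G M" unfolding alternating_cycles_def using c alt by blast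
  define y where "y e = of_bool (e \<in> M) - (of_bool (e \<in> B) :: int)" for e
  have y: "y e = 1 \<or> y e = -1" if "e \<in> C" for e using that C(2) by (auto simp: y_def)
  have y_alt: "y (es ! (Suc i mod length es)) = - y (es ! i)" if i: "i < length es" for i
  proof -
    have j: "Suc i mod length es < length es" using i by (intro mod_less_divisor) linarith
    have "es ! i \<in> sym_diff M B" "es ! (Suc i mod length es) \<in> sym_diff M B" using C c i j by auto
    then show ?thesis using alt[OF i] by (auto simp: y_def)
  qed
  have "0 < length es" using l(2) by linarith
  then have "es ! 0 \<in> C" using c(2) nth_mem by blast
  have agree: "cvec C e = k * y e" if "e \<in> C" "cvec C (es ! 0) = k * y (es ! 0)" for e k
  proof (rule cycle_propagate[OF c(1), of "\<lambda>e. cvec C e = k * y e" "es ! 0" e])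
    fix i assume "i < length es" "cvec C (es ! i) = k * y (es ! i)"
    then show "cvec C (es ! (Suc i mod length es)) = k * y (es ! (Suc i mod length es))"
      using cvec_adjacent[OF c(1)] y_alt c(2) by simp
  qed (use that \<open>es ! 0 \<in> C\<close> c in auto)
  have "cvec C (es ! 0) = 1 * y (es ! 0) \<or> cvec C (es ! 0) = -1 * y (es ! 0)"
    using y[OF \<open>es ! 0 \<in> C\<close>] cvec_abs(1)[OF \<open>es ! 0 \<in> C\<close>] by auto
  then have "(\<forall>e\<in>C. cvec C e = 1 * y e) \<or> (\<forall>e\<in>C. cvec C e = -1 * y e)" using agree by blast
  then show "(\<forall>e\<in>C. cvec C e = of_bool (e \<in> M) - of_bool (e \<in> B)) \<or>
         (\<forall>e\<in>C. cvec C e = of_bool (e \<in> B) - of_bool (e \<in> M))" by (simp add: y_def)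
qed

lemma proper_cycle_cvec:
  assumes "proper_cycle G col B C" "e \<in> C"
  shows "C \<in> cycles G" "cvec C e = (if e \<in> B then 1 else -1)"
proof -
  obtain vs es where c: "is_cycle G vs es" "C = set es"
    and alt: "\<And>i. i < length es \<Longrightarrow> es ! i \<in> B \<longleftrightarrow> es ! (Suc i mod length es) \<notin> B"
    using assms(1) unfolding proper_cycle_def alternating_cycles_def by blast
  show "C \<in> cycles G" using c by (auto simp: cycles_def)
  have in_B: "cvec C e = 1" if "e \<in> C" "e \<in> B" for e
    using assms(1) that by (auto simp: proper_cycle_def cvec_def)
  show "cvec C e = (if e \<in> B then 1 else -1)"
  proof (cases "e \<in> B")
    case False
    obtain i where i: "i < length es" "e = es ! i" using assms(2) c(2) by (auto simp: in_set_conv_nth)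
    have j: "Suc i mod length es < length es" using i by (intro mod_less_divisor) linarith
    have "cvec C (es ! (Suc i mod length es)) = 1" using alt[OF i(1)] False i j c(2) by (intro in_B) auto
    then show ?thesis using cvec_adjacent[OF c(1) i(1)] c(2) i False by simp
  qed (use in_B assms in simp)
qed

end

section \<open>Adding an ear to a plane graph\<close>

lemma frontier_component:
  fixes S :: "'a::real_normed_vector set"
  assumes "connected S" "S \<noteq> {}" "S \<inter> X = {}" "frontier S \<subseteq> X"
  shows "S \<in> components (- X)"
proof -
  obtain x where x: "x \<in> S" using assms(2) by blast
  have s: "S \<subseteq> connected_component_set (- X) x"
    using connected_component_maximal[OF x assms(1)] assms(3) by blast
  have "connected_component_set (- X) x \<subseteq> S"
  proof (rule ccontr)
    assume "\<not> ?thesis"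
    then have "connected_component_set (- X) x \<inter> frontier S \<noteq> {}"
      using connected_Int_frontier[of "connected_component_set (- X) x" S] s x by blast
    moreover have "connected_component_set (- X) x \<subseteq> - X" by (rule connected_component_subset)
    ultimately show False using assms(4) by blast
  qed
  then have "S = connected_component_set (- X) x" using s by blast
  then show ?thesis using componentsI[of x "- X"] x assms(3) by auto
qed

lemma component_inside_or_avoids:
  fixes f :: "complex set"
  assumes "arc_pair p q" "connected f" "f \<inter> (path_image p \<union> path_image q) = {}"
  shows "f \<subseteq> inside (path_image p \<union> path_image q) \<or> f \<inter> inside (path_image p \<union> path_image q) = {}"
  using connected_Int_frontier[OF assms(2), of "inside (path_image p \<union> path_image q)"]
  unfolding jordan_pair(9)[OF assms(1)] using assms(3) by blast

context plane_bip
begin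

text \<open>\<open>ends\<close> depends on the vertex set, so an edge of \<open>H\<close> might have
  fewer ends in \<open>H\<close> than in \<open>G\<close>. The last clause excludes this and lets
  \<open>ends G\<close> be used throughout.\<close>

definition sub_drawing :: "pgraph \<Rightarrow> bool" where
  "sub_drawing H \<longleftrightarrow> verts H \<subseteq> verts G \<and> edges H \<subseteq> edges G \<and> (\<forall>e\<in>edges H. ends G e \<subseteq> verts H)"

lemma sub_ends: "sub_drawing H \<Longrightarrow> e \<in> edges H \<Longrightarrow> ends H e = ends G e"
  unfolding sub_drawing_def ends_def by blast

lemma sub_path: "sub_drawing H \<Longrightarrow> is_path H vs es \<Longrightarrow> is_path G vs es"
proof -
  assume H: "sub_drawing H" and p: "is_path H vs es"
  have "ends G (es ! i) = ends H (es ! i)" if "i < length es" for i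
  proof -
    have "es ! i \<in> edges H" using p nth_mem[OF that] unfolding is_path_def by blast
    then show ?thesis using sub_ends[OF H] by simp
  qed
  moreover have "verts H \<subseteq> verts G" "edges H \<subseteq> edges G" using H by (simp_all add: sub_drawing_def)
  ultimately show "is_path G vs es" using p unfolding is_path_def by auto
qed

text \<open>The invariant of the induction over ears; it is what allows the theta-curve lemmas to be
  applied to the next ear.\<close>

definition well_drawn :: "pgraph \<Rightarrow> bool" where
  "well_drawn H \<longleftrightarrow> periphery H \<in> cycles G \<and> infinite_face H = outside (\<Union>(periphery H)) \<and>
     drawing H \<subseteq> \<Union>(periphery H) \<union> inside (\<Union>(periphery H))"

text \<open>Otherwise every point of \<open>e\<close> would lie on another edge and hence be an end
  of \<open>e\<close>, but \<open>e\<close> is infinite.\<close>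

lemma edge_in_Union:
  assumes "e \<in> edges G" "C \<subseteq> edges G" "e \<subseteq> \<Union>C"
  shows "e \<in> C"
proof (rule ccontr)
  assume "e \<notin> C"
  have "e \<subseteq> ends G e"
  proof
    fix x assume "x \<in> e"
    then obtain f where "f \<in> C" "x \<in> f" using assms(3) by blast
    then show "x \<in> ends G e" using edge_inter[OF assms(1), of f] \<open>x \<in> e\<close> \<open>e \<notin> C\<close> assms(2) by blast
  qed
  moreover have "finite (ends G e)" using earc(3)[OF assms(1)] by simp
  ultimately show False using edge_infinite[OF assms(1)] finite_subset by blast
qed

lemma face_edges_eq:
  assumes "frontier f = \<Union>C" "C \<subseteq> edges K" "edges K \<subseteq> edges G"
  shows "face_edges K f = C"
proof -
  have CG: "C \<subseteq> edges G" using assms(2,3) by (rule subset_trans)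
  show ?thesis
    unfolding face_edges_def assms(1)
  proof (intro equalityI subsetI)
    fix e assume e: "e \<in> {e \<in> edges K. e \<subseteq> \<Union>C}"
    then have "e \<in> edges G" using assms(3) by blast
    then show "e \<in> C" using CG by (rule edge_in_Union) (use e in simp)
  next
    fix e assume "e \<in> C"
    then show "e \<in> {e \<in> edges K. e \<subseteq> \<Union>C}" using assms(2) Union_upper[of e C] by blast
  qed
qed

lemma path_verts_in_edges:
  assumes "is_path G vs es" "es \<noteq> []" "v \<in> set vs"
  shows "\<exists>e\<in>set es. v \<in> ends G e"
proof -
  obtain k where k: "k < length vs" "v = vs ! k" using assms(3) by (auto simp: in_set_conv_nth)
  have l: "length vs = Suc (length es)" using assms(1) by (simp add: is_path_def)
  show ?thesis
  proof (cases "k < length es")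
    case True
    then have "v \<in> ends G (es ! k)" using assms(1) k by (simp add: is_path_def)
    then show ?thesis using True nth_mem by blast
  next
    case False
    have "0 < length es" using assms(2) by simp
    then have k': "k - 1 < length es" "Suc (k - 1) = k" using k l False by linarith+
    then have "ends G (es ! (k - 1)) = {vs ! (k - 1), vs ! Suc (k - 1)}"
      using assms(1) unfolding is_path_def by blast
    then have "v \<in> ends G (es ! (k - 1))" using k k' by simp
    then show ?thesis using k' nth_mem by blast
  qed
qed

lemma path_ends_col:
  "is_path G vs es \<Longrightarrow> sg (col (last vs)) = (if even (length es) then 1 else -1) * sg (col (hd vs))"
proof (induction es arbitrary: vs)
  case Nil
  then show ?case by (cases vs) (auto simp: is_path_def)
next
  case (Cons e es)
  then obtain u vs' where vs: "vs = u # vs'" by (cases vs) (auto simp: is_path_def)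
  note c = is_path_Cons[OF Cons.prems(1)[unfolded vs]]
  have "sg (col u) = - sg (col (hd vs'))" using ends_col[OF c(5,2)] by (rule sg_neq)
  then show ?case using Cons.IH[OF c(1)] vs c(4) by auto
qed

text \<open>Translates the branch condition of the algorithm into a sign. The path has odd length,
  so its ends have opposite colours, and the colour of the starting vertex together with the
  orientation fixes the sign of the first edge.\<close>

lemma white_to_black_path:
  assumes pp: "path_pair G vs1 es1 vs2 es2" and odd: "odd (length es1)"
  shows "white_to_black col (set es1 \<union> set es2) (set es1) \<longleftrightarrow> cvec (set es1 \<union> set es2) (es1 ! 0) = 1"
proof -
  obtain d :: int where d: "d = 1 \<or> d = -1"
    "\<And>e. cvec (set es1 \<union> set es2) e = - d * (pvec col vs1 es1 e - pvec col vs2 es2 e)"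
    "\<And>u v. clockwise_from_to (set es1 \<union> set es2) (set es1) u v \<longleftrightarrow>
       (if d = -1 then u = hd vs1 \<and> v = last vs1 else u = last vs1 \<and> v = hd vs1)"
    by (rule cvec_pair[OF pp]) blast
  have p: "is_path G vs1 es1" "es1 \<noteq> []" "set es1 \<inter> set es2 = {}" using pp by (auto simp: path_pair_def)
  have l: "length vs1 = Suc (length es1)" "vs1 \<noteq> []" using p(1) by (auto simp: is_path_def)
  have "es1 ! 0 \<in> set es1" using p(2) by (intro nth_mem) simp
  then have "pvec col vs2 es2 (es1 ! 0) = 0" using p(3) by (intro pvec_notin) blast
  moreover have "pvec col vs1 es1 (es1 ! 0) = sg (col (hd vs1))"
    using pvec_nth[OF is_path_distinct_edges[OF p(1)], of 0 vs1 col] p(2) l by (simp add: hd_conv_nth)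
  ultimately have c: "cvec (set es1 \<union> set es2) (es1 ! 0) = - d * sg (col (hd vs1))" using d(2) by simp
  have "sg (col (last vs1)) = - sg (col (hd vs1))" using path_ends_col[OF p(1)] odd by simp
  then have "(col (hd vs1) = White \<and> col (last vs1) = Black) \<or> (col (hd vs1) = Black \<and> col (last vs1) = White)"
    by (cases "col (hd vs1)"; cases "col (last vs1)") (auto simp: sg_def)
  moreover have "white_to_black col (set es1 \<union> set es2) (set es1) \<longleftrightarrow>
    (if d = -1 then col (hd vs1) = White \<and> col (last vs1) = Black
     else col (last vs1) = White \<and> col (hd vs1) = Black)"
    unfolding white_to_black_def d(3) by (cases "d = -1") simp_all
  ultimately show ?thesis unfolding c using d(1) by (elim disjE) (simp_all add: sg_def)
qed

lemma cvec_pair_given: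
  assumes pp: "path_pair G vs1 es1 vs2 es2" and d: "d = 1 \<or> d = (-1::int)"
    and t: "traces p vs1 es1" "traces q vs2 es2"
    and w: "\<And>z. z \<in> inside (path_image p \<union> path_image q) \<Longrightarrow> winding_number p z - winding_number q z = of_int d"
  shows "cvec (set es1 \<union> set es2) e = - d * (pvec col vs1 es1 e - pvec col vs2 es2 e)"
proof -
  let ?vs = "butlast vs1 @ butlast (rev vs2)" and ?es = "es1 @ rev es2"
  note c = path_pair_cycle[OF pp]
  have C: "set ?es = set es1 \<union> set es2" by simp
  have fe: "pvec col ?vs ?es = (\<lambda>e. pvec col vs1 es1 e - pvec col vs2 es2 e)" using c(2) by auto
  have im: "path_image p = \<Union>(set es1)" "path_image q = \<Union>(set es2)" using t by (auto simp: traces_def)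
  have "wn (\<lambda>e. pvec col vs1 es1 e - pvec col vs2 es2 e) z = of_int d"
    if "z \<in> inside (\<Union>(set es1 \<union> set es2))" for z
  proof -
    have z: "z \<in> inside (path_image p \<union> path_image q)" using that im by simp
    have "z \<notin> path_image p" "z \<notin> path_image q" using inside_UnD[OF z] by auto
    then show ?thesis using w[OF z] t unfolding traces_def wn_diff by auto
  qed
  from cvec_cycle[OF c(1) d, unfolded C fe, OF this] show ?thesis .
qed

lemma path_pair_union_cycle:
  assumes "path_pair G vs1 es1 vs2 es2" shows "set es1 \<union> set es2 \<in> cycles G"
proof -
  have "set (es1 @ rev es2) \<in> cycles G"
    using path_pair_cycle(1)[OF assms] unfolding cycles_def by blast
  then show ?thesis by simp
qed

lemma path_not_subset_ends:
  assumes "is_path G vs es" "es \<noteq> []"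
  shows "\<not> \<Union>(set es) \<subseteq> {a, b}"
proof
  assume "\<Union>(set es) \<subseteq> {a, b}"
  moreover have "hd es \<in> set es" using assms(2) by simp
  ultimately have "finite (hd es)" by (meson Union_upper finite.emptyI finite_insert finite_subset)
  moreover have "hd es \<in> edges G" using assms \<open>hd es \<in> set es\<close> by (auto simp: is_path_def)
  ultimately show False using edge_infinite by blast
qed

text \<open>Here \<open>p\<close> is the ear, \<open>q\<close> the part of the old periphery that it
  covers and \<open>r\<close> the part that stays outside. The new face lies between
  \<open>p\<close> and \<open>q\<close>, the old graph between \<open>q\<close> and
  \<open>r\<close>.\<close>

lemma ear_nested:
  assumes subH: "sub_drawing H" and subK: "sub_drawing K" and wd: "well_drawn H"
    and P: "is_path G vs es"
    and VK: "verts K = verts H \<union> set vs" and EK: "edges K = edges H \<union> set es"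
    and out: "\<Union>(set es) - {hd vs, last vs} \<subseteq> infinite_face H"
    and f: "f \<in> finite_faces K" "frontier f = \<Union>(set es \<union> F)" "F \<subseteq> periphery H"
    and pq: "path_pair G vs es vsq esq" and pr: "path_pair G vs es vsr esr"
    and qr: "path_pair G vsq esq vsr esr" and per: "periphery H = set esq \<union> set esr"
    and p: "traces p vs es" and q: "traces q vsq esq" and r: "traces r vsr esr"
    and nest: "path_image q \<inter> inside (path_image p \<union> path_image r) \<noteq> {}"
  shows "periphery K = set es \<union> set esr" "well_drawn K" "f = inside (\<Union>(set es \<union> set esq))"
    "f \<inter> inside (\<Union>(periphery H)) = {}" "inside (\<Union>(periphery H)) \<subseteq> inside (\<Union>(periphery K))"
    "f \<subseteq> inside (\<Union>(periphery K))"
    "cvec (set es \<union> set esr) e = cvec (set es \<union> set esq) e + cvec (set esq \<union> set esr) e"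
proof -
  note apq = traces_arc_pair[OF pq p q] and apr = traces_arc_pair[OF pr p r]
    and aqr = traces_arc_pair[OF qr q r]
  have im: "path_image p = \<Union>(set es)" "path_image q = \<Union>(set esq)" "path_image r = \<Union>(set esr)"
    and pe: "pathstart p = hd vs" "pathfinish p = last vs"
    using p q r by (auto simp: traces_def)
  have ne: "es \<noteq> []" using pq by (auto simp: path_pair_def)
  define X where "X = path_image p \<union> path_image q \<union> path_image r"
  have UH: "\<Union>(periphery H) = path_image q \<union> path_image r" using per im by auto
  have UK: "\<Union>(set es \<union> set esr) = path_image p \<union> path_image r" using im by auto
  have perE: "periphery H \<subseteq> edges H" by (auto simp: periphery_def face_edges_def)
  have XK: "X \<subseteq> drawing K"
    unfolding X_def im drawing_def EK using per perE by blast
  have fc: "f \<in> components (- drawing K)" "bounded f" using f by (auto simp: finite_faces_def)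
  have fcon: "connected f" "f \<noteq> {}" "f \<subseteq> - drawing K"
    using fc in_components_connected in_components_nonempty in_components_subset by blast+
  have free: "f \<inter> X = {}" using fcon XK by blast
  have frX: "frontier f \<subseteq> X" using f(2,3) per unfolding X_def im by blast
  have inf: "infinite_face H = outside (path_image q \<union> path_image r)"
    and drH: "drawing H \<subseteq> (path_image q \<union> path_image r) \<union> inside (path_image q \<union> path_image r)"
    using wd unfolding well_drawn_def UH by auto
  \<comment> \<open>If \<open>f\<close> were inside the old periphery, the ear, being in the closure
    of \<open>f\<close>, would be in the closed disc; but apart from its ends it lies in the
    infinite face.\<close>
  have fout: "f \<inter> inside (path_image q \<union> path_image r) = {}"
  proof (rule ccontr)
    assume "\<not> ?thesis"
    then have fi: "f \<subseteq> inside (path_image q \<union> path_image r)"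
      using component_inside_or_avoids[OF aqr fcon(1)] free unfolding X_def by blast
    have "closure f \<subseteq> inside (path_image q \<union> path_image r) \<union> (path_image q \<union> path_image r)"
      using closure_mono[OF fi] jordan_pair(9)[OF aqr]
        closure_Un_frontier[of "inside (path_image q \<union> path_image r)"] by simp
    moreover have "\<Union>(set es) \<subseteq> closure f" using f(2) frontier_def[of f] by auto
    ultimately have "\<Union>(set es) \<inter> outside (path_image q \<union> path_image r) = {}"
      using jordan_pair(7)[OF aqr] outside_no_overlap[of "path_image q \<union> path_image r"] by blast
    then have "\<Union>(set es) \<subseteq> {hd vs, last vs}" using out inf by blast
    then show False using path_not_subset_ends[OF P ne] by blast
  qed
  note ts = theta_split[OF apr apq aqr nest]
  have f_in: "f = inside (path_image p \<union> path_image q)"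
    using free frX unfolding X_def
    by (intro theta_bounded_face[OF apr apq aqr nest fcon(1,2) fc(2) _ _ fout])
  then show "f = inside (\<Union>(set es \<union> set esq))" using im by simp
  have CK: "set es \<union> set esr \<in> cycles G"
    by (rule path_pair_union_cycle[OF pr])
  have ends_in: "{pathstart p, pathfinish p} \<subseteq> path_image p"
    by (simp add: pathstart_in_path_image pathfinish_in_path_image)
  have drK: "drawing K \<subseteq> (path_image p \<union> path_image r) \<union> inside (path_image p \<union> path_image r)"
  proof -
    have "set vs \<subseteq> \<Union>(set es)" using path_verts_in_edges[OF P ne] ends_sub by blast
    then have "drawing K \<subseteq> drawing H \<union> path_image p" unfolding drawing_def VK EK im by blast
    moreover have "path_image q \<subseteq> inside (path_image p \<union> path_image r) \<union> path_image p"
      using ts(2) ends_in by blast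
    moreover have "inside (path_image q \<union> path_image r) \<subseteq> inside (path_image p \<union> path_image r)"
      using ts(2) by blast
    ultimately show ?thesis using drH by blast
  qed
  have inK: "infinite_face K = outside (path_image p \<union> path_image r)"
    unfolding infinite_face_def
  proof (rule outside_filled[OF jordan_pair(5,6)[OF apr] _ drK])
    show "path_image p \<union> path_image r \<subseteq> drawing K" using XK unfolding X_def by blast
  qed
  show perK: "periphery K = set es \<union> set esr"
    unfolding periphery_def
  proof (rule face_edges_eq)
    show "frontier (infinite_face K) = \<Union>(set es \<union> set esr)"
      using inK jordan_pair(10)[OF apr] UK by simp
    show "set es \<union> set esr \<subseteq> edges K" using EK per perE by blast
    show "edges K \<subseteq> edges G" using subK by (simp add: sub_drawing_def)
  qed
  show "well_drawn K" unfolding well_drawn_def perK UK using CK inK drK by blast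
  show "f \<inter> inside (\<Union>(periphery H)) = {}" using fout UH by simp
  show "inside (\<Union>(periphery H)) \<subseteq> inside (\<Union>(periphery K))"
    unfolding perK UK UH using ts(2) by blast
  show "f \<subseteq> inside (\<Union>(periphery K))" unfolding perK UK f_in using ts(2) by blast
  obtain d :: int where d: "d = 1 \<or> d = -1"
    "\<And>z. z \<in> inside (path_image p \<union> path_image r) \<Longrightarrow> winding_number p z - winding_number r z = of_int d"
    "\<And>z. z \<in> inside (path_image p \<union> path_image q) \<Longrightarrow> winding_number p z - winding_number q z = of_int d"
    "\<And>z. z \<in> inside (path_image q \<union> path_image r) \<Longrightarrow> winding_number q z - winding_number r z = of_int d"
    using theta_orientation[OF apr apq aqr nest] by blast
  show "cvec (set es \<union> set esr) e = cvec (set es \<union> set esq) e + cvec (set esq \<union> set esr) e"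
  proof -
    have "cvec (set es \<union> set esr) e = - d * (pvec col vs es e - pvec col vsr esr e)"
      by (rule cvec_pair_given[OF pr d(1) p r]) (rule d(2))
    moreover have "cvec (set es \<union> set esq) e = - d * (pvec col vs es e - pvec col vsq esq e)"
      by (rule cvec_pair_given[OF pq d(1) p q]) (rule d(3))
    moreover have "cvec (set esq \<union> set esr) e = - d * (pvec col vsq esq e - pvec col vsr esr e)"
      by (rule cvec_pair_given[OF qr d(1) q r]) (rule d(4))
    ultimately show ?thesis by (simp add: algebra_simps)
  qed
qed

text \<open>A connected set with more than one point has no isolated points, so \<open>u\<close> is
  a limit of points of the ear in the infinite face. It also belongs to the drawing, which fills at
  most the periphery and its inside; only the periphery is left.\<close>

lemma ear_ends_on_periphery:
  assumes wd: "well_drawn H" and P: "is_path G vs es" "es \<noteq> []"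
    and out: "\<Union>(set es) - {hd vs, last vs} \<subseteq> infinite_face H"
    and u: "u \<in> drawing H" "u \<in> \<Union>(set es)"
  shows "u \<in> \<Union>(periphery H)"
proof -
  obtain p q where pq: "arc_pair p q" and im: "\<Union>(periphery H) = path_image p \<union> path_image q"
  proof -
    have "periphery H \<in> cycles G" using wd by (simp add: well_drawn_def)
    from cycle_jordan[OF this] show thesis using that by blast
  qed
  let ?g = "path_image p \<union> path_image q"
  let ?U = "\<Union>(set es)"
  obtain t where t: "arc t" "path_image t = ?U" using path_arc[OF P] by blast
  have "connected ?U" using t connected_path_image[OF arc_imp_path] by metis
  moreover have "\<not> (\<exists>a. ?U = {a})" using path_not_subset_ends[OF P] by blast
  ultimately have "u islimpt ?U" using connected_imp_perfect u(2) by blast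
  moreover have "?U = (?U - {hd vs, last vs}) \<union> (?U \<inter> {hd vs, last vs})" by blast
  moreover have "finite (?U \<inter> {hd vs, last vs})" by simp
  ultimately have "u islimpt (?U - {hd vs, last vs})" by (metis islimpt_Un_finite sup_commute)
  then have "u islimpt outside ?g"
    using out wd im by (auto simp: well_drawn_def intro: islimpt_subset)
  then have "u \<in> closure (outside ?g)" by (simp add: closure_def)
  then have "u \<in> outside ?g \<union> ?g"
    using closure_Un_frontier[of "outside ?g"] jordan_pair(10)[OF pq] by simp
  moreover have "u \<in> ?g \<union> inside ?g" using u(1) wd im unfolding well_drawn_def by auto
  ultimately show ?thesis using jordan_pair(7)[OF pq] im by blast
qed

lemma cycle_split_at:
  assumes C: "C \<in> cycles G" and u: "u \<in> \<Union>C" "u \<in> verts G" and v: "v \<in> \<Union>C" "v \<in> verts G" and uv: "u \<noteq> v"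
  obtains vs1 es1 vs2 es2 where "path_pair G vs1 es1 vs2 es2" "C = set es1 \<union> set es2"
    "hd vs1 = u" "last vs1 = v"
proof -
  obtain cv ce where c: "is_cycle G cv ce" "C = set ce" using C by (auto simp: cycles_def)
  have l: "length cv = length ce" "set ce \<subseteq> edges G" using c(1) by (auto simp: is_cycle_def)
  have mem: "x \<in> set cv" if "x \<in> \<Union>C" "x \<in> verts G" for x
  proof -
    obtain e where e: "e \<in> C" "x \<in> e" using \<open>x \<in> \<Union>C\<close> by blast
    then obtain i where i: "i < length ce" "e = ce ! i" using c(2) by (auto simp: in_set_conv_nth)
    have j: "Suc i mod length ce < length ce" using i by (intro mod_less_divisor) linarith
    have "x \<in> ends G e" using e that by (simp add: ends_def)
    then have "x = cv ! i \<or> x = cv ! (Suc i mod length ce)" using c(1) i by (simp add: is_cycle_def)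
    then show ?thesis using i j l nth_mem by metis
  qed
  obtain k where k: "k < length cv" "u = cv ! k" using mem[OF u] by (auto simp: in_set_conv_nth)
  let ?cv = "rotate k cv" and ?ce = "rotate k ce"
  have rc: "is_cycle G ?cv ?ce" by (rule is_cycle_rotate[OF c(1)])
  have "?cv \<noteq> []" using k by auto
  then have hdu: "hd ?cv = u" using k by (simp add: hd_rotate_conv_nth)
  have "v \<in> set ?cv" using mem[OF v] by simp
  then obtain j where j: "j < length ?cv" "v = ?cv ! j" by (metis in_set_conv_nth)
  have "j \<noteq> 0" using j hdu uv \<open>?cv \<noteq> []\<close> by (metis hd_conv_nth)
  then have j': "0 < j" "j < length ?ce" using j l by auto
  note sp = cycle_split(1)[OF rc j']
  have "set ?ce = set (take j ?ce) \<union> set (rev (drop j ?ce))"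
    by (metis append_take_drop_id set_append set_rev)
  then have "C = set (take j ?ce) \<union> set (rev (drop j ?ce))" using c(2) by simp
  moreover have "hd (take (Suc j) ?cv) = u" using hdu by simp
  moreover have "last (take (Suc j) ?cv) = v" using j by (simp add: take_Suc_conv_app_nth)
  ultimately show thesis using that[OF sp] by blast
qed

text \<open>Gathers in one predicate what the later sections need about an ear, so that the lists
  can be chosen once. \<open>esq\<close> is the part of the old periphery covered by the ear,
  \<open>esr\<close> the part that remains.\<close>

definition ear_step :: "pgraph \<Rightarrow> pgraph \<Rightarrow> complex set \<Rightarrow> complex list \<Rightarrow> complex set list \<Rightarrow>
    complex set list \<Rightarrow> complex set list \<Rightarrow> bool" where
  "ear_step H K f vs es esq esr \<longleftrightarrow>
     is_path G vs es \<and> odd (length es) \<and> verts K = verts H \<union> set vs \<and> edges K = edges H \<union> set es \<and>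
     set vs \<inter> verts H = {hd vs, last vs} \<and> set es \<inter> edges H = {} \<and>
     \<Union>(set es) - {hd vs, last vs} \<subseteq> infinite_face H \<and> {hd vs, last vs} \<subseteq> drawing H \<and>
     periphery H = set esq \<union> set esr \<and> periphery K = set es \<union> set esr \<and> well_drawn K \<and>
     set esq \<inter> set esr = {} \<and> (\<exists>vsr. path_pair G vs es vsr esr) \<and> set es \<union> set esq \<in> cycles G \<and>
     f = inside (\<Union>(set es \<union> set esq)) \<and> frontier f = \<Union>(set es \<union> set esq) \<and>
     f \<inter> inside (\<Union>(periphery H)) = {} \<and> inside (\<Union>(periphery H)) \<subseteq> inside (\<Union>(periphery K)) \<and>
     f \<subseteq> inside (\<Union>(periphery K)) \<and>
     (\<forall>e. cvec (periphery K) e = cvec (set es \<union> set esq) e + cvec (periphery H) e)"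

lemma ex_ear_step:
  assumes subH: "sub_drawing H" and subK: "sub_drawing K" and wd: "well_drawn H"
    and ear: "ear_extension H K f"
  shows "\<exists>vs es esq esr. ear_step H K f vs es esq esr"
proof -
  obtain vs es F where e: "is_path K vs es" "odd (length es)" "verts K = verts H \<union> set vs"
    "edges K = edges H \<union> set es" "hd vs \<in> verts H" "last vs \<in> verts H"
    "\<Union>(set es) \<inter> drawing H = {hd vs, last vs}"
    "\<Union>(set es) - {hd vs, last vs} \<subseteq> infinite_face H"
    "f \<in> finite_faces K" "F \<subseteq> periphery H" "frontier f = \<Union>(set es \<union> F)"
    using ear unfolding ear_extension_def by blast
  have P: "is_path G vs es" by (rule sub_path[OF subK e(1)])
  have ne: "es \<noteq> []" using e(2) by auto
  have uv: "hd vs \<noteq> last vs" by (rule is_path_distinct_ends[OF P ne])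
  have vsne: "vs \<noteq> []" using P by (auto simp: is_path_def)
  have vsU: "set vs \<subseteq> \<Union>(set es)" using path_verts_in_edges[OF P ne] ends_sub by blast
  have vH: "set vs \<inter> verts H = {hd vs, last vs}"
  proof
    show "set vs \<inter> verts H \<subseteq> {hd vs, last vs}" using vsU e(7) unfolding drawing_def by blast
    show "{hd vs, last vs} \<subseteq> set vs \<inter> verts H" using e(5,6) vsne by simp
  qed
  have eH: "set es \<inter> edges H = {}"
  proof (rule ccontr)
    assume "\<not> ?thesis"
    then obtain x where x: "x \<in> set es" "x \<in> edges H" by blast
    then have "x \<subseteq> {hd vs, last vs}" using e(7) unfolding drawing_def by blast
    then have "finite x" using finite_subset by blast
    moreover have "x \<in> edges G" using P x by (auto simp: is_path_def)
    ultimately show False using edge_infinite by blast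
  qed
  have perE: "periphery H \<subseteq> edges H" by (auto simp: periphery_def face_edges_def)
  have C: "periphery H \<in> cycles G" using wd by (simp add: well_drawn_def)
  have uU: "hd vs \<in> \<Union>(set es)" "last vs \<in> \<Union>(set es)" using vsU vsne hd_in_set last_in_set by blast+
  have uD: "hd vs \<in> drawing H" "last vs \<in> drawing H" using e(5,6) by (auto simp: drawing_def)
  have sV: "verts H \<subseteq> verts G" using subH by (simp add: sub_drawing_def)
  obtain v1 e1 v2 e2 where s: "path_pair G v1 e1 v2 e2" "periphery H = set e1 \<union> set e2"
    "hd v1 = hd vs" "last v1 = last vs"
    using cycle_split_at[OF C ear_ends_on_periphery[OF wd P ne e(8) uD(1) uU(1)] _
        ear_ends_on_periphery[OF wd P ne e(8) uD(2) uU(2)] _ uv] e(5,6) sV by blast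
  have pairP: "path_pair G vs es va ea"
    if q: "is_path G va ea" "ea \<noteq> []" "set ea \<subseteq> periphery H" "hd va = hd vs" "last va = last vs" for va ea
  proof -
    have "set va \<subseteq> verts H"
    proof
      fix x assume "x \<in> set va"
      then obtain y where "y \<in> set ea" "x \<in> ends G y" using path_verts_in_edges[OF q(1,2)] by blast
      then show "x \<in> verts H" using q(3) perE subH unfolding sub_drawing_def by blast
    qed
    moreover have "va \<noteq> []" using q(1) by (auto simp: is_path_def)
    then have "{hd vs, last vs} \<subseteq> set va" using q(4,5) hd_in_set[of va] last_in_set[of va] by simp
    ultimately have "set vs \<inter> set va = {hd vs, last vs}" using vH by blast
    moreover have "set es \<inter> set ea = {}" using q(3) perE eH by blast
    ultimately show ?thesis using P ne q by (simp add: path_pair_def)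
  qed
  have s': "is_path G v1 e1" "is_path G v2 e2" "e1 \<noteq> []" "e2 \<noteq> []" "hd v2 = hd vs" "last v2 = last vs"
    "set e1 \<inter> set e2 = {}"
    using s by (auto simp: path_pair_def)
  have p1: "path_pair G vs es v1 e1" using s s' by (intro pairP) auto
  have p2: "path_pair G vs es v2 e2" using s s' by (intro pairP) auto
  obtain p where p: "traces p vs es" using ex_traces[OF p1] by blast
  obtain a1 where a1: "traces a1 v1 e1" using ex_traces[OF s(1)] by blast
  obtain a2 where a2: "traces a2 v2 e2" using ex_traces[OF path_pair_sym[OF s(1)]] by blast
  have im: "path_image p = \<Union>(set es)" "path_image a1 = \<Union>(set e1)" "path_image a2 = \<Union>(set e2)"
    using p a1 a2 by (auto simp: traces_def)
  have UH: "\<Union>(periphery H) = path_image a1 \<union> path_image a2" using s(2) im by auto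
  have a12: "arc_pair a1 a2" by (rule traces_arc_pair[OF s(1) a1 a2])
  have "path_image p \<inter> inside (path_image a1 \<union> path_image a2) = {}"
  proof -
    have "path_image p - {hd vs, last vs} \<subseteq> outside (path_image a1 \<union> path_image a2)"
      using e(8) wd im(1) UH by (simp add: well_drawn_def)
    moreover have "{hd vs, last vs} \<subseteq> path_image a1"
      using a1 s(3,4) pathstart_in_path_image[of a1] pathfinish_in_path_image[of a1]
      by (simp add: traces_def)
    ultimately show ?thesis
      using jordan_pair(7)[OF a12] inside_no_overlap[of "path_image a1 \<union> path_image a2"] by blast
  qed
  \<comment> \<open>The decomposition does not tell which of the two arcs of the old periphery is
    covered by the ear. \<open>theta_nested\<close> leaves both cases open, and the covered arc is
    called \<open>q\<close>.\<close>
  from theta_nested[OF traces_arc_pair[OF p1 p a1] traces_arc_pair[OF p2 p a2] a12 this]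
  obtain vq eq vr er q r where w: "path_pair G vs es vq eq" "path_pair G vs es vr er"
    "path_pair G vq eq vr er" "periphery H = set eq \<union> set er" "traces q vq eq" "traces r vr er"
    "path_image q \<inter> inside (path_image p \<union> path_image r) \<noteq> {}"
  proof
    assume "path_image a1 \<inter> inside (path_image p \<union> path_image a2) \<noteq> {}"
    then show thesis using that[OF p1 p2 s(1) s(2) a1 a2] by blast
  next
    assume "path_image a2 \<inter> inside (path_image p \<union> path_image a1) \<noteq> {}"
    moreover have "periphery H = set e2 \<union> set e1" using s(2) by blast
    ultimately show thesis using that[OF p2 p1 path_pair_sym[OF s(1)] _ a2 a1] by blast
  qed
  note en = ear_nested[OF subH subK wd P e(3,4,8,9,11,10) w(1,2,3,4) p w(5,6,7)]
  have CQ: "set es \<union> set eq \<in> cycles G"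
    by (rule path_pair_union_cycle[OF w(1)])
  have UQ: "\<Union>(set es \<union> set eq) = path_image p \<union> path_image q"
    using im w(5) by (auto simp: traces_def)
  have "frontier f = \<Union>(set es \<union> set eq)"
    unfolding en(3) UQ by (rule jordan_pair(9)[OF traces_arc_pair[OF w(1) p w(5)]])
  moreover have "set eq \<inter> set er = {}" using w(3) by (simp add: path_pair_def)
  moreover have "{hd vs, last vs} \<subseteq> drawing H" using uD by blast
  moreover have "\<forall>e. cvec (periphery K) e = cvec (set es \<union> set eq) e + cvec (periphery H) e"
    unfolding en(1) w(4) using en(7) by blast
  ultimately have "ear_step H K f vs es eq er"
    unfolding ear_step_def using P e(2,3,4,8) vH eH w(2,4) CQ en(1-6) by blast
  then show ?thesis by blast
qed

lemma first_cycle_drawn: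
  assumes sub: "sub_drawing K" and fc: "first_cycle K f"
  obtains e vs es where "is_path G vs es" "odd (length es)" "e \<notin> set es" "ends G e = {hd vs, last vs}"
    "verts K = set vs" "edges K = insert e (set es)" "edges K \<in> cycles G" "periphery K = edges K"
    "well_drawn K" "f = inside (\<Union>(edges K))" "frontier f = \<Union>(edges K)"
proof -
  obtain e vs es where p: "is_path K vs es" "odd (length es)" "e \<notin> set es" "ends K e = {hd vs, last vs}"
    "verts K = set vs" "edges K = insert e (set es)" and f: "f \<in> finite_faces K" "frontier f = \<Union>(edges K)"
    using fc unfolding first_cycle_def by blast
  have P: "is_path G vs es" by (rule sub_path[OF sub p(1)])
  have ne: "es \<noteq> []" using p(2) by auto
  have eG: "ends G e = {hd vs, last vs}" using sub_ends[OF sub, of e] p(4,6) by simp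
  have EG: "edges K \<subseteq> edges G" using sub by (simp add: sub_drawing_def)
  have vsne: "vs \<noteq> []" using P by (auto simp: is_path_def)
  have uv: "hd vs \<noteq> last vs" by (rule is_path_distinct_ends[OF P ne])
  have mem: "hd vs \<in> set vs" "last vs \<in> set vs" using vsne by auto
  have pp: "path_pair G [hd vs, last vs] [e] vs es"
    unfolding path_pair_def
  proof (intro conjI)
    have "set vs \<subseteq> verts G" using P by (simp add: is_path_def)
    then show "is_path G [hd vs, last vs] [e]"
      using uv eG p(6) EG mem by (auto simp: is_path_def)
    show "set [hd vs, last vs] \<inter> set vs = {hd [hd vs, last vs], last [hd vs, last vs]}" using mem by auto
  qed (use P ne p(3) in auto)
  have "set ([e] @ rev es) \<in> cycles G" using path_pair_cycle(1)[OF pp] unfolding cycles_def by blast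
  then have C: "edges K \<in> cycles G" using p(6) by simp
  obtain q r where qr: "arc_pair q r" "\<Union>(edges K) = path_image q \<union> path_image r" using cycle_jordan[OF C] .
  note J = jordan_pair[OF qr(1), folded qr(2)]
  have dr: "drawing K = \<Union>(edges K)"
    using path_verts_in_edges[OF P ne] ends_sub p(5,6) unfolding drawing_def by blast
  have fc: "f \<in> components (- \<Union>(edges K))" "bounded f" using f(1) dr by (auto simp: finite_faces_def)
  have fs: "f \<subseteq> - \<Union>(edges K)" "f \<noteq> {}" using in_components_subset in_components_nonempty fc(1) by blast+
  have "f \<inter> outside (\<Union>(edges K)) = {}"
  proof (rule ccontr)
    assume "\<not> ?thesis"
    then have "outside (\<Union>(edges K)) \<subseteq> f"
      using components_maximal[OF fc(1) J(5)] outside_no_overlap[of "\<Union>(edges K)"] by blast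
    then show False using J(6) fc(2) bounded_subset by blast
  qed
  then have "f \<subseteq> inside (\<Union>(edges K))" using fs(1) J(8) by blast
  moreover from this have "inside (\<Union>(edges K)) \<subseteq> f"
    using components_maximal[OF fc(1) J(3)] inside_no_overlap[of "\<Union>(edges K)"] fs(2) by blast
  ultimately have fi: "f = inside (\<Union>(edges K))" by blast
  have per: "periphery K = edges K"
    unfolding periphery_def infinite_face_def dr by (rule face_edges_eq[OF J(10) _ EG]) simp
  have "well_drawn K"
    unfolding well_drawn_def per infinite_face_def dr using C by blast
  then show thesis using that P p(2,3) eG p(5,6) C per fi f(2) by blast
qed

end

section \<open>Reducible face decompositions\<close>

context plane_bip
begin

text \<open>A path edge already has two ends in \<open>K\<close>, and no more than two in
  \<open>G\<close>, so no further vertex of \<open>G\<close> lies on it.\<close>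

lemma sub_path_ends:
  assumes "verts K \<subseteq> verts G" "set es \<subseteq> edges G" "is_path K vs es" "e \<in> set es"
  shows "ends G e \<subseteq> verts K"
proof -
  obtain i where i: "i < length es" "e = es ! i" using assms(4) by (auto simp: in_set_conv_nth)
  have "ends K e = {vs ! i, vs ! Suc i}" "vs ! i \<noteq> vs ! Suc i"
    using assms(3) i by (auto simp: is_path_def nth_eq_iff_index_eq)
  then have "card (ends K e) = 2" by simp
  moreover have "e \<in> edges G" using assms by blast
  then have "finite (ends G e)" "card (ends G e) \<le> 2"
    using earc(3)[of e] by (auto simp: card_insert_if)
  moreover have "ends K e \<subseteq> ends G e" using assms(1) by (auto simp: ends_def)
  ultimately have "ends K e = ends G e" by (metis card_seteq)
  then show ?thesis by (auto simp: ends_def)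
qed

lemma ear_stepD:
  assumes "ear_step H K f vs es esq esr"
  shows "is_path G vs es"
    "odd (length es)"
    "verts K = verts H \<union> set vs"
    "edges K = edges H \<union> set es"
    "set vs \<inter> verts H = {hd vs, last vs}"
    "set es \<inter> edges H = {}"
    "\<Union>(set es) - {hd vs, last vs} \<subseteq> infinite_face H"
    "{hd vs, last vs} \<subseteq> drawing H"
    "periphery H = set esq \<union> set esr"
    "periphery K = set es \<union> set esr"
    "well_drawn K"
    "set esq \<inter> set esr = {}"
    "\<exists>vsr. path_pair G vs es vsr esr"
    "set es \<union> set esq \<in> cycles G"
    "f = inside (\<Union>(set es \<union> set esq))"
    "frontier f = \<Union>(set es \<union> set esq)"
    "f \<inter> inside (\<Union>(periphery H)) = {}"
    "inside (\<Union>(periphery H)) \<subseteq> inside (\<Union>(periphery K))"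
    "f \<subseteq> inside (\<Union>(periphery K))"
    "\<forall>e. cvec (periphery K) e = cvec (set es \<union> set esq) e + cvec (periphery H) e"
  by (insert assms, unfold ear_step_def, elim conjE, assumption)+

lemma matching_balanced:
  assumes "M \<in> perfect_matchings G"
  shows "balanced (ends G) 1 (verts G) (edges G) (\<lambda>e. of_bool (e \<in> M))"
  unfolding balanced_def
proof (intro conjI ballI allI impI)
  fix e assume "e \<notin> edges G"
  then show "of_bool (e \<in> M) = (0::int)" using assms by (auto simp: perfect_matchings_def)
next
  fix v assume v: "v \<in> verts G"
  obtain e where e: "e \<in> M" "v \<in> ends G e" "\<And>e'. e' \<in> M \<Longrightarrow> v \<in> ends G e' \<Longrightarrow> e' = e"
    using matching_edge[OF assms v] by blast
  have "e \<in> edges G" using e(1) assms by (auto simp: perfect_matchings_def)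
  have "(\<Sum>f | f \<in> edges G \<and> v \<in> ends G f. of_bool (f \<in> M)) =
      (\<Sum>f | f \<in> edges G \<and> v \<in> ends G f. if f = e then 1 else (0::int))"
    using e(1) e(3) by (intro sum.cong refl) (auto simp: of_bool_def)
  also have "\<dots> = 1" using \<open>e \<in> edges G\<close> e(2) finite_edges by (simp add: sum.delta)
  finally have "(\<Sum>f | f \<in> edges G \<and> v \<in> ends G f. of_bool (f \<in> M)) = (1::int)" .
  then show "(\<Sum>f | f \<in> edges G \<and> v \<in> ends G f. of_bool (f \<in> M)) = (1::int)" by simp
qed

lemma balanced_matching:
  assumes b: "balanced (ends G) 1 (verts G) (edges G) m" and m: "\<And>e. m e \<in> {0, 1}"
  shows "{e. m e = 1} \<in> perfect_matchings G"
  unfolding perfect_matchings_def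
proof (intro CollectI conjI ballI)
  show "{e. m e = 1} \<subseteq> edges G" using b unfolding balanced_def by force
  fix v assume v: "v \<in> verts G"
  let ?A = "{e. e \<in> edges G \<and> v \<in> ends G e}"
  have "(\<Sum>e\<in>?A. m e) = (\<Sum>e\<in>{e\<in>?A. m e = 1}. 1)"
    using m finite_edges by (intro sum.mono_neutral_cong_right) auto
  then have "int (card {e\<in>?A. m e = 1}) = 1" using b v by (simp add: balanced_def)
  then obtain e where e: "{e\<in>?A. m e = 1} = {e}" by (metis card_1_singletonE of_nat_eq_1_iff)
  have "e' \<in> edges G" if "m e' = 1" for e' using b that unfolding balanced_def by force
  then show "\<exists>!e. e \<in> {e. m e = 1} \<and> v \<in> ends G e"
    using e by (intro ex1I[of _ e]) blast+
qed

end

locale rfd_graph = plane_bip +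
  fixes n :: nat and Gs :: "nat \<Rightarrow> pgraph" and s :: "nat \<Rightarrow> complex set"
  assumes rfd: "RFD G n Gs s"
begin

lemma n1: "1 \<le> n" and first: "first_cycle (Gs 1) (s 1)" and Gn: "Gs n = G"
  using rfd by (simp_all add: RFD_def)

lemma ear:
  assumes "1 \<le> i" "i < n" shows "ear_extension (Gs i) (Gs (Suc i)) (s (Suc i))"
proof -
  have "Suc i \<in> {2..n}" using assms by simp
  then have "ear_extension (Gs (Suc i - 1)) (Gs (Suc i)) (s (Suc i))"
    using rfd unfolding RFD_def by blast
  then show ?thesis by simp
qed

text \<open>An ear extension only compares a graph with its successor, and the last graph is
  \<open>G\<close>, so the induction runs downwards.\<close>

lemma Gs_sub: "1 \<le> i \<Longrightarrow> i \<le> n \<Longrightarrow> verts (Gs i) \<subseteq> verts G \<and> edges (Gs i) \<subseteq> edges G"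
proof (induction "n - i" arbitrary: i)
  case 0
  then have "i = n" by simp
  then show ?case using Gn by simp
next
  case (Suc k)
  then have "verts (Gs (Suc i)) \<subseteq> verts G \<and> edges (Gs (Suc i)) \<subseteq> edges G" by auto
  moreover have "ear_extension (Gs i) (Gs (Suc i)) (s (Suc i))" using ear Suc by auto
  ultimately show ?case unfolding ear_extension_def by blast
qed

lemma sub: "1 \<le> i \<Longrightarrow> i \<le> n \<Longrightarrow> sub_drawing (Gs i)"
proof (induction i)
  case (Suc i)
  note g = Gs_sub[OF Suc.prems]
  show ?case
  proof (cases "i = 0")
    case True
    obtain e vs es where p: "is_path (Gs 1) vs es" "ends (Gs 1) e = {hd vs, last vs}" "odd (length es)"
      "verts (Gs 1) = set vs" "edges (Gs 1) = insert e (set es)"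
      using first unfolding first_cycle_def by blast
    have l: "length vs = Suc (length es)" "distinct vs" "es \<noteq> []" using p(1,3) by (auto simp: is_path_def)
    have hl: "hd vs \<noteq> last vs" using l by (cases vs) auto
    have "ends G f \<subseteq> verts (Gs 1)" if f: "f \<in> edges (Gs 1)" for f
    proof (cases "f = e")
      case False
      then show ?thesis using sub_path_ends[of "Gs 1" es vs f] p g f True by auto
    next
      case fe: True
      have "card (ends (Gs 1) e) = 2" using p(2) hl by simp
      moreover have eE: "e \<in> edges G" using p(5) g True by auto
      then have "finite (ends G e)" "card (ends G e) \<le> 2"
        using earc(3)[of e] by (auto simp: card_insert_if)
      moreover have "ends (Gs 1) e \<subseteq> ends G e" using g True by (auto simp: ends_def)
      ultimately have "ends (Gs 1) e = ends G e" by (metis card_seteq)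
      then show ?thesis using fe by (auto simp: ends_def)
    qed
    then show ?thesis using g True by (simp add: sub_drawing_def)
  next
    case False
    then have IH: "sub_drawing (Gs i)" using Suc by auto
    obtain vs es where p: "is_path (Gs (Suc i)) vs es" "verts (Gs (Suc i)) = verts (Gs i) \<union> set vs"
      "edges (Gs (Suc i)) = edges (Gs i) \<union> set es"
      using ear[of i] False Suc.prems unfolding ear_extension_def by auto
    have "ends G f \<subseteq> verts (Gs (Suc i))" if f: "f \<in> edges (Gs (Suc i))" for f
    proof (cases "f \<in> set es")
      case True
      then show ?thesis using sub_path_ends[of "Gs (Suc i)" es vs f] p g by auto
    next
      case False
      then show ?thesis using IH f p unfolding sub_drawing_def by blast
    qed
    then show ?thesis using g by (simp add: sub_drawing_def)
  qed
qed simp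

lemma sub1: "sub_drawing (Gs 1)"
  using sub n1 by simp

lemma first_facts:
  "edges (Gs 1) \<in> cycles G" "periphery (Gs 1) = edges (Gs 1)" "well_drawn (Gs 1)"
  "s 1 = inside (\<Union>(edges (Gs 1)))" "frontier (s 1) = \<Union>(edges (Gs 1))"
  by (rule first_cycle_drawn[OF sub1 first]; assumption)+

lemma drawn: "1 \<le> i \<Longrightarrow> i \<le> n \<Longrightarrow> well_drawn (Gs i)"
proof (induction i)
  case (Suc i)
  show ?case
  proof (cases "i = 0")
    case True
    then show ?thesis using first_facts(3) by simp
  next
    case False
    then have "well_drawn (Gs i)" "sub_drawing (Gs i)" "sub_drawing (Gs (Suc i))"
      "ear_extension (Gs i) (Gs (Suc i)) (s (Suc i))" using Suc sub ear by auto
    then show ?thesis using ex_ear_step ear_stepD(11) by blast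
  qed
qed simp

lemma ex_step:
  assumes "1 \<le> i" "i < n"
  shows "\<exists>vs es esq esr. ear_step (Gs i) (Gs (Suc i)) (s (Suc i)) vs es esq esr"
  using assms sub drawn ear by (intro ex_ear_step) auto

text \<open>The choices are made for all steps at once because \<open>ear_system\<close> takes
  functions of the step as parameters. Entry \<open>Suc i\<close> belongs to the step from
  \<open>Gs i\<close> to \<open>Gs (Suc i)\<close>; the first cycle has its own data.\<close>

definition handle_data where
  "handle_data = (SOME F. \<forall>i. 1 \<le> i \<and> i < n \<longrightarrow>
     ear_step (Gs i) (Gs (Suc i)) (s (Suc i)) (fst (F (Suc i))) (fst (snd (F (Suc i))))
       (fst (snd (snd (F (Suc i))))) (snd (snd (snd (F (Suc i))))))"

definition first_data where
  "first_data = (SOME (e, vs, es). is_path G vs es \<and> odd (length es) \<and> e \<notin> set es \<and>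
     ends G e = {hd vs, last vs} \<and> verts (Gs 1) = set vs \<and> edges (Gs 1) = insert e (set es))"

definition pv :: "nat \<Rightarrow> complex list" where
  "pv i = (if i = 1 then fst (snd first_data) else fst (handle_data i))"
definition pe :: "nat \<Rightarrow> complex set list" where
  "pe i = (if i = 1 then snd (snd first_data) else fst (snd (handle_data i)))"
definition pq :: "nat \<Rightarrow> complex set list" where
  "pq i = fst (snd (snd (handle_data i)))"
definition pr :: "nat \<Rightarrow> complex set list" where
  "pr i = snd (snd (snd (handle_data i)))"
definition closing :: "complex set" where
  "closing = fst first_data"

lemma step:
  assumes "1 \<le> i" "i < n"
  shows "ear_step (Gs i) (Gs (Suc i)) (s (Suc i)) (pv (Suc i)) (pe (Suc i)) (pq (Suc i)) (pr (Suc i))"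
proof -
  have "\<forall>i. \<exists>d. 1 \<le> i \<and> i < n \<longrightarrow> ear_step (Gs i) (Gs (Suc i)) (s (Suc i)) (fst d) (fst (snd d))
       (fst (snd (snd d))) (snd (snd (snd d)))"
    using ex_step by (metis fst_conv snd_conv)
  then obtain f where f: "\<And>i. 1 \<le> i \<and> i < n \<longrightarrow> ear_step (Gs i) (Gs (Suc i)) (s (Suc i)) (fst (f i)) (fst (snd (f i)))
       (fst (snd (snd (f i)))) (snd (snd (snd (f i))))" by metis
  have "\<exists>F. \<forall>i. 1 \<le> i \<and> i < n \<longrightarrow>
     ear_step (Gs i) (Gs (Suc i)) (s (Suc i)) (fst (F (Suc i))) (fst (snd (F (Suc i))))
       (fst (snd (snd (F (Suc i))))) (snd (snd (snd (F (Suc i)))))"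
    using f by (intro exI[of _ "\<lambda>i. f (i - 1)"]) simp
  from someI_ex[OF this, folded handle_data_def] show ?thesis
    using assms by (simp add: pv_def pe_def pq_def pr_def)
qed

lemma step':
  "1 < j \<Longrightarrow> j \<le> n \<Longrightarrow> ear_step (Gs (j - 1)) (Gs j) (s j) (pv j) (pe j) (pq j) (pr j)"
  using step[of "j - 1"] by simp

lemma first_step:
  "is_path G (pv 1) (pe 1)" "odd (length (pe 1))" "closing \<notin> set (pe 1)"
  "ends G closing = {hd (pv 1), last (pv 1)}" "verts (Gs 1) = set (pv 1)"
  "edges (Gs 1) = insert closing (set (pe 1))"
proof -
  obtain e vs es where "is_path G vs es" "odd (length es)" "e \<notin> set es" "ends G e = {hd vs, last vs}"
    "verts (Gs 1) = set vs" "edges (Gs 1) = insert e (set es)"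
    by (rule first_cycle_drawn[OF sub1 first]) blast
  then have "\<exists>d. case d of (e, vs, es) \<Rightarrow> is_path G vs es \<and> odd (length es) \<and> e \<notin> set es \<and>
     ends G e = {hd vs, last vs} \<and> verts (Gs 1) = set vs \<and> edges (Gs 1) = insert e (set es)"
    by (intro exI[of _ "(e, vs, es)"]) simp
  from someI_ex[OF this, folded first_data_def]
  show "is_path G (pv 1) (pe 1)" "odd (length (pe 1))" "closing \<notin> set (pe 1)"
  "ends G closing = {hd (pv 1), last (pv 1)}" "verts (Gs 1) = set (pv 1)"
  "edges (Gs 1) = insert closing (set (pe 1))"
    by (simp_all add: pv_def pe_def closing_def case_prod_beta)
qed

text \<open>The boundary is taken in the final graph; \<open>face_edges_Gs\<close> shows that every
  earlier graph that has the face gives the same edges.\<close>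

definition bd :: "nat \<Rightarrow> complex set set" where
  "bd j = face_edges G (s j)"

lemma face_frontier:
  assumes "1 \<le> j" "j \<le> n"
  shows "frontier (s j) = \<Union>(bd j)" "bd j \<subseteq> edges (Gs j)" "bd j \<in> cycles G"
    "s j = inside (\<Union>(bd j))" "s j \<inter> drawing (Gs j) = {}" "s j \<subseteq> inside (\<Union>(periphery (Gs j)))"
    "1 < j \<Longrightarrow> bd j = set (pe j) \<union> set (pq j)" "j = 1 \<Longrightarrow> bd j = edges (Gs 1)"
proof -
  have sj: "s j \<in> finite_faces (Gs j)"
  proof (cases "j = 1")
    case True
    then show ?thesis using first unfolding first_cycle_def by blast
  next
    case False
    then have "ear_extension (Gs (j - 1)) (Gs j) (s j)" using ear[of "j - 1"] assms by simp
    then show ?thesis unfolding ear_extension_def by blast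
  qed
  then show "s j \<inter> drawing (Gs j) = {}" unfolding finite_faces_def using in_components_subset by blast
  show *: "1 < j \<Longrightarrow> bd j = set (pe j) \<union> set (pq j)" "j = 1 \<Longrightarrow> bd j = edges (Gs 1)"
  proof -
    show "bd j = edges (Gs 1)" if "j = 1"
      unfolding bd_def that using first_facts(5) Gs_sub[of 1] n1 by (intro face_edges_eq) simp_all
    assume j: "1 < j"
    then have st: "ear_step (Gs (j - 1)) (Gs j) (s j) (pv j) (pe j) (pq j) (pr j)"
      using step'[of j] assms by auto
    note sd = ear_stepD[OF st]
    have per: "periphery (Gs (j - 1)) \<subseteq> edges (Gs (j - 1))" by (auto simp: periphery_def face_edges_def)
    have "edges (Gs j) \<subseteq> edges G" using Gs_sub[OF assms] by blast
    then have "set (pe j) \<union> set (pq j) \<subseteq> edges G" using sd(4,9) per by blast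
    then show "bd j = set (pe j) \<union> set (pq j)"
      unfolding bd_def by (rule face_edges_eq[OF sd(16)]) simp
  qed
  have "frontier (s j) = \<Union>(bd j) \<and> bd j \<subseteq> edges (Gs j) \<and> bd j \<in> cycles G \<and>
    s j = inside (\<Union>(bd j)) \<and> s j \<subseteq> inside (\<Union>(periphery (Gs j)))"
  proof (cases "j = 1")
    case True
    then show ?thesis using *(2) first_facts by simp
  next
    case False
    then have st: "ear_step (Gs (j - 1)) (Gs j) (s j) (pv j) (pe j) (pq j) (pr j)"
      using step'[of j] assms by auto
    have per: "periphery (Gs (j - 1)) \<subseteq> edges (Gs (j - 1))" by (auto simp: periphery_def face_edges_def)
    have b: "bd j = set (pe j) \<union> set (pq j)" using *(1) False assms by simp
    note sd = ear_stepD[OF st]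
    have "set (pe j) \<union> set (pq j) \<subseteq> edges (Gs j)" using sd(4,9) per by blast
    then show ?thesis unfolding b using sd(14,15,16,19) by blast
  qed
  then show "frontier (s j) = \<Union>(bd j)" "bd j \<subseteq> edges (Gs j)" "bd j \<in> cycles G"
    "s j = inside (\<Union>(bd j))" "s j \<subseteq> inside (\<Union>(periphery (Gs j)))" by auto
qed

lemma Gs_mono: "1 \<le> i \<Longrightarrow> i \<le> j \<Longrightarrow> j \<le> n \<Longrightarrow> edges (Gs i) \<subseteq> edges (Gs j)"
proof (induction j)
  case (Suc j)
  show ?case
  proof (cases "i = Suc j")
    case False
    then have "edges (Gs i) \<subseteq> edges (Gs j)" using Suc by auto
    moreover have "edges (Gs (Suc j)) = edges (Gs j) \<union> set (pe (Suc j))"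
      using ear_stepD(4)[OF step[of j]] Suc.prems False by simp
    ultimately show ?thesis by blast
  qed simp
qed simp

text \<open>Later ears run through the infinite face of the current graph, while \<open>s j\<close>
  is inside its periphery; so no later ear enters it.\<close>

lemma face_persists:
  "1 \<le> j \<Longrightarrow> j \<le> i \<Longrightarrow> i \<le> n \<Longrightarrow> s j \<inter> drawing (Gs i) = {} \<and> s j \<subseteq> inside (\<Union>(periphery (Gs i)))"
proof (induction i)
  case (Suc i)
  show ?case
  proof (cases "j = Suc i")
    case True
    then show ?thesis using face_frontier[of j] Suc.prems by auto
  next
    case False
    then have IH: "s j \<inter> drawing (Gs i) = {}" "s j \<subseteq> inside (\<Union>(periphery (Gs i)))"
      and i: "1 \<le> i" "i < n" using Suc by auto
    note st = step[OF i]
    let ?vs = "pv (Suc i)" and ?es = "pe (Suc i)"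
    note sd = ear_stepD[OF st]
    have P: "is_path G ?vs ?es" "?es \<noteq> []" using sd(1,2) by auto
    have "set ?vs \<subseteq> \<Union>(set ?es)" using path_verts_in_edges[OF P] ends_sub by blast
    then have dr: "drawing (Gs (Suc i)) \<subseteq> drawing (Gs i) \<union> \<Union>(set ?es)"
      unfolding drawing_def sd(3,4) by blast
    have "infinite_face (Gs i) = outside (\<Union>(periphery (Gs i)))" using drawn[of i] i by (simp add: well_drawn_def)
    then have "\<Union>(set ?es) \<subseteq> outside (\<Union>(periphery (Gs i))) \<union> drawing (Gs i)"
      using sd(7,8) by blast
    then have "s j \<inter> drawing (Gs (Suc i)) = {}"
      using dr IH inside_Int_outside[of "\<Union>(periphery (Gs i))"] by blast
    moreover have "inside (\<Union>(periphery (Gs i))) \<subseteq> inside (\<Union>(periphery (Gs (Suc i))))"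
      by (rule sd(18))
    ultimately show ?thesis using IH by blast
  qed
qed simp

lemma faces_disjoint:
  assumes "1 \<le> j" "j < k" "k \<le> n" shows "s j \<inter> s k = {}"
proof -
  have "ear_step (Gs (k - 1)) (Gs k) (s k) (pv k) (pe k) (pq k) (pr k)" using step'[of k] assms by simp
  then have "s k \<inter> inside (\<Union>(periphery (Gs (k - 1)))) = {}"
    by (rule ear_stepD(17))
  moreover have "s j \<subseteq> inside (\<Union>(periphery (Gs (k - 1))))" using face_persists[of j "k - 1"] assms by auto
  ultimately show ?thesis by blast
qed

lemma face_nonempty:
  assumes "1 \<le> j" "j \<le> n" shows "s j \<noteq> {}" "connected (s j)" "bounded (s j)"
proof -
  obtain p q where "arc_pair p q" "\<Union>(bd j) = path_image p \<union> path_image q"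
    using cycle_jordan[OF face_frontier(3)[OF assms]] .
  then show "s j \<noteq> {}" "connected (s j)" "bounded (s j)"
    using jordan_pair[of p q] face_frontier(4)[OF assms] by auto
qed

text \<open>Hence the membership test in \<open>adjacent_digits_eq\<close> is passed by all indices
  from 1 to \<open>i\<close>.\<close>

lemma face_in_finite_faces:
  assumes "1 \<le> j" "j \<le> i" "i \<le> n" shows "s j \<in> finite_faces (Gs i)"
proof -
  have j: "j \<le> n" using assms by simp
  have "\<Union>(bd j) \<subseteq> drawing (Gs i)"
    using face_frontier(2)[OF assms(1) j] Gs_mono[OF assms] by (auto simp: drawing_def)
  then have "s j \<in> components (- drawing (Gs i))"
    using face_nonempty[OF assms(1) j] face_persists[OF assms] face_frontier(1)[OF assms(1) j]
    by (intro frontier_component) auto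
  then show ?thesis using face_nonempty[OF assms(1) j] by (simp add: finite_faces_def)
qed

lemma face_edges_Gs:
  assumes "1 \<le> j" "j \<le> i" "i \<le> n" shows "face_edges (Gs i) (s j) = bd j"
proof (rule face_edges_eq)
  have j: "j \<le> n" using assms by simp
  show "frontier (s j) = \<Union>(bd j)" by (rule face_frontier(1)[OF assms(1) j])
  show "bd j \<subseteq> edges (Gs i)" using face_frontier(2)[OF assms(1) j] Gs_mono[OF assms] by blast
  show "edges (Gs i) \<subseteq> edges G" using Gs_sub assms by auto
qed

section \<open>The decomposition as a sequence of ears\<close>

definition Vs :: "nat \<Rightarrow> complex set" where "Vs i = (if i = 0 then {} else verts (Gs i))"
definition Es :: "nat \<Rightarrow> complex set set" where "Es i = (if i = 0 then {} else edges (Gs i))"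
definition P0 :: "nat \<Rightarrow> complex set set" where
  "P0 i = odd_edges (pe i) \<union> (if i = 1 then {closing} else {})"
definition P1 :: "nat \<Rightarrow> complex set set" where "P1 i = even_edges (pe i)"
definition T :: "nat \<Rightarrow> complex set" where "T i = {hd (pv i), last (pv i)}"
definition D :: "nat \<Rightarrow> complex set \<Rightarrow> int" where "D j = cvec (bd j)"

lemma sum_D:
  "1 \<le> i \<Longrightarrow> i \<le> n \<Longrightarrow> (\<Sum>j=1..i. D j e) = cvec (periphery (Gs i)) e"
proof (induction i)
  case (Suc i)
  show ?case
  proof (cases "i = 0")
    case True
    then show ?thesis using first_facts(2) face_frontier(8)[of 1] n1 by (simp add: D_def)
  next
    case False
    then have i: "1 \<le> i" "i < n" using Suc.prems by auto
    have "cvec (periphery (Gs (Suc i))) e = D (Suc i) e + cvec (periphery (Gs i)) e"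
      using ear_stepD(20)[OF step[OF i]] face_frontier(7)[of "Suc i"] i unfolding D_def by simp
    then show ?thesis using Suc.IH i by simp
  qed
qed simp

lemma D_balanced_Es:
  assumes "i < n" shows "balanced (ends G) 0 (Vs (Suc i)) (Es (Suc i)) (D (Suc i))"
proof -
  have f: "bd (Suc i) \<subseteq> edges (Gs (Suc i))" "bd (Suc i) \<in> cycles G" using face_frontier[of "Suc i"] assms by auto
  have g: "edges (Gs (Suc i)) \<subseteq> edges G" using Gs_sub[of "Suc i"] assms by auto
  have "(\<Sum>e | e \<in> edges (Gs (Suc i)) \<and> v \<in> ends G e. D (Suc i) e) =
      (\<Sum>e | e \<in> edges G \<and> v \<in> ends G e. D (Suc i) e)" for v
    using f g finite_edges cvec_abs(2) by (intro sum.mono_neutral_left) (auto simp: D_def)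
  then show ?thesis
    using cvec_balance[OF f(2)] f(1) cvec_abs(2)[of _ "bd (Suc i)"]
    by (auto simp: balanced_def Vs_def Es_def D_def subset_iff)
qed

text \<open>Brings the first cycle, as an ear of the empty graph at index 0, and all later ears into
  the single form that the combinatorial locale asks for.\<close>

lemma handle:
  assumes "i < n"
  shows "is_path G (pv (Suc i)) (pe (Suc i))" (is ?A1) "odd (length (pe (Suc i)))" (is ?A2)
    "Es (Suc i) = Es i \<union> (P0 (Suc i) \<union> P1 (Suc i))" (is ?A3) "Es i \<inter> (P0 (Suc i) \<union> P1 (Suc i)) = {}" (is ?A4)
    "P0 (Suc i) \<inter> P1 (Suc i) = {}" (is ?A5) "set (pe (Suc i)) \<subseteq> bd (Suc i)" (is ?A6) "set (pe (Suc i)) \<inter> Es i = {}" (is ?A7)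
    "balanced (ends G) b (Vs (Suc i)) (Es (Suc i)) f \<longleftrightarrow>
      (\<forall>e. e \<notin> Es (Suc i) \<longrightarrow> f e = 0) \<and>
      (\<exists>t. (\<forall>e\<in>P1 (Suc i). f e = t) \<and> (\<forall>e\<in>P0 (Suc i). f e = b - t) \<and>
         (\<forall>v\<in>Vs i. (\<Sum>e | e \<in> Es i \<and> v \<in> ends G e. f e) = b - of_bool (v \<in> T (Suc i)) * t))" (is ?A8)
proof -
  have main: "?A1 \<and> ?A2 \<and> ?A3 \<and> ?A4 \<and> ?A5 \<and> ?A6 \<and> ?A7 \<and> ?A8"
  proof (cases "i = 0")
    case True
    note fs = first_step
    have S: "Suc i = 1" using True by simp
    have V: "Vs 1 = set (pv 1)" "Es 1 = insert closing (set (pe 1))" "Vs i = {}" "Es i = {}"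
      using fs True by (simp_all add: Vs_def Es_def)
    have P: "P0 1 = insert closing (odd_edges (pe 1))" "P1 1 = even_edges (pe 1)"
      by (auto simp: P0_def P1_def)
    note eo = even_odd_edges(1)[of "pe 1"] even_odd_edges(2)[OF is_path_distinct_edges[OF fs(1)]]
    have "closing \<notin> P1 1" using fs(3) eo(1) P by blast
    moreover have "set (pe 1) \<subseteq> bd 1" using face_frontier(8)[of 1] n1 fs(6) by auto
    ultimately show ?thesis
      unfolding S V P first_cycle_balanced[OF fs(1-4)] using fs(1,2) eo P by auto
  next
    case False
    then have i: "1 \<le> i" "i < n" using assms by auto
    note st = step[OF i]
    have S: "Suc i \<noteq> 1" using i by simp
    have p: "is_path G (pv (Suc i)) (pe (Suc i))" "odd (length (pe (Suc i)))"
      "verts (Gs (Suc i)) = verts (Gs i) \<union> set (pv (Suc i))" "edges (Gs (Suc i)) = edges (Gs i) \<union> set (pe (Suc i))"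
      "set (pv (Suc i)) \<inter> verts (Gs i) = {hd (pv (Suc i)), last (pv (Suc i))}"
      "set (pe (Suc i)) \<inter> edges (Gs i) = {}" by (rule ear_stepD[OF st])+
    have V: "Vs (Suc i) = verts (Gs (Suc i))" "Es (Suc i) = edges (Gs (Suc i))" "Vs i = verts (Gs i)" "Es i = edges (Gs i)"
      using i by (simp_all add: Vs_def Es_def)
    have P: "P0 (Suc i) = odd_edges (pe (Suc i))" "P1 (Suc i) = even_edges (pe (Suc i))"
      using S by (auto simp: P0_def P1_def)
    note eo = even_odd_edges(1)[of "pe (Suc i)"] even_odd_edges(2)[OF is_path_distinct_edges[OF p(1)]]
    have pb: "set (pe (Suc i)) \<subseteq> bd (Suc i)" using face_frontier(7)[of "Suc i"] i by auto
    have fin: "finite (edges (Gs i))" using Gs_sub[of i] i finite_edges finite_subset by auto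
    have e: "\<And>e. e \<in> edges (Gs i) \<Longrightarrow> ends G e \<subseteq> verts (Gs i)" using sub[of i] i by (auto simp: sub_drawing_def)
    have "odd_edges (pe (Suc i)) \<union> even_edges (pe (Suc i)) = set (pe (Suc i))" using eo(1) by blast
    then show ?thesis
      unfolding V P T_def
    proof (intro conjI)
      show "edges (Gs (Suc i)) = edges (Gs i) \<union> (odd_edges (pe (Suc i)) \<union> even_edges (pe (Suc i)))"
        "edges (Gs i) \<inter> (odd_edges (pe (Suc i)) \<union> even_edges (pe (Suc i))) = {}"
        using p(4,6) eo(1) by blast+
      show "odd_edges (pe (Suc i)) \<inter> even_edges (pe (Suc i)) = {}" using eo(2) by blast
      show "balanced (ends G) b (verts (Gs (Suc i))) (edges (Gs (Suc i))) f \<longleftrightarrow>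
        (\<forall>e. e \<notin> edges (Gs (Suc i)) \<longrightarrow> f e = 0) \<and>
        (\<exists>t. (\<forall>e\<in>even_edges (pe (Suc i)). f e = t) \<and> (\<forall>e\<in>odd_edges (pe (Suc i)). f e = b - t) \<and>
          (\<forall>v\<in>verts (Gs i). (\<Sum>e | e \<in> edges (Gs i) \<and> v \<in> ends G e. f e) =
            b - of_bool (v \<in> {hd (pv (Suc i)), last (pv (Suc i))}) * t))"
        by (rule ear_balanced[OF p(1,2,3,5,4,6) fin e])
    qed (rule p pb)+
  qed
  show ?A1 ?A2 ?A3 ?A4 ?A5 ?A6 ?A7 ?A8
    by (insert main, elim conjE, assumption)+
qed

sublocale ear_system n "ends G" Vs Es P0 P1 T D "\<lambda>j. D j (pe j ! 0)"
proof
  show "Es 0 = {}" "Vs 0 = {}" by (simp_all add: Es_def Vs_def)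
  fix i assume i: "i < n"
  show "Es (Suc i) = Es i \<union> (P0 (Suc i) \<union> P1 (Suc i))" "Es i \<inter> (P0 (Suc i) \<union> P1 (Suc i)) = {}"
    "P0 (Suc i) \<inter> P1 (Suc i) = {}" by (rule handle[OF i])+
  have e0: "pe (Suc i) ! 0 \<in> P1 (Suc i)" unfolding P1_def by (rule ends_even_edges(1)[OF handle(2)[OF i]])
  then show "P1 (Suc i) \<noteq> {}" by blast
  show "balanced (ends G) b (Vs (Suc i)) (Es (Suc i)) f =
      ((\<forall>e. e \<notin> Es (Suc i) \<longrightarrow> f e = 0) \<and>
      (\<exists>t. (\<forall>e\<in>P1 (Suc i). f e = t) \<and> (\<forall>e\<in>P0 (Suc i). f e = b - t) \<and>
         (\<forall>v\<in>Vs i. (\<Sum>e | e \<in> Es i \<and> v \<in> ends G e. f e) = b - of_bool (v \<in> T (Suc i)) * t)))" for b f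
    by (rule handle(8)[OF i])
  show bal: "balanced (ends G) 0 (Vs (Suc i)) (Es (Suc i)) (D (Suc i))" by (rule D_balanced_Es[OF i])
  then obtain t where "\<forall>e\<in>P1 (Suc i). D (Suc i) e = t" unfolding handle(8)[OF i] by blast
  then show "D (Suc i) e = D (Suc i) (pe (Suc i) ! 0)" if "e \<in> P1 (Suc i)" for e using e0 that by simp
  have "pe (Suc i) ! 0 \<in> set (pe (Suc i))" using e0 even_odd_edges(1)[of "pe (Suc i)"] by (auto simp: P1_def)
  then have "pe (Suc i) ! 0 \<in> bd (Suc i)" using handle(6)[OF i] by blast
  then show "D (Suc i) (pe (Suc i) ! 0) = 1 \<or> D (Suc i) (pe (Suc i) ! 0) = - 1"
    unfolding D_def by (rule cvec_abs(1))
  show "D (Suc i) e = 0 \<or> D (Suc i) e = - (\<Sum>j=1..i. D j e)" if e: "e \<in> Es i" for e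
  proof -
    have i1: "1 \<le> i" using e by (cases i) (auto simp: Es_def)
    note st = step[OF i1 i]
    have b: "bd (Suc i) = set (pe (Suc i)) \<union> set (pq (Suc i))" using face_frontier(7)[of "Suc i"] i i1 by auto
    have en: "e \<notin> set (pe (Suc i))" using handle(7)[OF i] e by blast
    show ?thesis
    proof (cases "e \<in> bd (Suc i)")
      case False
      then show ?thesis by (simp add: D_def cvec_abs(2))
    next
      case True
      then have "e \<in> set (pq (Suc i))" using b en by blast
      \<comment> \<open>The edge belongs to the covered part of the old periphery, so its new outer
        value is 0, and the new face must cancel the old one.\<close>
      then have "e \<notin> periphery (Gs (Suc i))" using ear_stepD(10,12)[OF st] en by blast
      then have "cvec (periphery (Gs (Suc i))) e = 0" by (rule cvec_abs(2))
      moreover have "cvec (periphery (Gs (Suc i))) e = D (Suc i) e + cvec (periphery (Gs i)) e"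
        using ear_stepD(20)[OF st] b unfolding D_def by simp
      ultimately show ?thesis using sum_D[OF i1, of e] i by simp
    qed
  qed
qed

end

section \<open>The minimal matching and the coding\<close>

context rfd_graph
begin

lemma Vn: "Vs n = verts G" "Es n = edges G"
  using n1 Gn by (auto simp: Vs_def Es_def)

lemma cvec_balanced:
  assumes "C \<in> cycles G" shows "balanced (ends G) 0 (verts G) (edges G) (cvec C)"
  using cvec_balance[OF assms] cycle_edges(1)[OF assms] cvec_abs(2)[of _ C]
  by (auto simp: balanced_def subset_iff)

lemma face_height:
  assumes C: "C \<in> cycles G"
  shows "cvec C = span n (\<lambda>k. of_bool (s k \<subseteq> inside (\<Union>C)))"
proof -
  obtain h where h: "cvec C = span n h"
    using spanning[of n "cvec C"] cvec_balanced[OF C] Vn by auto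
  have "h k = of_bool (s k \<subseteq> inside (\<Union>C))" if k: "k \<in> {1..n}" for k
  proof -
    have k': "1 \<le> k" "k \<le> n" using k by auto
    obtain z where z: "z \<in> s k" using face_nonempty(1)[OF k'] by blast
    have free: "s k \<inter> drawing G = {}" using face_persists[OF k' order_refl] Gn by simp
    have zn: "z \<notin> \<Union>X" if "X \<subseteq> edges G" for X using free z that unfolding drawing_def by blast
    have wj: "wn (D j) z = (if j = k then -1 else 0)" if j: "j \<in> {1..n}" for j
    proof -
      have j': "1 \<le> j" "j \<le> n" using j by auto
      have "z \<in> s j \<longleftrightarrow> j = k"
        using faces_disjoint[of j k] faces_disjoint[of k j] k' j' z by (cases j k rule: linorder_cases) auto
      moreover have "z \<notin> \<Union>(bd j)" using zn cycle_edges(1)[OF face_frontier(3)[OF j']] by blast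
      ultimately show ?thesis
        using wn_cvec[OF face_frontier(3)[OF j'], of z] face_frontier(4)[OF j'] by (simp add: D_def)
    qed
    have sp: "cvec C = (\<lambda>e. \<Sum>j=1..n. h j * D j e)" using h by (auto simp: span_def)
    have "wn (cvec C) z = (\<Sum>j=1..n. of_int (h j) * wn (D j) z)"
      unfolding sp wn_sum wn_scale by (rule refl)
    also have "\<dots> = (\<Sum>j=1..n. if j = k then - of_int (h k) else 0)"
      by (intro sum.cong) (auto simp: wj)
    also have "\<dots> = - of_int (h k)" using k by (simp add: sum.delta)
    finally have w: "wn (cvec C) z = - of_int (h k)" .
    have "z \<notin> \<Union>C" using zn cycle_edges(1)[OF C] by blast
    then have "wn (cvec C) z = (if z \<in> inside (\<Union>C) then -1 else 0)" by (rule wn_cvec[OF C])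
    then have "of_int (h k) = (of_int (of_bool (z \<in> inside (\<Union>C))) :: complex)" using w by auto
    then have hk: "h k = of_bool (z \<in> inside (\<Union>C))" by (simp only: of_int_eq_iff)
    \<comment> \<open>The face misses the drawing, so it lies entirely inside \<open>C\<close> or
      has no point there: the single point \<open>z\<close> decides.\<close>
    obtain p q where pq: "arc_pair p q" "\<Union>C = path_image p \<union> path_image q" using cycle_jordan[OF C] .
    have "s k \<inter> \<Union>C = {}" using free cycle_edges(1)[OF C] unfolding drawing_def by blast
    then have "s k \<subseteq> inside (\<Union>C) \<or> s k \<inter> inside (\<Union>C) = {}"
      using component_inside_or_avoids[OF pq(1) face_nonempty(2)[OF k']] pq(2) by simp
    then have "s k \<subseteq> inside (\<Union>C) \<longleftrightarrow> z \<in> inside (\<Union>C)" using z by blast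
    then show ?thesis using hk by simp
  qed
  then show ?thesis unfolding h span_def by (intro ext sum.cong) auto
qed

definition B :: "complex set set" where "B = {e. base n e = 1}"

lemma B: "B \<in> perfect_matchings G"
  unfolding B_def using base_balanced[of n] base_01[of n] Vn by (intro balanced_matching) auto

lemma base_B: "base n e = of_bool (e \<in> B)"
  using base_01[of n e] by (auto simp: B_def)

lemma outer_periphery: "outer n e = cvec (periphery G) e"
  using sum_D[of n e] n1 Gn by (simp add: outer_def)

lemma span_cong: "(\<And>j. j \<in> {1..i} \<Longrightarrow> h j = k j) \<Longrightarrow> span i h = span i k"
  unfolding span_def by (intro ext sum.cong) auto

lemma comb_cong:
  assumes "\<And>j. j \<in> {1..i} \<Longrightarrow> h j = k j"
  shows "comb i h = comb i k"
proof -
  have "span i h = span i k" by (rule span_cong) (rule assms)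
  then show ?thesis by (simp add: comb_def fun_eq_iff)
qed

context
  assumes forcing: "infinite_face_forcing G"
begin

text \<open>The common edges on the periphery already cover all its vertices. What remains of either
  matching is a perfect matching of the graph without these vertices, and forcing makes that
  unique.\<close>

lemma forcing_unique:
  assumes m: "balanced (ends G) 1 (verts G) (edges G) m" "\<And>e. m e \<in> {0, 1}"
    and agree: "\<And>e. e \<in> periphery G \<Longrightarrow> m e = base n e"
  shows "m = base n"
proof -
  define M where "M = {e. m e = 1}"
  have M: "M \<in> perfect_matchings G" unfolding M_def by (rule balanced_matching[OF m])
  define C where "C = periphery G"
  define X where "X = periphery_verts G"
  have C: "C \<in> cycles G" using forcing by (simp add: infinite_face_forcing_def C_def)
  have X: "X = verts G \<inter> \<Union>C" using forcing by (simp add: infinite_face_forcing_def C_def X_def periphery_verts_def)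
  have CB: "e \<in> B \<longleftrightarrow> cvec C e = -1" if "e \<in> C" for e
  proof -
    have eE: "e \<in> edges G" using that cycle_edges(1)[OF C] by blast
    have "outer n e = cvec C e" by (simp add: outer_periphery C_def)
    then show ?thesis using base_outer[of n e] cvec_abs(1)[OF that] eE Vn by (auto simp: B_def)
  qed
  have CM: "e \<in> M \<longleftrightarrow> e \<in> B" if "e \<in> C" for e
    using agree[of e] that unfolding C_def M_def B_def by simp
  \<comment> \<open>If no periphery edge at \<open>x\<close> were in \<open>B\<close>, all clockwise
    values at \<open>x\<close> would be non-negative and at least one of them 1, against the zero
    sum of a circulation.\<close>
  have cover: "\<exists>e\<in>C. e \<in> B \<and> x \<in> ends G e" if x: "x \<in> X" for x
  proof (rule ccontr)
    assume none: "\<not> ?thesis"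
    obtain e where e: "e \<in> C" "x \<in> ends G e" using x X by (auto simp: ends_def)
    have pos: "cvec C e' \<ge> 0" if "x \<in> ends G e'" for e'
    proof (cases "e' \<in> C")
      case True
      then show ?thesis using none that CB[of e'] cvec_abs(1)[of e' C] by auto
    next
      case False
      then show ?thesis by (simp add: cvec_abs(2))
    qed
    have eE: "e \<in> edges G" using e cycle_edges(1)[OF C] by blast
    have "cvec C e = 1" using none e CB[of e] cvec_abs(1)[of e C] by auto
    then have "0 < (\<Sum>e | e \<in> edges G \<and> x \<in> ends G e. cvec C e)"
      using e eE pos finite_edges by (intro sum_pos2[of _ e]) auto
    then show False using cvec_balance[OF C, of x] by simp
  qed
  have touch: "e \<in> C \<and> e \<in> B" if e: "e \<in> N" "x \<in> e" "x \<in> X"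
    and N: "N \<in> perfect_matchings G" "\<And>e. e \<in> C \<Longrightarrow> e \<in> N \<longleftrightarrow> e \<in> B" for e x N
  proof -
    obtain e' where e': "e' \<in> C" "e' \<in> B" "x \<in> ends G e'" using cover[OF e(3)] by blast
    have xV: "x \<in> verts G" using e(3) X by blast
    have "x \<in> ends G e" using e(2) xV by (simp add: ends_def)
    moreover have "e' \<in> N" using N(2) e' by blast
    ultimately have "e = e'" using matching_edge[OF N(1) xV] e(1) e'(3) by metis
    then show ?thesis using e' by simp
  qed
  let ?H = "delete_verts G X"
  define inner where "inner N = {e \<in> N. e \<inter> X = {}}" for N :: "complex set set"
  have inner: "inner N \<in> perfect_matchings ?H"
    if N: "N \<in> perfect_matchings G" "\<And>e. e \<in> C \<Longrightarrow> e \<in> N \<longleftrightarrow> e \<in> B" for N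
    unfolding perfect_matchings_def
  proof (intro CollectI conjI ballI)
    show "inner N \<subseteq> edges ?H"
      using N(1) unfolding inner_def perfect_matchings_def delete_verts_def by auto
    fix v assume "v \<in> verts ?H"
    then have v: "v \<in> verts G" "v \<notin> X" by (auto simp: delete_verts_def)
    have en: "v \<in> ends ?H e \<longleftrightarrow> v \<in> ends G e" for e using v by (auto simp: ends_def delete_verts_def)
    obtain e where e: "e \<in> N" "v \<in> ends G e" "\<And>e'. e' \<in> N \<Longrightarrow> v \<in> ends G e' \<Longrightarrow> e' = e"
      using matching_edge[OF N(1) v(1)] by blast
    have "e \<inter> X = {}"
    proof (rule ccontr)
      assume "e \<inter> X \<noteq> {}"
      then obtain x where "x \<in> e" "x \<in> X" by blast
      then have "e \<in> C" using touch[OF e(1) _ _ N] by blast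
      then have "v \<in> X" using e(2) X unfolding ends_def by blast
      then show False using v by simp
    qed
    then show "\<exists>!e. e \<in> inner N \<and> v \<in> ends ?H e"
      unfolding en inner_def using e(1,2) e(3) by blast
  qed
  have "inner M = inner B"
  \<comment> \<open>Forcing gives uniqueness only when there are inner vertices. Without them an
    edge avoiding \<open>X\<close> would have no end at all, so both remainders are empty.\<close>
  proof (cases "verts G - X = {}")
    case True
    have "inner N = {}" if N: "N \<in> perfect_matchings G" for N
    proof (rule ccontr)
      assume "inner N \<noteq> {}"
      then obtain e where e: "e \<in> N" "e \<inter> X = {}" by (auto simp: inner_def)
      then have "e \<in> edges G" using N by (auto simp: perfect_matchings_def)
      then have "pathstart (earc e) \<in> ends G e" using earc(3) by blast
      then show False using e(2) True by (auto simp: ends_def)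
    qed
    then show ?thesis using M B by simp
  next
    case False
    then have "\<exists>!M. M \<in> perfect_matchings ?H"
      using forcing unfolding infinite_face_forcing_def X_def by blast
    moreover have "inner M \<in> perfect_matchings ?H" by (rule inner[OF M CM])
    moreover have "inner B \<in> perfect_matchings ?H" by (rule inner[OF B]) simp
    ultimately show ?thesis by blast
  qed
  have "M = B"
  proof (rule set_eqI)
    fix e
    show "e \<in> M \<longleftrightarrow> e \<in> B"
    proof (cases "e \<inter> X = {}")
      case True
      then show ?thesis using \<open>inner M = inner B\<close> unfolding inner_def by blast
    next
      case False
      then obtain x where x: "x \<in> e" "x \<in> X" by blast
      have "e \<in> M \<Longrightarrow> e \<in> C" using touch[OF _ x M CM] by blast
      moreover have "e \<in> B \<Longrightarrow> e \<in> C" using touch[OF _ x B] by blast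
      ultimately show ?thesis using CM by blast
    qed
  qed
  then have "m e = base n e" for e
    using m(2)[of e] base_B[of e] unfolding M_def by (auto simp: set_eq_iff)
  then show ?thesis by blast
qed

lemma comb_heights:
  assumes "\<And>e. comb n h e \<in> {0, 1}" "j \<in> {1..n}"
  shows "h j \<in> {0, 1}"
proof (rule heights_01[OF _ assms])
  fix m assume m: "balanced (ends G) 1 (Vs n) (Es n) m" "\<And>e. m e \<in> {0, 1}"
    "\<And>e. e \<in> Es n \<Longrightarrow> outer n e \<noteq> 0 \<Longrightarrow> m e = base n e"
  show "m = base n"
  proof (rule forcing_unique)
    show "balanced (ends G) 1 (verts G) (edges G) m" using m(1) Vn by simp
    fix e assume e: "e \<in> periphery G"
    then have "outer n e \<noteq> 0" using cvec_abs(1)[OF e] by (auto simp: outer_periphery)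
    moreover have "e \<in> Es n" using e Vn by (auto simp: periphery_def face_edges_def)
    ultimately show "m e = base n e" using m(3) by blast
  qed (rule m(2))
qed

lemma B_no_proper: "\<not> proper_cycle G col B C"
proof
  assume p: "proper_cycle G col B C"
  then have "C \<in> alternating_cycles G B" by (simp add: proper_cycle_def)
  then have "C \<noteq> {}" by (auto simp: alternating_cycles_def is_cycle_def)
  then obtain e0 where e0: "e0 \<in> C" by blast
  note C = proper_cycle_cvec(1)[OF p e0]
  \<comment> \<open>Rotating \<open>B\<close> along a proper cycle lowers each enclosed face by 1.
    The heights of the resulting matching must be in \<open>{0, 1}\<close>, so no face is enclosed
    and \<open>cvec C\<close> vanishes, which is absurd.\<close>
  let ?h = "\<lambda>k. - of_bool (s k \<subseteq> inside (\<Union>C)) :: int"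
  have "comb n ?h e = of_bool (e \<in> B) - cvec C e" for e
    unfolding comb_def base_B face_height[OF C] by (simp add: span_def sum_negf)
  moreover have "of_bool (e \<in> B) - cvec C e \<in> {0, 1}" for e
    using proper_cycle_cvec(2)[OF p, of e] cvec_abs(2)[of e C] by (cases "e \<in> C") auto
  ultimately have "comb n ?h e \<in> {0, 1}" for e by simp
  then have h: "?h k \<in> {0, 1}" if "k \<in> {1..n}" for k by (rule comb_heights) (use that in auto)
  have "\<not> s k \<subseteq> inside (\<Union>C)" if "k \<in> {1..n}" for k using h[OF that] by auto
  then have "cvec C e0 = 0" unfolding face_height[OF C] span_def by (intro sum.neutral) auto
  then show False using cvec_abs(1)[OF e0] by auto
qed

text \<open>Of the two signs left open by \<open>sym_diff_cycle\<close>, the opposite one would make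
  \<open>C\<close> a proper \<open>B\<close>-alternating cycle.\<close>

lemma sym_diff_cvec:
  assumes M: "M \<in> perfect_matchings G" and C: "C \<in> cycles G" "C \<subseteq> sym_diff M B" and e: "e \<in> C"
  shows "cvec C e = of_bool (e \<in> M) - of_bool (e \<in> B)"
proof (rule ccontr)
  assume n: "\<not> ?thesis"
  then have c: "\<forall>e\<in>C. cvec C e = of_bool (e \<in> B) - of_bool (e \<in> M)"
    using sym_diff_cycle(2)[OF M B C] e by blast
  have "C \<subseteq> sym_diff B M" using C(2) by blast
  then have "C \<in> alternating_cycles G B" by (rule sym_diff_cycle(1)[OF B M C(1)])
  moreover have "white_to_black col C {e}" if "e \<in> C \<inter> B" for e
  proof -
    have "cvec C e = 1" using c that C(2) by auto
    then show ?thesis using that by (auto simp: cvec_def split: if_splits)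
  qed
  ultimately have "proper_cycle G col B C" unfolding proper_cycle_def by blast
  then show False using B_no_proper by blast
qed

text \<open>Any other perfect matching \<open>M\<close> differs from \<open>B\<close> along some
  cycle. By \<open>sym_diff_cvec\<close> its \<open>M\<close>-edges run clockwise from white to
  black, so that cycle is proper for \<open>M\<close>.\<close>

lemma M0_eq: "M0 G col = B"
  unfolding M0_def
proof (rule the_equality)
  show "B \<in> perfect_matchings G \<and> (\<nexists>C. proper_cycle G col B C)" using B B_no_proper by blast
  fix M assume M: "M \<in> perfect_matchings G \<and> (\<nexists>C. proper_cycle G col M C)"
  show "M = B"
  proof (rule ccontr)
    assume "M \<noteq> B"
    then have "sym_diff M B \<noteq> {}" by blast
    then obtain C where C: "C \<in> cycles G" "C \<subseteq> sym_diff M B"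
      using deg02_ex_cycle[OF sym_diff_deg02] M B by blast
    have "C \<in> alternating_cycles G M" using sym_diff_cycle(1)[OF _ B C] M by blast
    moreover have "white_to_black col C {e}" if "e \<in> C \<inter> M" for e
    proof -
      have "cvec C e = 1" using sym_diff_cvec[OF _ C] that C(2) M by auto
      then show ?thesis using that by (auto simp: cvec_def split: if_splits)
    qed
    ultimately have "proper_cycle G col M C" unfolding proper_cycle_def by blast
    then show False using M by blast
  qed
qed

lemma matching_phi:
  assumes M: "M \<in> perfect_matchings G"
  shows "of_bool (e \<in> M) = comb n (\<lambda>k. int (phi G col M (s k))) e"
proof -
  define S where "S = {C \<in> cycles G. C \<subseteq> sym_diff M B}"
  have fin: "finite S"
  proof -
    have "S \<subseteq> Pow (edges G)" using cycle_edges(1) by (auto simp: S_def)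
    then show ?thesis using finite_edges finite_subset by blast
  qed
  \<comment> \<open>The cycles in the symmetric difference partition it, so at most one summand is
    non-zero on a given edge, and its sign is known.\<close>
  have "of_bool (e \<in> M) - of_bool (e \<in> B) = (\<Sum>C\<in>S. cvec C e)"
  proof (cases "e \<in> sym_diff M B")
    case True
    obtain C where C: "C \<in> cycles G" "C \<subseteq> sym_diff M B" "e \<in> C"
      using deg02_cover[OF sym_diff_deg02[OF M B] True] by blast
    have "cvec C' e = 0" if "C' \<in> S - {C}" for C'
    proof (rule cvec_abs(2))
      show "e \<notin> C'"
      proof
        assume e': "e \<in> C'"
        have "C' \<in> cycles G" "C' \<subseteq> sym_diff M B" using that by (auto simp: S_def)
        then have "C' = C"
          using deg02_cycle_unique[OF sym_diff_deg02[OF M B]] C e' by (metis subset_antisym)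
        then show False using that by simp
      qed
    qed
    then have "(\<Sum>C\<in>S. cvec C e) = (\<Sum>C\<in>{C}. cvec C e)"
      using C fin by (intro sum.mono_neutral_right) (auto simp: S_def)
    then show ?thesis using sym_diff_cvec[OF M C] by simp
  next
    case False
    then have "(\<Sum>C\<in>S. cvec C e) = 0" by (intro sum.neutral) (auto simp: S_def intro: cvec_abs(2))
    then show ?thesis using False by auto
  qed
  also have "\<dots> = (\<Sum>C\<in>S. \<Sum>k=1..n. of_bool (s k \<subseteq> inside (\<Union>C)) * D k e)"
  proof (intro sum.cong refl)
    fix C assume "C \<in> S"
    then have "C \<in> cycles G" by (simp add: S_def)
    from fun_cong[OF face_height[OF this], of e]
    show "cvec C e = (\<Sum>k=1..n. of_bool (s k \<subseteq> inside (\<Union>C)) * D k e)" by (simp add: span_def)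
  qed
  \<comment> \<open>Summing over the cycles first makes the coefficient of \<open>D k\<close> the
    number of cycles around \<open>s k\<close>, which is \<open>phi\<close> because
    \<open>M0\<close> is \<open>B\<close>.\<close>
  also have "\<dots> = (\<Sum>k=1..n. \<Sum>C\<in>S. of_bool (s k \<subseteq> inside (\<Union>C)) * D k e)" by (rule sum.swap)
  also have "\<dots> = (\<Sum>k=1..n. int (phi G col M (s k)) * D k e)"
  proof (intro sum.cong refl)
    fix k
    have "(\<Sum>C\<in>S. of_bool (s k \<subseteq> inside (\<Union>C)) * D k e) = (\<Sum>C\<in>S. of_bool (s k \<subseteq> inside (\<Union>C))) * D k e"
      by (simp only: sum_distrib_right)
    also have "(\<Sum>C\<in>S. of_bool (s k \<subseteq> inside (\<Union>C))) = int (card {C \<in> S. s k \<subseteq> inside (\<Union>C)})"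
      using fin by (simp add: Int_def)
    also have "{C \<in> S. s k \<subseteq> inside (\<Union>C)} = {C \<in> cycles G. C \<subseteq> sym_diff M (M0 G col) \<and> s k \<subseteq> inside (\<Union>C)}"
      unfolding S_def M0_eq by blast
    finally show "(\<Sum>C\<in>S. of_bool (s k \<subseteq> inside (\<Union>C)) * D k e) = int (phi G col M (s k)) * D k e"
      by (simp only: phi_def)
  qed
  finally show ?thesis unfolding comb_def base_B span_def by (simp add: algebra_simps)
qed

end

section \<open>Codes and the recursion of the algorithm\<close>

definition digit :: "nat list \<Rightarrow> nat \<Rightarrow> int" where
  "digit x j = int (x ! (j - 1))"

definition codes :: "nat \<Rightarrow> nat list set" where
  "codes i = {x. length x = i \<and> set x \<subseteq> {0, 1} \<and> (\<forall>e. comb i (digit x) e \<in> {0, 1})}"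

lemma digit_append: "j \<in> {1..length x} \<Longrightarrow> digit (x @ y) j = digit x j"
  by (auto simp: digit_def nth_append)

lemma digit_01: "set x \<subseteq> {0, 1} \<Longrightarrow> j \<in> {1..length x} \<Longrightarrow> digit x j \<in> {0, 1}"
proof -
  assume a: "set x \<subseteq> {0, 1}" "j \<in> {1..length x}"
  then have "x ! (j - 1) \<in> set x" by (intro nth_mem) auto
  then have "x ! (j - 1) = 0 \<or> x ! (j - 1) = 1" using a(1) by blast
  then show ?thesis by (auto simp: digit_def)
qed

text \<open>\<open>comb_Suc_01\<close> read for digit strings: \<open>d\<close> is the constrained
  digit, equal to 1 iff the end edges of the new ear run clockwise from white to black around the
  new face, and faces are adjacent iff their boundaries share an edge.\<close>

lemma append_in_codes:
  assumes i: "i < n" and x: "length x = i" "set x \<subseteq> {0, 1}" and b: "b \<in> {0, 1}"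
  defines "d \<equiv> of_bool (D (Suc i) (pe (Suc i) ! 0) = 1)"
  shows "x @ [b] \<in> codes (Suc i) \<longleftrightarrow> x \<in> codes i \<and>
    (b = d \<longrightarrow> (\<forall>j\<in>{1..i}. bd j \<inter> bd (Suc i) \<noteq> {} \<longrightarrow> x ! (j - 1) = d))"
proof -
  have xb: "set (x @ [b]) \<subseteq> {0, 1}" "length (x @ [b]) = Suc i" using x b by auto
  have lt: "digit (x @ [b]) j = digit x j" if "j \<in> {1..i}" for j
    using that x(1) by (intro digit_append) simp
  have eqd: "(digit (x @ [b]) j = int d) = (x ! (j - 1) = d)" if "j \<in> {1..i}" for j
    using lt[OF that] by (simp add: digit_def)
  have last: "digit (x @ [b]) (Suc i) = int b" using x(1) by (simp add: digit_def nth_append)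
  have adj: "(\<exists>e\<in>Es (Suc i). D j e \<noteq> 0 \<and> D (Suc i) e \<noteq> 0) \<longleftrightarrow> bd j \<inter> bd (Suc i) \<noteq> {}" for j
  proof -
    have "e \<in> bd j \<longleftrightarrow> D j e \<noteq> 0" for j e
      using cvec_abs[of e "bd j"] by (cases "e \<in> bd j") (auto simp: D_def)
    moreover have "bd (Suc i) \<subseteq> Es (Suc i)" using face_frontier(2)[of "Suc i"] i by (simp add: Es_def)
    ultimately show ?thesis by blast
  qed
  have "(\<forall>e. comb (Suc i) (digit (x @ [b])) e \<in> {0, 1}) \<longleftrightarrow>
    (\<forall>e. comb i (digit (x @ [b])) e \<in> {0, 1}) \<and>
    (digit (x @ [b]) (Suc i) = int d \<longrightarrow> (\<forall>j\<in>{1..i}.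
       (\<exists>e\<in>Es (Suc i). D j e \<noteq> 0 \<and> D (Suc i) e \<noteq> 0) \<longrightarrow> digit (x @ [b]) j = int d))"
    unfolding d_def of_nat_of_bool
    by (rule comb_Suc_01[OF i]) (use digit_01[OF xb(1)] xb(2) in simp)
  also have "comb i (digit (x @ [b])) = comb i (digit x)" by (rule comb_cong) (rule lt)
  finally show ?thesis
    unfolding codes_def adj last using x xb eqd by auto
qed

lemma codes_Suc:
  assumes "i < n"
  shows "codes (Suc i) = {x @ [b] |x b. b \<in> {0, 1} \<and> x \<in> codes i \<and> x @ [b] \<in> codes (Suc i)}"
proof (rule set_eqI)
  fix y
  show "y \<in> codes (Suc i) \<longleftrightarrow> y \<in> {x @ [b] |x b. b \<in> {0, 1} \<and> x \<in> codes i \<and> x @ [b] \<in> codes (Suc i)}"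
  proof
    assume y: "y \<in> codes (Suc i)"
    then have l: "length y = Suc i" "set y \<subseteq> {0, 1}" by (auto simp: codes_def)
    then obtain x b where xb: "y = x @ [b]" by (cases y rule: rev_cases) auto
    have xx: "length x = i" "set x \<subseteq> {0, 1}" "b \<in> {0, 1}" using l xb by auto
    have "x \<in> codes i" using append_in_codes[OF assms xx] y xb by blast
    then show "y \<in> {x @ [b] |x b. b \<in> {0, 1} \<and> x \<in> codes i \<and> x @ [b] \<in> codes (Suc i)}"
      using xb xx y by blast
  qed blast
qed

lemma algorithm_codes: "1 \<le> i \<Longrightarrow> i \<le> n \<Longrightarrow> algorithm_L col Gs s i = codes i"
proof (induction i)
  case (Suc i)
  then have i: "i < n" by auto
  \<comment> \<open>The digit \<open>1 - d\<close> is always allowed. If \<open>b = d\<close>, the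
    neighbours must have digit \<open>b\<close> itself, so both branches of the algorithm obey one
    formula.\<close>
  have app: "x @ [b] \<in> codes (Suc i) \<longleftrightarrow> b = 1 - of_bool (D (Suc i) (pe (Suc i) ! 0) = 1) \<or>
     (\<forall>j\<in>{1..i}. bd j \<inter> bd (Suc i) \<noteq> {} \<longrightarrow> x ! (j - 1) = b)"
    if "x \<in> codes i" "b \<in> {0, 1}" for x b
    using append_in_codes[OF i _ _ that(2), of x] that by (auto simp: codes_def)
  show ?case
  proof (cases i)
    case 0
    \<comment> \<open>With the empty string as the only code of the empty graph, the first face is a
      step without neighbours, and both digits are allowed.\<close>
    have "[] \<in> codes 0" by (auto simp: codes_def comb_def span_def)
    moreover have "codes 0 \<subseteq> {[]}" by (auto simp: codes_def)
    ultimately have c0: "codes 0 = {[]}" by blast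
    have "codes (Suc 0) = {[0], [1]}"
      using codes_Suc[of 0] app[unfolded 0] i 0 c0 by auto
    then show ?thesis using 0 by simp
  next
    case (Suc k)
    then have i1: "1 \<le> i" by simp
    note st = ear_stepD[OF step[OF i1 i]]
    let ?H = "Gs (Suc i)"
    have IH: "algorithm_L col Gs s i = codes i" using Suc.IH i1 i by simp
    have b: "bd (Suc i) = set (pe (Suc i)) \<union> set (pq (Suc i))" using face_frontier(7)[of "Suc i"] i i1 by auto
    have feH: "face_edges ?H (s j) = bd j" if "j \<in> {1..Suc i}" for j
      using face_edges_Gs[of j "Suc i"] that i by simp
    \<comment> \<open>The covered part \<open>pq\<close> has left the periphery, so the new face
      shares exactly the ear with it.\<close>
    have P: "face_edges ?H (s (Suc i)) \<inter> periphery ?H = set (pe (Suc i))"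
      unfolding feH[of "Suc i", simplified] b st(10) using st(12) by blast
    obtain vsr where pp: "path_pair G (pv (Suc i)) (pe (Suc i)) vsr (pr (Suc i))" using st(13) by blast
    have e0: "pe (Suc i) ! 0 \<in> set (pe (Suc i))" using st(2) by (intro nth_mem) (auto intro: odd_pos)
    then have "pe (Suc i) ! 0 \<notin> periphery (Gs i)" using st(6) by (auto simp: periphery_def face_edges_def)
    \<comment> \<open>The algorithm looks at the orientation of the new periphery, the recursion at
      that of the new face. On the ear they agree, since the old periphery contributes nothing
      there.\<close>
    then have "cvec (periphery ?H) (pe (Suc i) ! 0) = D (Suc i) (pe (Suc i) ! 0)"
      using st(20) b by (simp add: D_def cvec_abs(2))
    then have wtb: "white_to_black col (periphery ?H) (face_edges ?H (s (Suc i)) \<inter> periphery ?H) \<longleftrightarrow>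
      D (Suc i) (pe (Suc i) ! 0) = 1"
      using white_to_black_path[OF pp st(2)] unfolding P unfolding st(10) by simp
    have adj: "adjacent_digits_eq Gs s i d x \<longleftrightarrow>
      (\<forall>j\<in>{1..i}. bd j \<inter> bd (Suc i) \<noteq> {} \<longrightarrow> x ! (j - 1) = d)" for d x
    proof -
      have "s j \<in> finite_faces (Gs i)" if "j \<in> {1..i}" for j
        using face_in_finite_faces[of j i] that i by simp
      then show ?thesis unfolding adjacent_digits_eq_def using feH i1 by auto
    qed
    have alg: "algorithm_L col Gs s (Suc i) = (if D (Suc i) (pe (Suc i) ! 0) = 1
         then {x @ [0] |x. x \<in> codes i} \<union> {x @ [1] |x. x \<in> codes i \<and> adjacent_digits_eq Gs s i 1 x}
         else {x @ [1] |x. x \<in> codes i} \<union> {x @ [0] |x. x \<in> codes i \<and> adjacent_digits_eq Gs s i 0 x})"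
      using wtb IH unfolding \<open>i = Suc k\<close> algorithm_L.simps(3) Let_def by simp
    define c where "c \<longleftrightarrow> D (Suc i) (pe (Suc i) ! 0) = 1"
    have a0: "x @ [0] \<in> codes (Suc i) \<longleftrightarrow> c \<or> adjacent_digits_eq Gs s i 0 x" if "x \<in> codes i" for x
      unfolding adj c_def using app[OF that, of 0] by auto
    have a1: "x @ [1] \<in> codes (Suc i) \<longleftrightarrow> \<not> c \<or> adjacent_digits_eq Gs s i 1 x" if "x \<in> codes i" for x
      unfolding adj c_def using app[OF that, of 1] by auto
    have "codes (Suc i) = {x @ [0] |x. x \<in> codes i \<and> x @ [0] \<in> codes (Suc i)} \<union>
      {x @ [1] |x. x \<in> codes i \<and> x @ [1] \<in> codes (Suc i)}"
      by (subst codes_Suc[OF i]) blast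
    also have "{x @ [0] |x. x \<in> codes i \<and> x @ [0] \<in> codes (Suc i)} =
      {x @ [0] |x. x \<in> codes i \<and> (c \<or> adjacent_digits_eq Gs s i 0 x)}" using a0 by blast
    also have "{x @ [1] |x. x \<in> codes i \<and> x @ [1] \<in> codes (Suc i)} =
      {x @ [1] |x. x \<in> codes i \<and> (\<not> c \<or> adjacent_digits_eq Gs s i 1 x)}" using a1 by blast
    finally show ?thesis unfolding alg c_def[symmetric] by (cases c) auto
  qed
qed simp

text \<open>By \<open>matching_phi\<close> the digits of \<open>phi_string\<close> are the heights
  of the matching, so \<open>comb\<close> recovers the matching from its string. Conversely a code
  defines a matching through \<open>comb\<close>, and independence of the boundaries shows that its
  string is the given code.\<close>

lemma codes_bij:
  assumes forcing: "infinite_face_forcing G"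
  shows "bij_betw (phi_string G col n s) (perfect_matchings G) (codes n)"
  unfolding bij_betw_def
proof
  let ?f = "phi_string G col n s"
  have dig: "digit (?f M) j = int (phi G col M (s j))" if "j \<in> {1..n}" for M j
    using that by (auto simp: digit_def phi_string_def simp del: upt_Suc)
  have len: "length (?f M) = n" for M by (simp add: phi_string_def)
  have cmb: "comb n (digit (?f M)) e = of_bool (e \<in> M)" if "M \<in> perfect_matchings G" for M e
  proof -
    have "comb n (digit (?f M)) = comb n (\<lambda>k. int (phi G col M (s k)))" by (rule comb_cong) (rule dig)
    then show ?thesis using matching_phi[OF forcing that] by simp
  qed
  show "inj_on ?f (perfect_matchings G)"
  proof (rule inj_onI)
    fix M N assume MN: "M \<in> perfect_matchings G" "N \<in> perfect_matchings G" "?f M = ?f N"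
    have "e \<in> M \<longleftrightarrow> e \<in> N" for e
      using cmb[OF MN(1), of e] cmb[OF MN(2), of e] MN(3) by (auto split: if_splits)
    then show "M = N" by blast
  qed
  show "?f ` perfect_matchings G = codes n"
  proof
    show "?f ` perfect_matchings G \<subseteq> codes n"
    proof
      fix x assume "x \<in> ?f ` perfect_matchings G"
      then obtain M where M: "M \<in> perfect_matchings G" "x = ?f M" by blast
      have c: "comb n (digit x) e \<in> {0, 1}" for e using cmb[OF M(1), of e] M(2) by simp
      have "set x \<subseteq> {0, 1}"
      proof
        fix a assume "a \<in> set x"
        then obtain k where k: "k < length x" "a = x ! k" by (auto simp: in_set_conv_nth)
        \<comment> \<open>That \<open>phi\<close> takes only the values 0 and 1 comes from the bound
          on the heights; the symmetric difference may a priori contain nested cycles.\<close>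
        then have "digit x (Suc k) \<in> {0, 1}" using comb_heights[OF forcing c, of "Suc k"] len M(2) by simp
        then show "a \<in> {0, 1}" using k by (auto simp: digit_def)
      qed
      then show "x \<in> codes n" using c len M(2) by (simp add: codes_def)
    qed
    show "codes n \<subseteq> ?f ` perfect_matchings G"
    proof
      fix x assume x: "x \<in> codes n"
      then have c: "\<And>e. comb n (digit x) e \<in> {0, 1}" and lx: "length x = n" by (auto simp: codes_def)
      define M where "M = {e. comb n (digit x) e = 1}"
      have M: "M \<in> perfect_matchings G"
        unfolding M_def using comb_balanced[of n "digit x"] Vn c by (intro balanced_matching) auto
      have "comb n (digit (?f M)) = comb n (digit x)"
      proof
        fix e
        show "comb n (digit (?f M)) e = comb n (digit x) e"
          using cmb[OF M, of e] c[of e] by (auto simp: M_def)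
      qed
      then have eq: "digit (?f M) j = digit x j" if "j \<in> {1..n}" for j using comb_inj that by blast
      have "?f M = x"
      proof (rule nth_equalityI)
        fix k assume "k < length (?f M)"
        then show "?f M ! k = x ! k" using eq[of "Suc k"] len by (simp add: digit_def)
      qed (simp add: len lx)
      then show "x \<in> ?f ` perfect_matchings G" using M by blast
    qed
  qed
qed

end

theorem theorem3p4:
  fixes G :: pgraph and col :: "complex \<Rightarrow> colour"
    and n :: nat and Gs :: "nat \<Rightarrow> pgraph" and s :: "nat \<Rightarrow> complex set"
  assumes "plane_graph G"
    and "proper_colouring G col"
    and "elementary G"
    and "infinite_face_forcing G"
    and "RFD G n Gs s"
    and "\<forall>i\<in>{2..n}. reducible_face (Gs i) (s i)"
  shows "algorithm_L col Gs s n \<subseteq> binary_strings n \<and>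
    bij_betw (phi_string G col n s) (perfect_matchings G) (algorithm_L col Gs s n)"
proof -
  interpret rfd_graph G col n Gs s by unfold_locales (use assms in auto)
  have "algorithm_L col Gs s n = codes n" by (rule algorithm_codes[OF n1 order_refl])
  then show ?thesis
    using codes_bij[OF assms(4)] by (auto simp: codes_def binary_strings_def)
qed

end
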